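(* Let $n,m\ge1$ be integers, $0<\alpha<nm$ and $\delta>0$. There is a constant $C>0$ such that for all weights $w_1,\dots,w_m$ on $\mathbb{R}^n$, with $u=\prod_{i=1}^m w_i^{1/m}$, and all $\vec f=(f_1,\dots,f_m)$, $$\|\mathcal{I}_\alpha\vec f\|_{L^{1/m,\infty}(u)}\le C\prod_{i=1}^m\int_{\mathbb{R}^n}|f_i|\,M_{\alpha/m}\bigl(M_{L(\log L)^\delta}(w_i)\bigr)\,dx,$$ and, in particular, $$\|\mathcal{I}_\alpha\vec f\|_{L^{1/m,\infty}(u)}\le C\prod_{i=1}^m\int_{\mathbb{R}^n}|f_i|\,M_{\alpha/m}\bigl(M^2(w_i)\bigr)\,dx.$$
   Context: A weight is a nonnegative measurable function on $\mathbb{R}^n$. Cubes have sides parallel to the axes. The multilinear fractional integral is $\mathcal{I}_\alpha\vec f(x)=\int_{(\mathbb{R}^n)^m}\frac{f_1(y_1)\cdots f_m(y_m)}{(|x-y_1|+\dots+|x-y_m|)^{mn-\alpha}}\,d\vec y$, for functions $f_i$ for which the integral converges (for instance Schwartz functions). $M f(x)=\sup_{Q\ni x}\frac1{|Q|}\int_Q|f|$ is the Hardy–Littlewood maximal operator, $M^2=M\circ M$, and for $0<\beta<n$, $M_\beta f(x)=\sup_{Q\ni x}\frac1{|Q|^{1-\beta/n}}\int_Q|f|$. $M_{L(\log L)^\delta}f(x)=\sup_{Q\ni x}\|f\|_{B,Q}$ with $B(t)=t(1+\log^+t)^\delta$ and $\|f\|_{B,Q}=\inf\{\lambda>0:\frac1{|Q|}\int_Q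 B(|f|/\lambda)\le1\}$. $\|F\|_{L^{r,\infty}(u)}=\sup_{\lambda>0}\lambda\,u(\{|F|>\lambda\})^{1/r}$, with $u(E)=\int_E u$. *)

theory Defs
  imports "HOL-Analysis.Analysis"
begin

text \<open>
  The dimension is \<open>n = CARD('n)\<close> and the number of functions is \<open>m = CARD('m)\<close>; a point of
  \<open>(R^n)^m\<close> is \<open>y :: real^'n^'m\<close>, with components \<open>y $ i\<close>. Measurability and integration
  refer to Lebesgue (not only Borel) measurable functions.
\<close>

definition weight :: "(real^'n \<Rightarrow> real) \<Rightarrow> bool" where
  "weight w \<longleftrightarrow> w \<in> borel_measurable lebesgue \<and> (\<forall>x. 0 \<le> w x)"

definition cubes :: "(real^'n) set set" where
  "cubes = {cbox a (\<chi> i. a $ i + l) | a l. l > 0}"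

text \<open>
  The maximal operators act on nonnegative functions with values in \<open>[0,\<infinity>]\<close>, so that they can be
  iterated without any local integrability assumption; for real \<open>f\<close> apply them to \<open>|f|\<close>.
\<close>

definition HL_maximal :: "(real^'n \<Rightarrow> ennreal) \<Rightarrow> real^'n \<Rightarrow> ennreal" where
  "HL_maximal f x =
     (SUP Q \<in> {Q \<in> cubes. x \<in> Q}. (\<integral>\<^sup>+ y \<in> Q. f y \<partial>lebesgue) / emeasure lebesgue Q)"

definition frac_maximal :: "real \<Rightarrow> (real^'n \<Rightarrow> ennreal) \<Rightarrow> real^'n \<Rightarrow> ennreal" where
  "frac_maximal \<beta> f x =
     (SUP Q \<in> {Q \<in> cubes. x \<in> Q}.
        (\<integral>\<^sup>+ y \<in> Q. f y \<partial>lebesgue) / ennreal (measure lebesgue Q powr (1 - \<beta> / real CARD('n))))"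

text \<open>Since \<open>ln 0 = 0\<close>, the formula gives \<open>B(0) = 0\<close>.\<close>

definition LlogL_young :: "real \<Rightarrow> real \<Rightarrow> real" where
  "LlogL_young \<delta> t = t * (1 + max 0 (ln t)) powr \<delta>"

text \<open>The infimum is taken in \<open>[0,\<infinity>]\<close>; it is \<open>\<infinity>\<close> if no \<open>t\<close> is admissible.\<close>

definition luxemburg_norm :: "(real \<Rightarrow> real) \<Rightarrow> (real^'n) set \<Rightarrow> (real^'n \<Rightarrow> real) \<Rightarrow> ennreal" where
  "luxemburg_norm B Q f =
     Inf {ennreal t | t. t > 0 \<and>
       (\<integral>\<^sup>+ y \<in> Q. ennreal (B (\<bar>f y\<bar> / t)) \<partial>lebesgue) / emeasure lebesgue Q \<le> 1}"

definition LlogL_maximal :: "real \<Rightarrow> (real^'n \<Rightarrow> real) \<Rightarrow> real^'n \<Rightarrow> ennreal" where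
  "LlogL_maximal \<delta> f x =
     (SUP Q \<in> {Q \<in> cubes. x \<in> Q}. luxemburg_norm (LlogL_young \<delta>) Q f)"

definition frac_kernel_integrand ::
    "real \<Rightarrow> ('m::finite \<Rightarrow> real^'n \<Rightarrow> complex) \<Rightarrow> real^'n \<Rightarrow> real^'n^'m \<Rightarrow> complex" where
  "frac_kernel_integrand \<alpha> f x y =
     (\<Prod>i\<in>UNIV. f i (y $ i)) /
     complex_of_real ((\<Sum>i\<in>UNIV. norm (x - y $ i)) powr (real CARD('m) * real CARD('n) - \<alpha>))"

definition multilinear_frac_integral ::
    "real \<Rightarrow> ('m::finite \<Rightarrow> real^'n \<Rightarrow> complex) \<Rightarrow> real^'n \<Rightarrow> complex" where
  "multilinear_frac_integral \<alpha> f x = (LINT y|lebesgue. frac_kernel_integrand \<alpha> f x y)"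

text \<open>
  The functions to which the operator applies: measurable, with the defining integral absolutely
  convergent at almost every point (the Bochner integral is \<open>0\<close> by convention elsewhere).
\<close>

definition frac_integral_domain ::
    "real \<Rightarrow> ('m::finite \<Rightarrow> real^'n \<Rightarrow> complex) set" where
  "frac_integral_domain \<alpha> =
     {f. (\<forall>i. f i \<in> borel_measurable lebesgue) \<and>
         (AE x in lebesgue. integrable lebesgue (frac_kernel_integrand \<alpha> f x))}"

text \<open>Powers of elements of \<open>[0,\<infinity>]\<close>, meant for exponents \<open>p > 0\<close>.\<close>

definition ennreal_powr :: "ennreal \<Rightarrow> real \<Rightarrow> ennreal" where
  "ennreal_powr a p = (if a = \<infinity> then \<infinity> else ennreal (enn2real a powr p))"

definition weighted_measure :: "(real^'n \<Rightarrow> real) \<Rightarrow> (real^'n) set \<Rightarrow> ennreal" where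
  "weighted_measure u E = (\<integral>\<^sup>+ x \<in> E. ennreal (u x) \<partial>lebesgue)"

definition weak_Lnorm ::
    "real \<Rightarrow> (real^'n \<Rightarrow> real) \<Rightarrow> (real^'n \<Rightarrow> complex) \<Rightarrow> ennreal" where
  "weak_Lnorm r u F =
     (SUP t \<in> {0<..}. ennreal t * ennreal_powr (weighted_measure u {x. norm (F x) > t}) (1 / r))"

end

theory Submission
  imports Defs
begin

text \<open>
  Put \<open>d = n - \<alpha>/m\<close>. The kernel is dominated by finitely many shifted dyadic grids: it suffices to
  treat \<open>x \<mapsto> \<Sum> a(Q)\<close>, the sum over the cubes \<open>Q\<close> of one grid containing \<open>x\<close>, where
  \<open>a(Q)\<close> is the product of the numbers \<open>side(Q)^(-d) \<integral>_Q |f_i|\<close>. The cubes with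
  \<open>a(Q)\<close> in \<open>(\<lambda>/2^(j+1), \<lambda>/2^j]\<close> split into boundedly many sparse families. If \<open>w\<close>
  is a weight and \<open>v = M_{L(log L)^\<delta>} w\<close>, then the part of \<open>Q\<close> lying in \<open>l\<close> further
  generations below \<open>Q\<close> has relative measure at most \<open>2^(-l)\<close>, hence \<open>w\<close>-measure at most
  \<open>C (1 + l)^(-\<delta>) |Q| inf_Q v\<close>. Summing this over all generations improves the decay by one power:
  the points of a maximal cube \<open>Q\<close> lying in \<open>q\<close> cubes of the family have \<open>w\<close>-measure at most
  \<open>C q^(-1-\<delta>) \<integral>_Q v\<close>. For \<open>v = M (M w)\<close> the same summation, applied twice, gives this with
  \<open>\<delta> = 1\<close>. Since \<open>1 + \<delta> > 1 \<ge> 1/m\<close>, the contributions of the windows are summable in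
  \<open>j\<close>. For a single window, Hoelder's inequality over the maximal cubes, where
  \<open>\<lambda>/2^(j+1) < a(Q)\<close>, produces the product of the integrals of \<open>|f_i| M_{\<alpha>/m} v_i\<close>.
\<close>

section \<open>Hoelder inequality and Fubini for products\<close>

text \<open>The second estimate is not deduced from the first by comparing maximal functions: L(log
  L)^\<delta> and M(M w) are both shown to satisfy one abstract condition, \<open>dominates\<close>,
  and the weak type argument sees the weights only through it. The target quasi-norm has no usable
  triangle inequality, so grids, windows and residue classes are split off on level sets, where the
  u-measures add up; each splitting costs a factor in the height. Neighbouring cells of one window
  can be of comparable size, so a window need not be sparse. Restricting to levels in one residue
  class modulo s repairs this: side^(-d) |Q| = side^(\<alpha>/m) then grows by at least 4m from one
  level of the class to the next. This is where \<alpha> > 0 enters. Each grid is cut off to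
  finitely many levels. Counts are then finite, maximal cells exist, and whatever is built from the
  grid is constant on the finest cells, hence measurable; no measurability of the full maximal
  functions is ever established. The constants do not depend on the cut-off, which is removed at the
  end.\<close>

lemma prod_le_mean_power:
  fixes x :: "'i::finite \<Rightarrow> real"
  assumes "\<And>i. 0 \<le> x i"
  shows "(\<Prod>i\<in>UNIV. x i) \<le> ((\<Sum>i\<in>UNIV. x i) / CARD('i)) ^ CARD('i)"
proof -
  define A where "A = (\<Sum>i\<in>UNIV. x i) / CARD('i)"
  have A0: "0 \<le> A" unfolding A_def by (simp add: assms sum_nonneg)
  show ?thesis
  proof (cases "A = 0")
    case True
    then have "(\<Sum>i\<in>UNIV. x i) = 0" by (simp add: A_def)
    then have "\<forall>i. x i = 0" using assms by (simp add: sum_nonneg_eq_0_iff)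
    then show ?thesis by simp
  next
    case False
    with A0 have A: "0 < A" by simp
    \<comment> \<open>The inequality z <= exp (z - 1) is applied to each factor; the exponents sum
      to zero because \<open>A\<close> is the mean.\<close>
    have "(\<Prod>i\<in>UNIV. x i / A) \<le> (\<Prod>i\<in>UNIV. exp (x i / A - 1))"
    proof (intro prod_mono conjI)
      fix i show "0 \<le> x i / A" using assms A by simp
      show "x i / A \<le> exp (x i / A - 1)" using exp_ge_add_one_self[of "x i / A - 1"] by simp
    qed
    also have "\<dots> = exp (\<Sum>i\<in>UNIV. x i / A - 1)" by (simp add: exp_sum)
    also have "(\<Sum>i\<in>UNIV. x i / A - 1) = (\<Sum>i\<in>UNIV. x i) / A - CARD('i)"
      by (simp add: sum_subtractf sum_divide_distrib)
    also have "(\<Sum>i\<in>UNIV. x i) = A * CARD('i)" by (simp add: A_def)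
    finally have "(\<Prod>i\<in>UNIV. x i / A) \<le> 1" using A by simp
    then show ?thesis using A unfolding A_def[symmetric]
      by (simp add: prod_dividef field_simps)
  qed
qed

text \<open>Hoelder with equal exponents, stated with powers so that no roots of infinite values
  occur. Once the integrals of the \<open>w i\<close> are normalised it is AM-GM, integrated. It
  serves both for Lebesgue measure on a cell and for counting measure on the maximal cells.\<close>

lemma nn_integral_Holder_root:
  fixes u :: "'a \<Rightarrow> ennreal" and w :: "'i::finite \<Rightarrow> 'a \<Rightarrow> ennreal"
  assumes u: "u \<in> borel_measurable M" and w: "\<And>i. w i \<in> borel_measurable M"
    and le: "\<And>x. x \<in> space M \<Longrightarrow> ennreal c * u x ^ CARD('i) \<le> (\<Prod>i\<in>UNIV. w i x)"
    and c: "0 < c"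
  shows "ennreal c * (\<integral>\<^sup>+x. u x \<partial>M) ^ CARD('i) \<le> (\<Prod>i\<in>UNIV. \<integral>\<^sup>+x. w i x \<partial>M)"
proof -
  define m where "m = CARD('i)"
  have m: "0 < m" unfolding m_def by simp
  define W where "W i = (\<integral>\<^sup>+x. w i x \<partial>M)" for i
  consider (zero) i where "W i = 0" | (inf) "\<And>i. W i \<noteq> 0" "\<exists>i. W i = \<infinity>" | (fin) "\<And>i. W i \<noteq> 0" "\<And>i. W i \<noteq> \<infinity>"
    by blast
  then show ?thesis
  proof cases
    case zero
    then have "AE x in M. w i x = 0"
      unfolding W_def by (subst (asm) nn_integral_0_iff_AE) (auto intro: w)
    then have "AE x in M. u x = 0"
    proof (rule AE_mp[OF _ AE_I2], intro impI)
      fix x assume x: "x \<in> space M" "w i x = 0"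
      have "(\<Prod>j\<in>UNIV. w j x) = 0" using x(2) by (intro prod_zero) auto
      then have "ennreal c * u x ^ CARD('i) \<le> 0" using le[OF x(1)] by (simp only:)
      then show "u x = 0" using c by simp
    qed
    then have "(\<integral>\<^sup>+x. u x \<partial>M) = 0"
      using u by (subst nn_integral_0_iff_AE) auto
    then show ?thesis by (simp add: power_0_left)
  next
    case inf
    then have "(\<Prod>i\<in>UNIV. W i) = \<infinity>" by (auto simp: ennreal_prod_eq_top)
    then show ?thesis unfolding W_def by simp
  next
    case fin
    define V where "V i = enn2real (W i)" for i
    have V: "0 < V i" "W i = ennreal (V i)" for i
      using fin[of i] unfolding V_def by (auto simp: enn2real_positive_iff less_top zero_less_iff_neq_zero)
    define P where "P = (\<Prod>i\<in>UNIV. V i)"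
    have P: "0 < P" unfolding P_def using V by (simp add: prod_pos)
    \<comment> \<open>With this normalisation AM-GM bounds \<open>k * u\<close> pointwise by the
      mean of the quotients \<open>w i / V i\<close>, and that mean has integral 1.\<close>
    define k where "k = root m (c / P)"
    have k: "0 < k" "k ^ m = c / P" unfolding k_def using c P m by auto
    have pw: "ennreal k * u x \<le> (\<Sum>i\<in>UNIV. ennreal (1 / (V i * m)) * w i x)" if x: "x \<in> space M" for x
    proof (cases "\<exists>i. w i x = \<infinity>")
      case True
      then obtain i where "w i x = \<infinity>" by auto
      then have "ennreal (1 / (V i * m)) * w i x = \<infinity>" using V[of i] m by (simp add: ennreal_mult_eq_top_iff)
      then have S: "(\<Sum>i\<in>UNIV. ennreal (1 / (V i * m)) * w i x) = \<infinity>"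
        by auto
      show ?thesis unfolding S by simp
    next
      case False
      define r where "r i = enn2real (w i x)" for i
      have r: "0 \<le> r i" "w i x = ennreal (r i)" for i
        using False unfolding r_def by (auto simp: less_top)
      have prodr: "(\<Prod>i\<in>UNIV. w i x) = ennreal (\<Prod>i\<in>UNIV. r i)"
        using r by (simp add: prod_ennreal)
      have "u x \<noteq> \<infinity>"
      proof
        assume "u x = \<infinity>"
        then have "ennreal c * u x ^ CARD('i) = \<infinity>" using c by (simp add: ennreal_mult_eq_top_iff)
        then show False using le[OF x] prodr by (simp add: top_unique)
      qed
      then obtain y where y: "u x = ennreal y" "0 \<le> y" by (cases "u x") auto
      have "ennreal (c * y ^ m) \<le> ennreal (\<Prod>i\<in>UNIV. r i)"
        using le[OF x] prodr y c unfolding m_def by (simp add: ennreal_power ennreal_mult)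
      then have "c * y ^ m \<le> (\<Prod>i\<in>UNIV. r i)"
        using r by (simp add: ennreal_le_iff prod_nonneg)
      then have "(k * y) ^ m \<le> (\<Prod>i\<in>UNIV. r i / V i)"
        using P by (simp add: power_mult_distrib k(2) prod_dividef P_def[symmetric] divide_right_mono)
      also have "\<dots> \<le> ((\<Sum>i\<in>UNIV. r i / V i) / m) ^ m"
        unfolding m_def using r V by (intro prod_le_mean_power) (simp add: less_imp_le)
      finally have "k * y \<le> (\<Sum>i\<in>UNIV. r i / V i) / m"
        by (rule power_le_imp_le_base[where n="m - 1", simplified Suc_diff_1[OF m] ])
          (use m r V in \<open>auto intro!: divide_nonneg_nonneg sum_nonneg simp: less_imp_le\<close>)
      then have "ennreal (k * y) \<le> ennreal ((\<Sum>i\<in>UNIV. r i / V i) / m)" by (rule ennreal_leI)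
      also have "(\<Sum>i\<in>UNIV. r i / V i) / m = (\<Sum>i\<in>UNIV. 1 / (V i * m) * r i)"
        by (simp add: sum_divide_distrib)
      also have "ennreal \<dots> = (\<Sum>i\<in>UNIV. ennreal (1 / (V i * m) * r i))"
        using r V by (intro sum_ennreal[symmetric]) (simp add: less_imp_le)
      also have "\<dots> = (\<Sum>i\<in>UNIV. ennreal (1 / (V i * m)) * w i x)"
        using r V by (intro sum.cong refl) (simp add: ennreal_mult'[symmetric] less_imp_le)
      finally show ?thesis using y k by (simp add: ennreal_mult)
    qed
    have "ennreal k * (\<integral>\<^sup>+x. u x \<partial>M) = (\<integral>\<^sup>+x. ennreal k * u x \<partial>M)"
      using u by (simp add: nn_integral_cmult)
    also have "\<dots> \<le> (\<integral>\<^sup>+x. (\<Sum>i\<in>UNIV. ennreal (1 / (V i * m)) * w i x) \<partial>M)"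
      by (intro nn_integral_mono pw)
    also have "\<dots> = (\<Sum>i\<in>UNIV. ennreal (1 / (V i * m)) * W i)"
      unfolding W_def using w by (subst nn_integral_sum) (auto simp: nn_integral_cmult)
    also have "\<dots> = (\<Sum>i\<in>(UNIV::'i set). ennreal (1 / m))"
    proof (intro sum.cong refl)
      fix i
      show "ennreal (1 / (V i * m)) * W i = ennreal (1 / m)"
        using V[of i] by (simp add: ennreal_mult[symmetric] less_imp_le)
    qed
    also have "\<dots> = 1" using m unfolding m_def
      by (simp add: ennreal_of_nat_eq_real_of_nat ennreal_mult[symmetric])
    finally have "(ennreal k * (\<integral>\<^sup>+x. u x \<partial>M)) ^ m \<le> 1"
      by (metis power_one power_mono zero_le)
    then have "ennreal (c / P) * (\<integral>\<^sup>+x. u x \<partial>M) ^ m \<le> 1"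
      using k by (simp add: power_mult_distrib ennreal_power)
    then have "ennreal P * (ennreal (c / P) * (\<integral>\<^sup>+x. u x \<partial>M) ^ m) \<le> ennreal P * 1"
      by (intro mult_left_mono) auto
    moreover have "ennreal P * ennreal (c / P) = ennreal c"
      using P c by (simp add: ennreal_mult[symmetric] less_imp_le)
    moreover have "ennreal P = (\<Prod>i\<in>UNIV. W i)"
      unfolding P_def using V by (simp add: prod_ennreal less_imp_le)
    ultimately show ?thesis unfolding W_def m_def by (simp add: mult.assoc[symmetric])
  qed
qed

text \<open>Lebesgue measure on (R^n)^m is the completion of a product, not a product of
  completions. An upper bound with the right integral is enough here, so Tonelli is applied to Borel
  functions lying above the \<open>g i\<close>.\<close>

lemma Fubini_prod_components_majorant:
  fixes g :: "'m::finite \<Rightarrow> real^'n \<Rightarrow> ennreal"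
  assumes g: "\<And>i. g i \<in> borel_measurable lebesgue"
  obtains G :: "real^'n^'m \<Rightarrow> ennreal" where "G \<in> borel_measurable lebesgue"
    "\<And>y. (\<Prod>i\<in>UNIV. g i (y $ i)) \<le> G y"
    "(\<integral>\<^sup>+y. G y \<partial>lebesgue) = (\<Prod>i\<in>UNIV. \<integral>\<^sup>+x. g i x \<partial>lebesgue)"
proof -
  interpret product_sigma_finite "\<lambda>_::'m. lborel :: (real^'n) measure"
    by standard
  let ?P = "Pi\<^sub>M (UNIV::'m set) (\<lambda>_. lborel :: (real^'n) measure)"
  let ?D = "distr ?P borel vec_lambda"
  have vm: "(vec_lambda :: ('m \<Rightarrow> real^'n) \<Rightarrow> _) \<in> measurable ?P borel"
  proof (rule borel_measurable_euclidean_space[THEN iffD2], rule ballI)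
    fix b :: "real^'n^'m" assume "b \<in> Basis"
    then obtain i c where "b = axis i c" by (auto simp: Basis_vec_def)
    then have "(\<lambda>f. vec_lambda f \<bullet> b) = (\<lambda>f. f i \<bullet> c)" by (simp add: inner_axis)
    moreover have "(\<lambda>f. f i) \<in> measurable ?P borel"
      using measurable_component_singleton[of i UNIV "\<lambda>_::'m. lborel :: (real^'n) measure"] by simp
    ultimately show "(\<lambda>f. vec_lambda f \<bullet> b) \<in> borel_measurable ?P" by simp
  qed
  have Basis_eq: "(Basis :: (real^'n^'m) set) = (\<lambda>(i, b). axis i b) ` (UNIV \<times> Basis)"
    by (auto simp: Basis_vec_def)
  have Basis_inj: "inj_on (\<lambda>(i, b). axis i b) (UNIV \<times> (Basis :: (real^'n) set))"
    by (auto simp: inj_on_def axis_eq_axis)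
  \<comment> \<open>\<open>lborel\<close> is determined by its values on boxes, and a box of (R^n)^m
    is a product of boxes of R^n.\<close>
  have D: "lborel = ?D"
  proof (rule lborel_eqI)
    fix l u :: "real^'n^'m"
    assume "\<And>b. b \<in> Basis \<Longrightarrow> l \<bullet> b \<le> u \<bullet> b"
    then have le: "l $ i \<bullet> b \<le> u $ i \<bullet> b" if "b \<in> Basis" for i b
      using that by (metis axis_in_Basis_iff inner_axis)
    have "vec_lambda -` box l u \<inter> space ?P = Pi\<^sub>E UNIV (\<lambda>i. box (l $ i) (u $ i))"
      by (auto simp: mem_box Basis_eq inner_axis space_PiM PiE_iff)
    then have "emeasure ?D (box l u) = emeasure ?P (Pi\<^sub>E UNIV (\<lambda>i. box (l $ i) (u $ i)))"
      using vm by (simp add: emeasure_distr)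
    also have "\<dots> = (\<Prod>i\<in>UNIV. emeasure lborel (box (l $ i) (u $ i)))"
      by (intro emeasure_PiM) auto
    also have "\<dots> = (\<Prod>i\<in>UNIV. \<Prod>b\<in>Basis. ennreal ((u $ i - l $ i) \<bullet> b))"
      using le by (intro prod.cong refl)
        (subst emeasure_lborel_box, auto simp: prod_ennreal inner_diff_left)
    also have "\<dots> = (\<Prod>b\<in>Basis. ennreal ((u - l) \<bullet> b))"
      unfolding Basis_eq by (subst prod.reindex[OF Basis_inj])
        (simp add: prod.cartesian_product case_prod_beta inner_axis)
    also have "\<dots> = (\<Prod>b\<in>Basis. (u - l) \<bullet> b)"
      using le by (intro prod_ennreal) (auto simp: Basis_eq inner_axis inner_diff_left)
    finally show "emeasure ?D (box l u) = (\<Prod>b\<in>Basis. (u - l) \<bullet> b)" .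
  qed simp
  have ex: "\<exists>g'. g' \<in> borel_measurable lborel \<and> (\<forall>x. g i x \<le> g' x) \<and> (\<integral>\<^sup>+x. g' x \<partial>lborel) = (\<integral>\<^sup>+x. g i x \<partial>lebesgue)" for i
  proof -
    obtain h where h: "h \<in> borel_measurable lborel" "AE x in lborel. g i x = h x"
      using completion_ex_borel_measurable[OF g[of i]] by auto
    then obtain N where N: "N \<in> null_sets lborel" "{x. g i x \<noteq> h x} \<subseteq> N"
      by (auto simp: eventually_ae_filter)
    \<comment> \<open>The value infinity on a Borel null set turns equality almost everywhere into
      majorisation at every point without changing the integral.\<close>
    define g' where "g' x = (if x \<in> N then \<infinity> else h x)" for x
    have "N \<in> sets lborel" using N by auto
    then have "g' \<in> borel_measurable lborel" unfolding g'_def using h by measurable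
    moreover have gh: "g i x = h x" if "x \<notin> N" for x using N(2) that by blast
    then have "\<forall>x. g i x \<le> g' x" by (simp add: g'_def)
    moreover have "AE x in lborel. g' x = g i x"
      using AE_not_in[OF N(1)] by eventually_elim (simp add: gh g'_def)
    then have "(\<integral>\<^sup>+x. g' x \<partial>lborel) = (\<integral>\<^sup>+x. g i x \<partial>lebesgue)"
      by (simp add: nn_integral_completion cong: nn_integral_cong_AE)
    ultimately show ?thesis by blast
  qed
  then obtain g' where g': "\<And>i. g' i \<in> borel_measurable lborel" "\<And>i x. g i x \<le> g' i x"
    "\<And>i. (\<integral>\<^sup>+x. g' i x \<partial>lborel) = (\<integral>\<^sup>+x. g i x \<partial>lebesgue)" by metis
  have [measurable]: "g' i \<in> borel_measurable borel" for i using g'(1)[of i] by simp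
  have [measurable]: "(\<lambda>y::real^'n^'m. y $ i) \<in> borel_measurable borel" for i
    by (intro borel_measurable_continuous_onI continuous_intros)
  have G: "(\<lambda>y::real^'n^'m. \<Prod>i\<in>UNIV. g' i (y $ i)) \<in> borel_measurable borel" by measurable
  have "(\<integral>\<^sup>+y. (\<Prod>i\<in>UNIV. g' i (y $ i)) \<partial>lebesgue) = (\<integral>\<^sup>+y. (\<Prod>i\<in>UNIV. g' i (y $ i)) \<partial>(lborel :: (real^'n^'m) measure))"
    by (rule nn_integral_completion)
  also have "\<dots> = (\<integral>\<^sup>+y. (\<Prod>i\<in>UNIV. g' i (y i)) \<partial>?P)"
    by (subst D, subst nn_integral_distr[OF vm]) (simp_all, measurable)
  also have "\<dots> = (\<Prod>i\<in>UNIV. \<integral>\<^sup>+x. g i x \<partial>lebesgue)"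
    using product_nn_integral_prod[of UNIV g'] g' by simp
  finally show thesis
    using G g'(2) by (intro that[of "\<lambda>y. \<Prod>i\<in>UNIV. g' i (y $ i)"])
      (auto intro!: measurable_completion prod_mono_ennreal)
qed

section \<open>Sparse families of nested cells\<close>

text \<open>Abstract dyadic grid with level 0 the finest. The existence of a finest level, with
  countably many cells, settles all measurability questions; the cut-off \<open>L\<close> keeps
  counts finite and provides maximal selected cells.\<close>

locale nested_cells =
  fixes M :: "'a measure" and cell :: "nat \<Rightarrow> 'a \<Rightarrow> 'a set" and L :: nat
  assumes space_UNIV: "space M = UNIV"
    and cell_self: "x \<in> cell k x"
    and cell_eq: "y \<in> cell k x \<Longrightarrow> cell k y = cell k x"
    and cell_Suc: "cell k x \<subseteq> cell (Suc k) x"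
    and countable_cells: "countable (range (cell k))"
    and sets_cell: "cell k x \<in> sets M"
    and emeasure_cell: "emeasure M (cell k x) \<noteq> 0" "emeasure M (cell k x) \<noteq> \<infinity>"
begin

lemma cell_mono: "k \<le> j \<Longrightarrow> cell k x \<subseteq> cell j x"
  by (rule lift_Suc_mono_le[of "\<lambda>k. cell k x"]) (rule cell_Suc)

lemma cell_eq_above:
  assumes "y \<in> cell k x" "k \<le> j" shows "cell j y = cell j x"
  using assms cell_mono[OF assms(2)] cell_eq by blast

lemma sets_cellwise:
  assumes "\<And>x y. y \<in> cell 0 x \<Longrightarrow> x \<in> A \<Longrightarrow> y \<in> A"
  shows "A \<in> sets M"
proof -
  have "A = \<Union> (cell 0 ` A)" using assms cell_self by blast
  moreover have "countable (cell 0 ` A)" by (rule countable_subset[OF _ countable_cells]) auto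
  then have "\<Union> (cell 0 ` A) \<in> sets M" using sets_cell by (intro sets.countable_Union) auto
  ultimately show ?thesis by simp
qed

lemma borel_measurable_cellwise:
  assumes "\<And>x y. y \<in> cell 0 x \<Longrightarrow> f y = f x"
  shows "f \<in> borel_measurable M"
  by (rule measurableI) (auto simp: space_UNIV intro!: sets_cellwise dest: assms)

text \<open>
  A family of cells is given by a predicate \<open>S\<close>, where \<open>S k x\<close> selects the cell of level \<open>k\<close> around
  \<open>x\<close>; only the levels up to \<open>L\<close> count. The set \<open>covered S g\<close> consists of the points lying in at
  least \<open>g\<close> selected cells, and \<open>generation S g\<close> of the selected cells which are the \<open>g\<close>-th ones
  from above.
\<close>

definition saturated :: "(nat \<Rightarrow> 'a \<Rightarrow> bool) \<Rightarrow> bool" where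
  "saturated S \<longleftrightarrow> (\<forall>k x y. y \<in> cell k x \<longrightarrow> S k y = S k x)"

definition height :: "(nat \<Rightarrow> 'a \<Rightarrow> bool) \<Rightarrow> nat \<Rightarrow> 'a \<Rightarrow> nat" where
  "height S k x = card {j. k \<le> j \<and> j \<le> L \<and> S j x}"

definition covered :: "(nat \<Rightarrow> 'a \<Rightarrow> bool) \<Rightarrow> nat \<Rightarrow> 'a set" where
  "covered S g = {x. g \<le> height S 0 x}"

definition generation :: "(nat \<Rightarrow> 'a \<Rightarrow> bool) \<Rightarrow> nat \<Rightarrow> 'a set set" where
  "generation S g = {cell k x | k x. k \<le> L \<and> S k x \<and> height S k x = g}"

definition sparse :: "(nat \<Rightarrow> 'a \<Rightarrow> bool) \<Rightarrow> bool" where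
  "sparse S \<longleftrightarrow> (\<forall>k\<le>L. \<forall>x. S k x \<longrightarrow>
     2 * emeasure M (cell k x \<inter> {y. \<exists>j<k. S j y}) \<le> emeasure M (cell k x))"

lemma height_cong:
  assumes "saturated S" "y \<in> cell k x" shows "height S k y = height S k x"
proof -
  have "S j y = S j x" if "k \<le> j" for j
    using assms cell_mono[OF that, of x] unfolding saturated_def by blast
  then have "{j. k \<le> j \<and> j \<le> L \<and> S j y} = {j. k \<le> j \<and> j \<le> L \<and> S j x}" by auto
  then show ?thesis by (simp add: height_def)
qed

lemma height_Suc:
  assumes "k \<le> L"
  shows "height S k x = (if S k x then 1 else 0) + height S (Suc k) x"
proof -
  have eq: "{j. k \<le> j \<and> j \<le> L \<and> S j x} = (if S k x then {k} else {}) \<union> {j. Suc k \<le> j \<and> j \<le> L \<and> S j x}"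
    using assms by (auto simp: Suc_le_eq le_less)
  then show ?thesis unfolding height_def by (subst eq, subst card_Un_disjoint) auto
qed

lemma height_antimono: "k \<le> j \<Longrightarrow> height S j x \<le> height S k x"
  unfolding height_def by (intro card_mono) auto

lemma height_strict:
  assumes "S k x" "k < j" "k \<le> L" shows "height S j x < height S k x"
  using height_Suc[of k S x] height_antimono[of "Suc k" j S x] assms by simp

lemma height_split:
  assumes "k \<le> L" shows "height S 0 x = card {j. j < k \<and> S j x} + height S k x"
proof -
  have eq: "{j. 0 \<le> j \<and> j \<le> L \<and> S j x} = {j. j < k \<and> S j x} \<union> {j. k \<le> j \<and> j \<le> L \<and> S j x}"
    using assms by auto
  then show ?thesis unfolding height_def by (subst eq, subst card_Un_disjoint) auto
qed

lemma sets_covered: "saturated S \<Longrightarrow> covered S g \<in> sets M"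
  unfolding covered_def by (rule sets_cellwise) (auto simp: height_cong)

lemma covered_antimono: "g \<le> h \<Longrightarrow> covered S h \<subseteq> covered S g"
  unfolding covered_def by auto

lemma generationE:
  assumes "saturated S" "Q \<in> generation S g" "y \<in> Q"
  obtains k where "Q = cell k y" "k \<le> L" "S k y" "height S k y = g"
proof -
  obtain k x where "Q = cell k x" "k \<le> L" "S k x" "height S k x = g"
    using assms(2) unfolding generation_def by auto
  moreover have "S k y = S k x"
    using assms(1,3) \<open>Q = cell k x\<close> unfolding saturated_def by blast
  ultimately show ?thesis using that[of k] cell_eq[of y k x] height_cong[OF assms(1), of y k x] assms(3) by simp
qed

text \<open>Along the cells around one point the height drops strictly each time the level rises
  past a selected cell, so a larger height forces a smaller cell.\<close>

lemma generation_nested: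
  assumes S: "saturated S" and Q: "Q \<in> generation S g" "Q' \<in> generation S g'" and "g \<le> g'" "y \<in> Q" "y \<in> Q'"
  shows "Q' \<subseteq> Q"
proof -
  obtain k where k: "Q = cell k y" "k \<le> L" "S k y" "height S k y = g" by (rule generationE[OF S Q(1) \<open>y \<in> Q\<close>])
  obtain k' where k': "Q' = cell k' y" "k' \<le> L" "S k' y" "height S k' y = g'" by (rule generationE[OF S Q(2) \<open>y \<in> Q'\<close>])
  have "k' \<le> k"
  proof (rule ccontr)
    assume "\<not> k' \<le> k"
    then have "height S k' y < height S k y" using k by (intro height_strict) auto
    with k k' \<open>g \<le> g'\<close> show False by simp
  qed
  then show ?thesis using k k' cell_mono by simp
qed

lemma generation_disjoint:
  assumes "saturated S" "Q \<in> generation S g" "Q' \<in> generation S g" "Q \<noteq> Q'"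
  shows "Q \<inter> Q' = {}"
  using generation_nested[OF assms(1,2,3)] generation_nested[OF assms(1,3,2)] assms(4) by blast

lemma countable_generation: "countable (generation S g)"
  by (rule countable_subset[OF _ countable_UN[OF _ countable_cells, of UNIV "\<lambda>k. k"]])
     (auto simp: generation_def)

lemma generation_sets: "Q \<in> generation S g \<Longrightarrow> Q \<in> sets M"
  unfolding generation_def using sets_cell by auto

lemma generation_emeasure:
  "Q \<in> generation S g \<Longrightarrow> emeasure M Q \<noteq> 0" "Q \<in> generation S g \<Longrightarrow> emeasure M Q \<noteq> \<infinity>"
  unfolding generation_def using emeasure_cell by auto

lemma generation_subset_covered:
  assumes "saturated S" "Q \<in> generation S g" shows "Q \<subseteq> covered S g"
proof
  fix y assume "y \<in> Q"
  then obtain k where "height S k y = g" using generationE[OF assms] by metis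
  then show "y \<in> covered S g" using height_antimono[of 0 k S y] by (simp add: covered_def)
qed

lemma covered_by_generation:
  assumes "x \<in> covered S g" "1 \<le> g"
  obtains Q where "Q \<in> generation S g" "x \<in> Q"
proof -
  \<comment> \<open>The height decreases in steps of at most one as the level rises. At the last
    level where it is still at least \<open>g\<close> it equals \<open>g\<close>, and the cell there
    is selected.\<close>
  define k where "k = (GREATEST k. g \<le> height S k x)"
  have 0: "g \<le> height S 0 x" using assms by (simp add: covered_def)
  have bd: "k \<le> L" if "g \<le> height S k x" for k
  proof (rule ccontr)
    assume "\<not> k \<le> L"
    then have "{j. k \<le> j \<and> j \<le> L \<and> S j x} = {}" by auto
    with that assms(2) show False by (simp add: height_def)
  qed
  have k: "g \<le> height S k x" unfolding k_def by (rule GreatestI_nat[of "\<lambda>k. g \<le> height S k x", OF 0 bd])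
  have "\<not> g \<le> height S (Suc k) x"
  proof
    assume "g \<le> height S (Suc k) x"
    then have "Suc k \<le> k" unfolding k_def by (rule Greatest_le_nat[of "\<lambda>k. g \<le> height S k x", OF _ bd])
    then show False by simp
  qed
  with k height_Suc[OF bd[OF k], of S x] have "S k x" "height S k x = g" by (auto split: if_splits)
  then have "cell k x \<in> generation S g" using bd[OF k] unfolding generation_def by auto
  then show ?thesis using that cell_self by blast
qed

lemma emeasure_Union_generation:
  assumes S: "saturated S" and QQ: "QQ \<subseteq> generation S g" and nu: "sets \<nu> = sets M" and A: "A \<in> sets M"
  shows "emeasure \<nu> (\<Union> QQ \<inter> A) = (\<integral>\<^sup>+Q. emeasure \<nu> (Q \<inter> A) \<partial>count_space QQ)"
proof -
  have "emeasure \<nu> (\<Union>Q\<in>QQ. Q \<inter> A) = (\<integral>\<^sup>+Q. emeasure \<nu> (Q \<inter> A) \<partial>count_space QQ)"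
  proof (rule emeasure_UN_countable)
    show "disjoint_family_on (\<lambda>Q. Q \<inter> A) QQ"
      using generation_disjoint[OF S] QQ unfolding disjoint_family_on_def by blast
  qed (use QQ A nu generation_sets countable_subset[OF QQ countable_generation] in auto)
  then show ?thesis by (simp add: Int_commute)
qed

lemma emeasure_split_generation:
  assumes S: "saturated S" and nu: "sets \<nu> = sets M" and A: "A \<in> sets M" "A \<subseteq> covered S g" and "1 \<le> g"
  shows "emeasure \<nu> A = (\<integral>\<^sup>+Q. emeasure \<nu> (Q \<inter> A) \<partial>count_space (generation S g))"
proof -
  have "\<Union> (generation S g) \<inter> A = A" using A covered_by_generation[of _ S g] \<open>1 \<le> g\<close> by blast
  then show ?thesis using emeasure_Union_generation[OF S subset_refl nu A(1), of g] by simp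
qed

lemma emeasure_split_generation_within:
  assumes S: "saturated S" and nu: "sets \<nu> = sets M" and A: "A \<in> sets M" "A \<subseteq> covered S h"
    and "1 \<le> h" "g \<le> h" and Q: "Q \<in> generation S g"
  shows "emeasure \<nu> (Q \<inter> A) = (\<integral>\<^sup>+R. emeasure \<nu> (R \<inter> A) \<partial>count_space {R \<in> generation S h. R \<subseteq> Q})"
proof -
  have "\<Union> {R \<in> generation S h. R \<subseteq> Q} \<inter> A = Q \<inter> A"
  proof (intro equalityI subsetI)
    fix x assume x: "x \<in> Q \<inter> A"
    then obtain R where R: "R \<in> generation S h" "x \<in> R" using A covered_by_generation[of x S h] \<open>1 \<le> h\<close> by blast
    then have "R \<subseteq> Q" using generation_nested[OF S Q R(1) \<open>g \<le> h\<close>] x by blast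
    then show "x \<in> \<Union> {R \<in> generation S h. R \<subseteq> Q} \<inter> A" using R x by auto
  qed auto
  then show ?thesis
    using emeasure_Union_generation[OF S _ nu A(1), of "{R \<in> generation S h. R \<subseteq> Q}" h] by simp
qed

text \<open>Within a cell of generation \<open>g\<close>, lying in g + 1 selected cells means lying
  in a smaller selected one, so the covered part is the very set measured in
  \<open>sparse\<close>.\<close>

lemma sparse_generation:
  assumes S: "saturated S" "sparse S" and Q: "Q \<in> generation S g"
  shows "2 * emeasure M (Q \<inter> covered S (Suc g)) \<le> emeasure M Q"
proof -
  obtain k x where k: "Q = cell k x" "k \<le> L" "S k x" "height S k x = g"
    using Q unfolding generation_def by auto
  have "Q \<inter> covered S (Suc g) = cell k x \<inter> {y. \<exists>j<k. S j y}"
  proof -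
    have "(Suc g \<le> height S 0 y) = (\<exists>j<k. S j y)" if "y \<in> cell k x" for y
    proof -
      have "height S 0 y = card {j. j < k \<and> S j y} + g"
        using height_split[OF k(2), of S y] height_cong[OF S(1) that] k by simp
      moreover have "(0 < card {j. j < k \<and> S j y}) = (\<exists>j<k. S j y)" by (auto simp: card_gt_0_iff)
      ultimately show ?thesis by auto
    qed
    then show ?thesis unfolding k(1) covered_def by auto
  qed
  then show ?thesis using S(2) k unfolding sparse_def by simp
qed

lemma sparse_decay:
  assumes S: "saturated S" "sparse S" and Q: "Q \<in> generation S g" and "1 \<le> g"
  shows "2 ^ l * emeasure M (Q \<inter> covered S (g + l)) \<le> emeasure M Q"
proof (induction l)
  case 0
  show ?case using generation_sets[OF Q] by (simp add: emeasure_mono)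
next
  case (Suc l)
  let ?R = "{R \<in> generation S (g + l). R \<subseteq> Q}"
  have "2 * emeasure M (Q \<inter> covered S (g + Suc l)) = 2 * (\<integral>\<^sup>+R. emeasure M (R \<inter> covered S (g + Suc l)) \<partial>count_space ?R)"
    using S Q \<open>1 \<le> g\<close> covered_antimono
    by (subst emeasure_split_generation_within[where h = "g + l"]) (auto intro: sets_covered)
  also have "\<dots> = (\<integral>\<^sup>+R. 2 * emeasure M (R \<inter> covered S (g + Suc l)) \<partial>count_space ?R)"
    by (simp add: nn_integral_cmult)
  also have "\<dots> \<le> (\<integral>\<^sup>+R. emeasure M (R \<inter> covered S (g + l)) \<partial>count_space ?R)"
  proof (rule nn_integral_mono)
    fix R assume "R \<in> space (count_space ?R)"
    then have R: "R \<in> generation S (g + l)" by simp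
    show "2 * emeasure M (R \<inter> covered S (g + Suc l)) \<le> emeasure M (R \<inter> covered S (g + l))"
      using sparse_generation[OF S R] generation_subset_covered[OF S(1) R] by (simp add: Int_absorb2)
  qed
  also have "\<dots> = emeasure M (Q \<inter> covered S (g + l))"
    using S Q \<open>1 \<le> g\<close>
    by (subst emeasure_split_generation_within[where h = "g + l"]) (auto intro: sets_covered)
  finally have "2 ^ l * (2 * emeasure M (Q \<inter> covered S (g + Suc l))) \<le> 2 ^ l * emeasure M (Q \<inter> covered S (g + l))"
    by (intro mult_left_mono) auto
  also note Suc
  finally show ?case by (simp add: mult_ac)
qed

text \<open>
  Each of the \<open>r\<close> generations starting at \<open>g\<close> bounds the same quantity by the integral of \<open>v\<close> over
  its own layer, and these layers are disjoint.
\<close>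

lemma generation_gain:
  assumes S: "saturated S" "sparse S" and v: "v \<in> borel_measurable M" and nu: "sets \<nu> = sets M"
    and bound: "\<And>g Q y. 1 \<le> g \<Longrightarrow> Q \<in> generation S g \<Longrightarrow> y \<in> Q \<Longrightarrow>
      emeasure \<nu> (Q \<inter> covered S (g + l)) \<le> \<phi> * emeasure M Q * v y"
    and Q: "Q \<in> generation S g" and "1 \<le> g"
  shows "of_nat r * emeasure \<nu> (Q \<inter> covered S (g + l + r)) \<le> 2 * \<phi> * (\<integral>\<^sup>+x\<in>Q. v x \<partial>M)"
proof -
  define \<sigma> where "\<sigma> = density M v"
  have sig: "sets \<sigma> = sets M" unfolding \<sigma>_def by simp
  have sig_eq: "emeasure \<sigma> A = (\<integral>\<^sup>+x\<in>A. v x \<partial>M)" if "A \<in> sets M" for A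
    unfolding \<sigma>_def using v that by (rule emeasure_density)
  \<comment> \<open>At least half of \<open>R\<close> lies in its own layer. The assumed bound holds
    at every point of that half; averaging it there replaces |R| v by the integral of
    \<open>v\<close> over the layer and costs the factor 2.\<close>
  have one: "emeasure \<nu> (R \<inter> covered S (j + l)) \<le> 2 * \<phi> * emeasure \<sigma> (R \<inter> (covered S j - covered S (Suc j)))"
    if R: "R \<in> generation S j" and j: "1 \<le> j" for R j
  proof -
    define D where "D = R \<inter> (covered S j - covered S (Suc j))"
    let ?N = "emeasure \<nu> (R \<inter> covered S (j + l))"
    have D: "D \<in> sets M" unfolding D_def using sets_covered[OF S(1)] generation_sets[OF R] by auto
    have "emeasure M R = emeasure M (R \<inter> covered S (Suc j)) + emeasure M D"
    proof (subst plus_emeasure)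
      show "emeasure M R = emeasure M ((R \<inter> covered S (Suc j)) \<union> D)"
        using generation_subset_covered[OF S(1) R] unfolding D_def by (intro arg_cong[where f="emeasure M"]) auto
    qed (use D generation_sets[OF R] sets_covered[OF S(1)] in \<open>auto simp: D_def\<close>)
    then have "2 * emeasure M R \<le> emeasure M R + 2 * emeasure M D"
      using sparse_generation[OF S R] by (simp add: distrib_left add_right_mono)
    then have half: "emeasure M R \<le> 2 * emeasure M D"
      using generation_emeasure(2)[OF R] by (simp add: mult_2 ennreal_add_left_cancel_le)
    have "?N * emeasure M D = (\<integral>\<^sup>+x\<in>D. ?N \<partial>M)"
      using D by (simp add: nn_integral_cmult_indicator)
    also have "\<dots> \<le> (\<integral>\<^sup>+x. (\<phi> * emeasure M R) * (v x * indicator D x) \<partial>M)"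
      using bound[OF j R] by (intro nn_integral_mono) (auto simp: D_def split: split_indicator)
    also have "\<dots> = \<phi> * emeasure M R * emeasure \<sigma> D"
      using v D by (subst nn_integral_cmult) (auto simp: sig_eq)
    finally have "2 * (?N * emeasure M D) \<le> 2 * (\<phi> * emeasure M R * emeasure \<sigma> D)"
      by (intro mult_left_mono) auto
    moreover have "?N * emeasure M R \<le> ?N * (2 * emeasure M D)"
      using half by (intro mult_left_mono) auto
    ultimately have "emeasure M R * ?N \<le> emeasure M R * (2 * \<phi> * emeasure \<sigma> D)"
      by (simp add: mult_ac)
    then show ?thesis
      using generation_emeasure[OF R] unfolding D_def by (subst (asm) ennreal_mult_le_mult_iff) auto
  qed
  \<comment> \<open>Covered sets decrease, so the deepest one, g + l + r, is contained in the one at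
    depth \<open>l\<close> below each generation \<open>j\<close> of the range.\<close>
  have layer: "emeasure \<nu> (Q \<inter> covered S (g + l + r)) \<le> 2 * \<phi> * emeasure \<sigma> (Q \<inter> (covered S j - covered S (Suc j)))"
    if j: "j \<in> {g..<g + r}" for j
  proof -
    have j1: "1 \<le> j" "g \<le> j" using j \<open>1 \<le> g\<close> by auto
    let ?R = "{R \<in> generation S j. R \<subseteq> Q}"
    have "emeasure \<nu> (Q \<inter> covered S (g + l + r)) \<le> emeasure \<nu> (Q \<inter> covered S (j + l))"
      using j sets_covered[OF S(1)] generation_sets[OF Q] nu covered_antimono[of "j + l" "g + l + r" S]
      by (intro emeasure_mono) auto
    also have "\<dots> = (\<integral>\<^sup>+R. emeasure \<nu> (R \<inter> covered S (j + l)) \<partial>count_space ?R)"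
      using S Q j1 nu covered_antimono[of j "j + l" S]
      by (subst emeasure_split_generation_within[where h = j]) (auto intro: sets_covered)
    also have "\<dots> \<le> (\<integral>\<^sup>+R. 2 * \<phi> * emeasure \<sigma> (R \<inter> (covered S j - covered S (Suc j))) \<partial>count_space ?R)"
      using one j1 by (intro nn_integral_mono) auto
    also have "\<dots> = 2 * \<phi> * (\<integral>\<^sup>+R. emeasure \<sigma> (R \<inter> (covered S j - covered S (Suc j))) \<partial>count_space ?R)"
      by (rule nn_integral_cmult) simp
    also have "\<dots> = 2 * \<phi> * emeasure \<sigma> (Q \<inter> (covered S j - covered S (Suc j)))"
      using S Q j1 sig sets_covered[OF S(1)]
      by (subst emeasure_split_generation_within[where h = j]) auto
    finally show ?thesis .
  qed
  have "of_nat r * emeasure \<nu> (Q \<inter> covered S (g + l + r)) = (\<Sum>j\<in>{g..<g + r}. emeasure \<nu> (Q \<inter> covered S (g + l + r)))"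
    by simp
  also have "\<dots> \<le> (\<Sum>j\<in>{g..<g + r}. 2 * \<phi> * emeasure \<sigma> (Q \<inter> (covered S j - covered S (Suc j))))"
    by (intro sum_mono layer)
  also have "\<dots> = 2 * \<phi> * (\<Sum>j\<in>{g..<g + r}. emeasure \<sigma> (Q \<inter> (covered S j - covered S (Suc j))))"
    by (simp add: sum_distrib_left)
  also have "(\<Sum>j\<in>{g..<g + r}. emeasure \<sigma> (Q \<inter> (covered S j - covered S (Suc j))))
      = emeasure \<sigma> (\<Union>j\<in>{g..<g + r}. Q \<inter> (covered S j - covered S (Suc j)))"
  proof (rule sum_emeasure)
    show "disjoint_family_on (\<lambda>j. Q \<inter> (covered S j - covered S (Suc j))) {g..<g + r}"
      unfolding disjoint_family_on_def covered_def by auto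
  qed (use sets_covered[OF S(1)] generation_sets[OF Q] sig in auto)
  also have "2 * \<phi> * \<dots> \<le> 2 * \<phi> * emeasure \<sigma> Q"
    using generation_sets[OF Q] sig by (intro mult_left_mono emeasure_mono) auto
  finally show ?thesis using generation_sets[OF Q] by (simp add: sig_eq)
qed

text \<open>Dyadic weak (1,1) inequality localised to one cell: the maximal cells with large average
  are the first generation of an auxiliary family, hence disjoint.\<close>

lemma cell_weak_type:
  assumes nu: "sets \<nu> = sets M" and "k \<le> L"
  shows "c * emeasure M (cell k x \<inter> {y. \<exists>j\<le>k. c * emeasure M (cell j y) \<le> emeasure \<nu> (cell j y)})
    \<le> emeasure \<nu> (cell k x)"
proof -
  define S where "S j y \<longleftrightarrow> j \<le> k \<and> y \<in> cell k x \<and> c * emeasure M (cell j y) \<le> emeasure \<nu> (cell j y)" for j y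
  have S: "saturated S"
    unfolding saturated_def
  proof (intro allI impI)
    fix j z y assume y: "y \<in> cell j z"
    then have "j \<le> k \<Longrightarrow> (y \<in> cell k x) = (z \<in> cell k x)"
      using cell_eq_above[OF y, of k] cell_eq cell_self by metis
    then show "S j y = S j z" using cell_eq[OF y] unfolding S_def by auto
  qed
  have O: "covered S 1 = cell k x \<inter> {y. \<exists>j\<le>k. c * emeasure M (cell j y) \<le> emeasure \<nu> (cell j y)}"
  proof -
    have "1 \<le> height S 0 y \<longleftrightarrow> (\<exists>j\<le>L. S j y)" for y
      unfolding height_def by (auto simp: Suc_le_eq card_gt_0_iff)
    then show ?thesis unfolding covered_def using \<open>k \<le> L\<close> unfolding S_def by (auto dest: order_trans)
  qed
  have "c * emeasure M (covered S 1) = c * (\<integral>\<^sup>+Q. emeasure M (Q \<inter> covered S 1) \<partial>count_space (generation S 1))"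
    by (subst emeasure_split_generation[OF S _ sets_covered[OF S], of M 1]) auto
  also have "\<dots> = (\<integral>\<^sup>+Q. c * emeasure M (Q \<inter> covered S 1) \<partial>count_space (generation S 1))"
    by (simp add: nn_integral_cmult)
  also have "\<dots> \<le> (\<integral>\<^sup>+Q. emeasure \<nu> (Q \<inter> covered S 1) \<partial>count_space (generation S 1))"
  proof (rule nn_integral_mono)
    fix Q assume "Q \<in> space (count_space (generation S 1))"
    then have Q: "Q \<in> generation S 1" by simp
    then have "c * emeasure M Q \<le> emeasure \<nu> Q" unfolding generation_def S_def by auto
    then show "c * emeasure M (Q \<inter> covered S 1) \<le> emeasure \<nu> (Q \<inter> covered S 1)"
      using generation_subset_covered[OF S Q] by (simp add: Int_absorb2)
  qed
  also have "\<dots> = emeasure \<nu> (covered S 1)"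
    by (rule emeasure_split_generation[OF S nu sets_covered[OF S] subset_refl order_refl, symmetric])
  also have "\<dots> \<le> emeasure \<nu> (cell k x)"
    unfolding O using nu sets_cell by (intro emeasure_mono) auto
  finally show ?thesis unfolding O .
qed

end

lemma le_of_power_le_ennreal:
  fixes U :: ennreal
  assumes "ennreal t * U ^ m \<le> ennreal (b ^ m * p)" "0 < t" "0 \<le> b" "0 \<le> p" "0 < m"
  shows "U \<le> ennreal (b * root m (p / t))"
proof -
  have "U \<noteq> \<infinity>"
  proof
    assume "U = \<infinity>"
    then have "ennreal t * U ^ m = \<infinity>" using assms by (simp add: ennreal_mult_top)
    then show False using assms(1) by (simp add: top_unique)
  qed
  then obtain y where y: "U = ennreal y" "0 \<le> y" by (cases U) auto
  then have "ennreal (t * y ^ m) \<le> ennreal (b ^ m * p)"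
    using assms by (simp add: ennreal_power ennreal_mult)
  then have "t * y ^ m \<le> b ^ m * p" using assms by (subst (asm) ennreal_le_iff) auto
  then have "y ^ m \<le> b ^ m * (p / t)" using assms(2) by (simp add: field_simps)
  also have "\<dots> = (b * root m (p / t)) ^ m" using assms by (simp add: power_mult_distrib)
  finally have "y \<le> b * root m (p / t)"
    using assms power_le_imp_le_base[of y "m - 1" "b * root m (p / t)"] by simp
  then show ?thesis using y by (simp add: ennreal_leI)
qed

section \<open>Measures dominated by a function and the estimate over maximal cells\<close>

context nested_cells
begin

text \<open>All that is needed of a weight and its maximal function. The first clause is for cells
  on which a single term exceeds the level, which need not be sparse; the second is for the windows.
  Both compare with \<open>v\<close> at every point of the cell, so the bounds can be averaged over
  any part of it.\<close>

definition dominates :: "real \<Rightarrow> real \<Rightarrow> 'a measure \<Rightarrow> ('a \<Rightarrow> ennreal) \<Rightarrow> bool" where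
  "dominates C \<delta> \<nu> v \<longleftrightarrow> sets \<nu> = sets M \<and> v \<in> borel_measurable M \<and>
     (\<forall>k\<le>L. \<forall>x. \<forall>y\<in>cell k x. emeasure \<nu> (cell k x) \<le> ennreal C * emeasure M (cell k x) * v y) \<and>
     (\<forall>S g Q l. saturated S \<longrightarrow> sparse S \<longrightarrow> 1 \<le> g \<longrightarrow> Q \<in> generation S g \<longrightarrow>
        (\<forall>y\<in>Q. emeasure \<nu> (Q \<inter> covered S (g + l)) \<le> ennreal (C * (1 + real l) powr - \<delta>) * emeasure M Q * v y))"

lemma le_set_integral:
  assumes "\<And>y. y \<in> Q \<Longrightarrow> N \<le> c * emeasure M Q * v y"
    and v: "v \<in> borel_measurable M" and Q: "Q \<in> sets M" "emeasure M Q \<noteq> 0" "emeasure M Q \<noteq> \<infinity>"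
  shows "N \<le> c * (\<integral>\<^sup>+x\<in>Q. v x \<partial>M)"
proof -
  have "emeasure M Q * N = (\<integral>\<^sup>+x\<in>Q. N \<partial>M)" using Q by (simp add: nn_integral_cmult_indicator mult.commute)
  also have "\<dots> \<le> (\<integral>\<^sup>+x. (c * emeasure M Q) * (v x * indicator Q x) \<partial>M)"
    using assms(1) by (intro nn_integral_mono) (auto split: split_indicator)
  also have "\<dots> = c * emeasure M Q * (\<integral>\<^sup>+x\<in>Q. v x \<partial>M)"
    using v Q by (subst nn_integral_cmult) auto
  finally have "emeasure M Q * N \<le> emeasure M Q * (c * (\<integral>\<^sup>+x\<in>Q. v x \<partial>M))" by (simp add: mult_ac)
  then show ?thesis using Q by (subst (asm) ennreal_mult_le_mult_iff) auto
qed

lemma dominates_cell: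
  assumes "dominates C \<delta> \<nu> v" "Q \<in> generation S g"
  shows "emeasure \<nu> Q \<le> ennreal C * (\<integral>\<^sup>+x\<in>Q. v x \<partial>M)"
  using assms generation_sets[OF assms(2)] generation_emeasure[OF assms(2)]
  by (intro le_set_integral) (auto simp: dominates_def generation_def)

lemma dominates_decay:
  assumes dom: "dominates C \<delta> \<nu> v" and S: "saturated S" "sparse S" and Q: "Q \<in> generation S 1"
    and "1 \<le> q" "0 < \<delta>" "0 < C"
  shows "emeasure \<nu> (Q \<inter> covered S q) \<le> ennreal (8 * 2 powr \<delta> * C * real q powr - (1 + \<delta>)) * (\<integral>\<^sup>+x\<in>Q. v x \<partial>M)"
proof -
  have v: "v \<in> borel_measurable M" and nu: "sets \<nu> = sets M"
    and bd: "\<And>S g Q l y. saturated S \<Longrightarrow> sparse S \<Longrightarrow> 1 \<le> g \<Longrightarrow> Q \<in> generation S g \<Longrightarrow> y \<in> Q \<Longrightarrow>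
        emeasure \<nu> (Q \<inter> covered S (g + l)) \<le> ennreal (C * (1 + real l) powr - \<delta>) * emeasure M Q * v y"
    using dom unfolding dominates_def by auto
  let ?I = "\<integral>\<^sup>+x\<in>Q. v x \<partial>M"
  have pw: "1 \<le> 2 powr \<delta>" using \<open>0 < \<delta>\<close> by (simp add: ge_one_powr_ge_zero)
  show ?thesis
  proof (cases "q = 1")
    case True
    have "emeasure \<nu> (Q \<inter> covered S q) \<le> emeasure \<nu> Q"
      using generation_sets[OF Q] nu by (intro emeasure_mono) auto
    also have "\<dots> \<le> ennreal C * ?I" by (rule dominates_cell[OF dom Q])
    also have "\<dots> \<le> ennreal (8 * 2 powr \<delta> * C * real q powr - (1 + \<delta>)) * ?I"
      using True pw \<open>0 < C\<close> mult_right_mono[of 1 "8 * 2 powr \<delta>" C]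
      by (intro mult_right_mono ennreal_leI) (auto simp: mult_ac)
    finally show ?thesis .
  next
    case False
    with \<open>1 \<le> q\<close> have q: "2 \<le> q" by simp
    \<comment> \<open>Half of the remaining q - 1 generations supply the decay (1 + l)^(-\<delta>),
      the other half the factor 1/r of \<open>generation_gain\<close>; for q = 1 there would be no
      r. The constant collects 2 from that lemma, 4 from q <= 4 r and 2^\<delta> from q/2 <= 1 +
      l.\<close>
    define l where "l = (q - 1) div 2"
    define r where "r = q - 1 - l"
    have qq: "q = 1 + l + r" unfolding r_def l_def using q by simp
    have r: "0 < r" "real q \<le> 4 * real r" unfolding r_def l_def using q by linarith+
    have l: "real q / 2 \<le> 1 + real l" unfolding l_def using q by linarith
    define \<phi> where "\<phi> = C * (1 + real l) powr - \<delta>"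
    have phi: "0 \<le> \<phi>" "\<phi> \<le> 2 powr \<delta> * C * real q powr - \<delta>"
    proof -
      show "0 \<le> \<phi>" using \<open>0 < C\<close> unfolding \<phi>_def by simp
      have "(1 + real l) powr - \<delta> \<le> (real q / 2) powr - \<delta>"
        using l q \<open>0 < \<delta>\<close> by (intro powr_mono2') auto
      also have "\<dots> = 2 powr \<delta> * real q powr - \<delta>"
        using q by (simp add: powr_divide powr_minus field_simps)
      finally show "\<phi> \<le> 2 powr \<delta> * C * real q powr - \<delta>"
        unfolding \<phi>_def using \<open>0 < C\<close> by (simp add: mult_ac)
    qed
    have "of_nat r * emeasure \<nu> (Q \<inter> covered S (1 + l + r)) \<le> 2 * ennreal \<phi> * ?I"
      by (rule generation_gain[OF S v nu _ Q]) (auto simp: \<phi>_def intro!: bd[OF S])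
    then have "ennreal (1 / r) * (of_nat r * emeasure \<nu> (Q \<inter> covered S q)) \<le> ennreal (1 / r) * (2 * ennreal \<phi> * ?I)"
      unfolding qq[symmetric] by (intro mult_left_mono) auto
    moreover have "ennreal (1 / r) * of_nat r = 1"
      using r by (simp add: ennreal_of_nat_eq_real_of_nat ennreal_mult[symmetric])
    moreover have "ennreal (1 / r) * (2 * ennreal \<phi>) = ennreal (2 * \<phi> / r)"
      using phi r by (simp add: numeral_mult_ennreal ennreal_mult'[symmetric])
    ultimately have "emeasure \<nu> (Q \<inter> covered S q) \<le> ennreal (2 * \<phi> / r) * ?I"
      by (simp add: mult.assoc[symmetric])
    also have "\<dots> \<le> ennreal (8 * 2 powr \<delta> * C * real q powr - (1 + \<delta>)) * ?I"
    proof (intro mult_right_mono ennreal_leI)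
      have "2 * \<phi> / r \<le> 8 * \<phi> / q"
        using r q phi mult_left_mono[OF r(2), of \<phi>] by (simp add: field_simps)
      also have "\<dots> \<le> 8 * (2 powr \<delta> * C * real q powr - \<delta>) / q"
        using phi q by (intro divide_right_mono mult_left_mono) auto
      also have "\<dots> = 8 * 2 powr \<delta> * C * real q powr - (1 + \<delta>)"
        using q by (simp add: powr_diff powr_minus powr_add field_simps)
      finally show "2 * \<phi> / r \<le> 8 * 2 powr \<delta> * C * real q powr - (1 + \<delta>)" .
    qed simp
    finally show ?thesis .
  qed
qed

text \<open>On a maximal cell the lower bound by \<open>t\<close> is multiplied into Hoelder's
  inequality for \<open>u\<close>. The factor \<open>e k\<close> is then moved from the integral of
  \<open>f i\<close> to that of \<open>v i\<close>, where it forms a quantity below the dyadic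
  fractional maximal function at every point of the cell. A second Hoelder sums over the disjoint
  maximal cells.\<close>

lemma first_generation_estimate:
  fixes w v f :: "'m::finite \<Rightarrow> 'a \<Rightarrow> ennreal" and e :: "nat \<Rightarrow> ennreal"
  assumes S: "saturated S" and "1 \<le> q" and "0 < t"
    and big: "\<And>k x. k \<le> L \<Longrightarrow> S k x \<Longrightarrow> ennreal t \<le> (\<Prod>i\<in>UNIV. e k * (\<integral>\<^sup>+y\<in>cell k x. f i y \<partial>M))"
    and meas: "u \<in> borel_measurable M" "\<And>i. w i \<in> borel_measurable M" "\<And>i. v i \<in> borel_measurable M"
      "\<And>i. f i \<in> borel_measurable M"
    and uw: "\<And>x. u x ^ CARD('m) \<le> (\<Prod>i\<in>UNIV. w i x)"
    and wv: "\<And>Q i. Q \<in> generation S 1 \<Longrightarrow> (\<integral>\<^sup>+x\<in>Q \<inter> covered S q. w i x \<partial>M) \<le> ennreal \<psi> * (\<integral>\<^sup>+x\<in>Q. v i x \<partial>M)"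
  shows "ennreal t * (\<integral>\<^sup>+x\<in>covered S q. u x \<partial>M) ^ CARD('m) \<le>
    (\<Prod>i\<in>UNIV. ennreal \<psi> * (\<integral>\<^sup>+x. f i x * (SUP k\<in>{..L}. e k * (\<integral>\<^sup>+y\<in>cell k x. v i y \<partial>M)) \<partial>M))"
proof -
  define c where "c i x = (SUP k\<in>{..L}. e k * (\<integral>\<^sup>+y\<in>cell k x. v i y \<partial>M))" for i x
  have cm: "c i \<in> borel_measurable M" for i
    unfolding c_def
  proof (rule borel_measurable_cellwise)
    fix x y assume "y \<in> cell 0 x"
    then have "cell k y = cell k x" for k using cell_eq_above by blast
    then show "(SUP k\<in>{..L}. e k * (\<integral>\<^sup>+z\<in>cell k y. v i z \<partial>M)) = (SUP k\<in>{..L}. e k * (\<integral>\<^sup>+z\<in>cell k x. v i z \<partial>M))"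
      by simp
  qed
  define N where "N i = density M (\<lambda>x. f i x * c i x)" for i
  have Nm: "(\<lambda>x. f i x * c i x) \<in> borel_measurable M" for i using meas cm by auto
  have Os: "covered S q \<in> sets M" by (rule sets_covered[OF S])
  have Om1: "covered S q \<subseteq> covered S 1" using \<open>1 \<le> q\<close> by (rule covered_antimono)
  define U where "U Q = (\<integral>\<^sup>+x\<in>Q \<inter> covered S q. u x \<partial>M)" for Q
  have "(\<integral>\<^sup>+x\<in>covered S q. u x \<partial>M) = emeasure (density M u) (covered S q)"
    using meas Os by (simp add: emeasure_density)
  also have "\<dots> = (\<integral>\<^sup>+Q. emeasure (density M u) (Q \<inter> covered S q) \<partial>count_space (generation S 1))"
    by (rule emeasure_split_generation[OF S _ Os Om1]) auto
  also have "\<dots> = (\<integral>\<^sup>+Q. U Q \<partial>count_space (generation S 1))"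
    unfolding U_def using meas Os generation_sets by (intro nn_integral_cong) (auto simp: emeasure_density)
  finally have split: "(\<integral>\<^sup>+x\<in>covered S q. u x \<partial>M) = (\<integral>\<^sup>+Q. U Q \<partial>count_space (generation S 1))" .
  have "ennreal t * (\<integral>\<^sup>+Q. U Q \<partial>count_space (generation S 1)) ^ CARD('m) \<le>
    (\<Prod>i\<in>UNIV. \<integral>\<^sup>+Q. ennreal \<psi> * emeasure (N i) Q \<partial>count_space (generation S 1))"
  proof (rule nn_integral_Holder_root)
    fix Q assume "Q \<in> space (count_space (generation S 1))"
    then have Q: "Q \<in> generation S 1" by simp
    then obtain k x where k: "Q = cell k x" "k \<le> L" "S k x" unfolding generation_def by auto
    have Qs: "Q \<in> sets M" by (rule generation_sets[OF Q])
    have "1 * U Q ^ CARD('m) \<le> (\<Prod>i\<in>UNIV. \<integral>\<^sup>+x\<in>Q \<inter> covered S q. w i x \<partial>M)"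
      unfolding U_def ennreal_1[symmetric]
    proof (rule nn_integral_Holder_root)
      fix x
      show "ennreal 1 * (u x * indicator (Q \<inter> covered S q) x) ^ CARD('m) \<le> (\<Prod>i\<in>UNIV. w i x * indicator (Q \<inter> covered S q) x)"
        using uw[of x] by (auto simp: power_0_left split: split_indicator)
    qed (use meas Qs Os in auto)
    then have "ennreal t * U Q ^ CARD('m) \<le>
        (\<Prod>i\<in>UNIV. e k * (\<integral>\<^sup>+y\<in>Q. f i y \<partial>M)) * (\<Prod>i\<in>UNIV. \<integral>\<^sup>+x\<in>Q \<inter> covered S q. w i x \<partial>M)"
      using big[OF k(2,3)] unfolding k(1)[symmetric] by (intro mult_mono) auto
    also have "\<dots> \<le> (\<Prod>i\<in>UNIV. e k * (\<integral>\<^sup>+y\<in>Q. f i y \<partial>M)) * (\<Prod>i\<in>UNIV. ennreal \<psi> * (\<integral>\<^sup>+x\<in>Q. v i x \<partial>M))"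
      using wv[OF Q] by (intro mult_left_mono prod_mono_ennreal) auto
    also have "\<dots> = (\<Prod>i\<in>UNIV. ennreal \<psi> * ((\<integral>\<^sup>+y\<in>Q. f i y \<partial>M) * (e k * (\<integral>\<^sup>+x\<in>Q. v i x \<partial>M))))"
      by (simp add: prod.distrib[symmetric] mult_ac)
    also have "\<dots> \<le> (\<Prod>i\<in>UNIV. ennreal \<psi> * emeasure (N i) Q)"
    proof (intro prod_mono_ennreal mult_left_mono)
      fix i
      have "(\<integral>\<^sup>+y\<in>Q. f i y \<partial>M) * (e k * (\<integral>\<^sup>+x\<in>Q. v i x \<partial>M))
        = (\<integral>\<^sup>+y. (f i y * indicator Q y) * (e k * (\<integral>\<^sup>+x\<in>Q. v i x \<partial>M)) \<partial>M)"
        using meas Qs by (subst nn_integral_multc) auto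
      also have "\<dots> \<le> (\<integral>\<^sup>+y\<in>Q. f i y * c i y \<partial>M)"
      proof (rule nn_integral_mono)
        fix y
        have "e k * (\<integral>\<^sup>+x\<in>Q. v i x \<partial>M) \<le> c i y" if "y \<in> Q"
          unfolding c_def using k cell_eq[of y k x] that by (intro SUP_upper2[of k]) auto
        then show "f i y * indicator Q y * (e k * (\<integral>\<^sup>+x\<in>Q. v i x \<partial>M)) \<le> f i y * c i y * indicator Q y"
          by (auto intro: mult_left_mono split: split_indicator)
      qed
      also have "\<dots> = emeasure (N i) Q" unfolding N_def using Nm Qs by (simp add: emeasure_density)
      finally show "(\<integral>\<^sup>+y\<in>Q. f i y \<partial>M) * (e k * (\<integral>\<^sup>+x\<in>Q. v i x \<partial>M)) \<le> emeasure (N i) Q" .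
    qed simp
    finally show "ennreal t * U Q ^ CARD('m) \<le> (\<Prod>i\<in>UNIV. ennreal \<psi> * emeasure (N i) Q)" .
  qed (use \<open>0 < t\<close> in auto)
  also have "\<dots> \<le> (\<Prod>i\<in>UNIV. ennreal \<psi> * (\<integral>\<^sup>+x. f i x * c i x \<partial>M))"
  proof (rule prod_mono_ennreal)
    fix i
    have "(\<integral>\<^sup>+Q. emeasure (N i) Q \<partial>count_space (generation S 1)) = (\<integral>\<^sup>+Q. emeasure (N i) (Q \<inter> covered S 1) \<partial>count_space (generation S 1))"
      using generation_subset_covered[OF S] by (intro nn_integral_cong) (simp add: Int_absorb2)
    also have "\<dots> = emeasure (N i) (covered S 1)"
      by (rule emeasure_split_generation[OF S _ sets_covered[OF S], symmetric]) (auto simp: N_def)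
    also have "\<dots> \<le> emeasure (N i) (space (N i))" by (rule emeasure_space)
    also have "\<dots> = (\<integral>\<^sup>+x. f i x * c i x \<partial>M)"
      unfolding N_def using Nm by (simp add: emeasure_density cong: nn_integral_cong)
    finally show "(\<integral>\<^sup>+Q. ennreal \<psi> * emeasure (N i) Q \<partial>count_space (generation S 1)) \<le> ennreal \<psi> * (\<integral>\<^sup>+x. f i x * c i x \<partial>M)"
      by (simp add: nn_integral_cmult mult_left_mono)
  qed
  finally show ?thesis unfolding split c_def .
qed

text \<open>
  If \<open>a\<close> stays in a window while the side of the cell shrinks by \<open>2^s\<close>, the product of the averages
  of the \<open>f i\<close> must grow, so one of them grows by the factor \<open>2 * CARD('m)\<close>; by the weak type
  inequality this happens on at most the fraction \<open>1/(2 * CARD('m))\<close> of the larger cell.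
\<close>

lemma sparse_window:
  fixes f :: "'m::finite \<Rightarrow> 'a \<Rightarrow> ennreal" and e :: "nat \<Rightarrow> ennreal"
  defines "a \<equiv> \<lambda>k x. \<Prod>i\<in>UNIV. e k * (\<integral>\<^sup>+y\<in>cell k x. f i y \<partial>M)"
  assumes f: "\<And>i. f i \<in> borel_measurable M" and "0 < t"
    and scale: "\<And>j k x y. j + s \<le> k \<Longrightarrow> k \<le> L \<Longrightarrow> y \<in> cell k x \<Longrightarrow>
      of_nat (4 * CARD('m)) * (e j * emeasure M (cell j y)) \<le> e k * emeasure M (cell k x)"
    and S: "\<And>k x. S k x \<longleftrightarrow> ennreal t < a k x \<and> a k x \<le> 2 * ennreal t \<and> k mod s = r"
  shows "saturated S" "sparse S"
proof -
  show "saturated S" unfolding saturated_def S a_def using cell_eq by simp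
  define m where "m = CARD('m)"
  have m: "1 \<le> m" unfolding m_def by (simp add: Suc_leI)
  define F where "F i = density M (f i)" for i
  have F: "sets (F i) = sets M" for i unfolding F_def by simp
  have Fe: "(\<integral>\<^sup>+y\<in>A. f i y \<partial>M) = emeasure (F i) A" if "A \<in> sets M" for i A
    unfolding F_def using f that by (simp add: emeasure_density)
  have a: "a k x = (\<Prod>i\<in>UNIV. e k * emeasure (F i) (cell k x))" for k x
    unfolding a_def by (simp add: Fe sets_cell)
  show "sparse S"
    unfolding sparse_def
  proof (intro allI impI)
    fix k x assume k: "k \<le> L" and Sk: "S k x"
    let ?Q = "cell k x"
    have a0: "a k x \<noteq> 0" using Sk \<open>0 < t\<close> unfolding S by (metis not_less_zero)
    have "2 * ennreal t < \<infinity>" by (simp add: ennreal_mult_less_top less_top)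
    then have a1: "a k x \<noteq> \<infinity>" using Sk unfolding S by (metis leD)
    have e: "e k \<noteq> 0" using a0 unfolding a by auto
    have F0: "emeasure (F i) ?Q \<noteq> 0" for i using a0 unfolding a by auto
    have F1: "emeasure (F i) ?Q \<noteq> \<infinity>" for i
    proof
      assume "emeasure (F i) ?Q = \<infinity>"
      then have "e k * emeasure (F i) ?Q = \<infinity>" using e by (simp add: ennreal_mult_top)
      then have "a k x = \<infinity>" using a0 unfolding a by (auto simp: ennreal_prod_eq_top)
      then show False using a1 by simp
    qed
    note Q = emeasure_cell[of k x]
    \<comment> \<open>This is 2m times the average of \<open>f i\<close> over the cell; the weak
      type inequality confines the cells with a larger average to the fraction 1/(2m).\<close>
    define b where "b i = of_nat (2 * m) * emeasure (F i) ?Q / emeasure M ?Q" for i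
    have bQ: "emeasure M ?Q * b i = of_nat (2 * m) * emeasure (F i) ?Q" for i
    proof -
      have "emeasure M ?Q * b i = of_nat (2 * m) * emeasure (F i) ?Q * emeasure M ?Q / emeasure M ?Q"
        unfolding b_def by (subst ennreal_times_divide, subst mult.commute) (rule refl)
      then show ?thesis using Q by (simp add: ennreal_mult_divide_eq)
    qed
    define Y where "Y i = ?Q \<inter> {y. \<exists>j\<le>k. b i * emeasure M (cell j y) \<le> emeasure (F i) (cell j y)}" for i
    have sub: "?Q \<inter> {y. \<exists>j<k. S j y} \<subseteq> (\<Union>i\<in>UNIV. Y i)"
    proof
      fix y assume "y \<in> ?Q \<inter> {y. \<exists>j<k. S j y}"
      then obtain j where y: "y \<in> ?Q" and j: "j < k" "S j y" by auto
      \<comment> \<open>Distinct levels in one residue class modulo \<open>s\<close> are at least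
        \<open>s\<close> apart, as \<open>scale\<close> demands.\<close>
      have "j + s \<le> k"
      proof -
        have "k mod s = j mod s" using Sk j(2) unfolding S by simp
        then have "s dvd k - j" using j(1) by (metis less_imp_le mod_eq_dvd_iff_nat)
        then have "s \<le> k - j" by (rule dvd_imp_le) (use j(1) in simp)
        then show ?thesis using j(1) by simp
      qed
      note sc = scale[OF this k y]
      have "\<exists>i. b i * emeasure M (cell j y) \<le> emeasure (F i) (cell j y)"
      proof (rule ccontr)
        assume "\<not> ?thesis"
        then have lt: "emeasure (F i) (cell j y) \<le> b i * emeasure M (cell j y)" for i by (auto simp: not_le less_imp_le)
        \<comment> \<open>The 4m of \<open>scale\<close> against the 2m in \<open>b\<close> leaves a
          factor 2 for each index. Then \<open>a\<close> would grow by 2^m >= 2, which is impossible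
          in a half-open window of ratio 2.\<close>
        have "2 * (e j * emeasure (F i) (cell j y)) \<le> e k * emeasure (F i) ?Q" for i
        proof -
          have "emeasure M ?Q * (of_nat (2 * m) * (2 * (e j * emeasure (F i) (cell j y))))
            \<le> emeasure M ?Q * (of_nat (2 * m) * (2 * (e j * (b i * emeasure M (cell j y)))))"
            using lt by (intro mult_left_mono) auto
          also have "\<dots> = (emeasure M ?Q * b i) * (of_nat (4 * m) * (e j * emeasure M (cell j y)))"
            by (simp add: mult_ac)
          also have "\<dots> \<le> (emeasure M ?Q * b i) * (e k * emeasure M ?Q)"
            using sc unfolding m_def[symmetric] by (intro mult_left_mono) auto
          also have "emeasure M ?Q * b i = of_nat (2 * m) * emeasure (F i) ?Q" by (rule bQ)
          also have "\<dots> * (e k * emeasure M ?Q) = emeasure M ?Q * (of_nat (2 * m) * (e k * emeasure (F i) ?Q))"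
            by (simp add: mult_ac)
          finally show ?thesis
            using Q m by (subst (asm) ennreal_mult_le_mult_iff, simp, simp, subst (asm) ennreal_mult_le_mult_iff)
              (auto simp: of_nat_eq_0_iff simp del: of_nat_mult)
        qed
        then have "(\<Prod>i\<in>(UNIV::'m set). 2 * (e j * emeasure (F i) (cell j y))) \<le> a k x"
          unfolding a by (intro prod_mono_ennreal)
        then have "2 ^ m * a j y \<le> a k x" unfolding a m_def by (simp add: prod.distrib)
        also have "\<dots> \<le> 2 * ennreal t" using Sk unfolding S by simp
        also have "\<dots> < 2 * a j y"
          using j(2) unfolding S by (intro ennreal_mult_strict_left_mono) auto
        also have "\<dots> \<le> 2 ^ m * a j y"
          using m power_increasing[of 1 m "2::ennreal"] by (intro mult_right_mono) auto
        finally show False by simp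
      qed
      then obtain i where "b i * emeasure M (cell j y) \<le> emeasure (F i) (cell j y)" by blast
      then have "y \<in> Y i" unfolding Y_def using y less_imp_le[OF j(1)] by blast
      then show "y \<in> (\<Union>i\<in>UNIV. Y i)" by blast
    qed
    have Ys: "Y i \<in> sets M" for i
      unfolding Y_def
    proof (rule sets_cellwise)
      fix z y assume y: "y \<in> cell 0 z" and z: "z \<in> ?Q \<inter> {y. \<exists>j\<le>k. b i * emeasure M (cell j y) \<le> emeasure (F i) (cell j y)}"
      then have "cell j y = cell j z" for j using cell_eq_above by blast
      moreover from this z have "y \<in> ?Q" using cell_self[of y k] cell_eq[of z k x] by auto
      ultimately show "y \<in> ?Q \<inter> {y. \<exists>j\<le>k. b i * emeasure M (cell j y) \<le> emeasure (F i) (cell j y)}"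
        using z by auto
    qed
    have Yi: "of_nat (2 * m) * emeasure M (Y i) \<le> emeasure M ?Q" for i
    proof -
      have "b i * emeasure M (Y i) \<le> emeasure (F i) ?Q"
        unfolding Y_def by (rule cell_weak_type[OF F k])
      then have "emeasure M ?Q * (b i * emeasure M (Y i)) \<le> emeasure M ?Q * emeasure (F i) ?Q"
        by (intro mult_left_mono) auto
      then have "(emeasure M ?Q * b i) * emeasure M (Y i) \<le> emeasure M ?Q * emeasure (F i) ?Q"
        by (simp only: mult.assoc)
      then have "emeasure (F i) ?Q * (of_nat (2 * m) * emeasure M (Y i)) \<le> emeasure (F i) ?Q * emeasure M ?Q"
        unfolding bQ by (simp add: mult_ac)
      then show ?thesis using F0[of i] F1[of i] by (subst (asm) ennreal_mult_le_mult_iff) auto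
    qed
    have "of_nat m * (2 * emeasure M (?Q \<inter> {y. \<exists>j<k. S j y})) \<le> of_nat (2 * m) * emeasure M (\<Union>i\<in>UNIV. Y i)"
      using sub Ys by (auto simp: mult_ac intro!: mult_left_mono emeasure_mono)
    also have "\<dots> \<le> of_nat (2 * m) * (\<Sum>i\<in>UNIV. emeasure M (Y i))"
      using Ys by (intro mult_left_mono emeasure_subadditive_finite) auto
    also have "\<dots> = (\<Sum>i\<in>UNIV. of_nat (2 * m) * emeasure M (Y i))" by (rule sum_distrib_left)
    also have "\<dots> \<le> (\<Sum>i\<in>(UNIV::'m set). emeasure M ?Q)" by (intro sum_mono Yi)
    also have "\<dots> = of_nat m * emeasure M ?Q" unfolding m_def by simp
    finally show "2 * emeasure M (?Q \<inter> {y. \<exists>j<k. S j y}) \<le> emeasure M ?Q"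
      using m by (subst (asm) ennreal_mult_le_mult_iff) auto
  qed
qed

end

section \<open>Weak type estimate for one grid\<close>

lemma binary_window:
  fixes a b :: real
  assumes "0 < a" "a \<le> b"
  obtains j :: nat where "b / 2 ^ Suc j < a" "a \<le> b / 2 ^ j"
proof -
  have ex: "\<exists>j. b / 2 ^ Suc j < a"
  proof -
    obtain n where "(1/2) ^ n < a / b"
      using real_arch_pow_inv[of "a / b" "1/2"] assms by auto
    then have "b / 2 ^ n < a" using assms by (simp add: field_simps power_one_over)
    moreover have "b / 2 ^ Suc n \<le> b / 2 ^ n" using assms by (simp add: field_simps)
    ultimately show ?thesis by (intro exI[of _ n]) linarith
  qed
  define j where "j = (LEAST j. b / 2 ^ Suc j < a)"
  have j: "b / 2 ^ Suc j < a" unfolding j_def by (rule LeastI_ex[OF ex])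
  have "a \<le> b / 2 ^ j"
  proof (cases j)
    case 0
    then show ?thesis using assms by simp
  next
    case (Suc i)
    then have "\<not> b / 2 ^ Suc i < a" using not_less_Least[of i "\<lambda>j. b / 2 ^ Suc j < a"] unfolding j_def by simp
    then show ?thesis using Suc by simp
  qed
  with j that show ?thesis by blast
qed

text \<open>
  A sum exceeding \<open>\<lambda>\<close> forces, in one of the windows \<open>(\<lambda>/2^(j+1), \<lambda>/2^j]\<close>, more than
  \<open>c 2^(j (1 - \<eta>))\<close> terms of one residue class: \<open>grid_threshold\<close> is this \<open>c\<close>. With
  \<open>\<eta> = (\<delta>/2)/(1 + \<delta>)\<close> the decay \<open>q^(-(1 + \<delta>))\<close> in the number \<open>q\<close> of terms
  becomes \<open>2^(-j (1 + \<delta>/2))\<close>, which beats the factor \<open>2^(j/m)\<close> lost in the height.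
\<close>

definition grid_threshold :: "real \<Rightarrow> nat \<Rightarrow> real" where
  "grid_threshold \<delta> s = (1 - 2 powr - (\<delta> / 2 / (1 + \<delta>))) / real s"

text \<open>The first summand accounts for the cells on which one term alone exceeds the level, the
  second for the \<open>s\<close> residue classes and the geometric series of the windows with ratio
  2^(-\<delta>/2).\<close>

definition grid_const :: "real \<Rightarrow> real \<Rightarrow> nat \<Rightarrow> real" where
  "grid_const \<delta> C s = 8 * 2 powr \<delta> * C +
     real s * (2 * (8 * 2 powr \<delta> * C) * grid_threshold \<delta> s powr - (1 + \<delta>)) / (1 - 2 powr - (\<delta> / 2))"

lemma two_powr_minus_less_1: "0 < x \<Longrightarrow> (2::real) powr - x < 1"
  using powr_less_mono[of "- x" 0 2] by simp

lemma grid_threshold_pos: "0 < \<delta> \<Longrightarrow> 0 < s \<Longrightarrow> 0 < grid_threshold \<delta> s"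
  unfolding grid_threshold_def using two_powr_minus_less_1[of "\<delta> / 2 / (1 + \<delta>)"] by simp

lemma grid_const_pos: "0 < \<delta> \<Longrightarrow> 0 < C \<Longrightarrow> 0 < grid_const \<delta> C s"
  unfolding grid_const_def using two_powr_minus_less_1[of "\<delta> / 2"]
  by (intro add_pos_nonneg divide_nonneg_pos mult_nonneg_nonneg) auto

lemma sum_le_of_few_in_windows:
  fixes a :: "nat \<Rightarrow> real"
  assumes a: "\<And>k. k \<le> L \<Longrightarrow> 0 \<le> a k" "\<And>k. k \<le> L \<Longrightarrow> a k \<le> b" and "0 < b" "0 < \<delta>" "0 < s"
    and few: "\<And>j r. r < s \<Longrightarrow>
      real (card {k. k \<le> L \<and> b / 2 ^ Suc j < a k \<and> a k \<le> b / 2 ^ j \<and> k mod s = r})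
        \<le> grid_threshold \<delta> s * 2 powr (real j * (1 - \<delta> / 2 / (1 + \<delta>)))"
  shows "(\<Sum>k\<le>L. a k) \<le> b"
proof -
  let ?S = "\<lambda>j r k. b / 2 ^ Suc j < a k \<and> a k \<le> b / 2 ^ j \<and> k mod s = r"
  define \<eta> where "\<eta> = \<delta> / 2 / (1 + \<delta>)"
  have eta: "0 < \<eta>" unfolding \<eta>_def using \<open>0 < \<delta>\<close> by simp
  \<comment> \<open>There are finitely many terms and the zero ones need no window, so finitely many
    windows suffice.\<close>
  have "\<exists>j. \<forall>k. k \<le> L \<longrightarrow> 0 < a k \<longrightarrow> (\<exists>i<j. b / 2 ^ Suc i < a k \<and> a k \<le> b / 2 ^ i)"
  proof -
    have "\<exists>i. k \<le> L \<longrightarrow> 0 < a k \<longrightarrow> b / 2 ^ Suc i < a k \<and> a k \<le> b / 2 ^ i" for k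
      using binary_window[of "a k" b] a by metis
    then obtain i where i: "\<And>k. k \<le> L \<Longrightarrow> 0 < a k \<Longrightarrow> b / 2 ^ Suc (i k) < a k \<and> a k \<le> b / 2 ^ i k"
      by metis
    have "i k < Suc (Max (i ` {..L}))" if "k \<le> L" for k
      using that by (simp add: less_Suc_eq_le)
    then show ?thesis using i by blast
  qed
  then obtain J where J: "\<And>k. k \<le> L \<Longrightarrow> 0 < a k \<Longrightarrow> \<exists>i<J. b / 2 ^ Suc i < a k \<and> a k \<le> b / 2 ^ i"
    by blast
  have each: "a k \<le> (\<Sum>j<J. \<Sum>r<s. if ?S j r k then b / 2 ^ j else 0)" if k: "k \<le> L" for k
  proof (cases "0 < a k")
    case False
    then have "a k \<le> 0" by simp
    also have "0 \<le> (\<Sum>j<J. \<Sum>r<s. if ?S j r k then b / 2 ^ j else 0)"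
      using \<open>0 < b\<close> by (intro sum_nonneg) auto
    finally show ?thesis .
  next
    case True
    then obtain i where i: "i < J" "b / 2 ^ Suc i < a k" "a k \<le> b / 2 ^ i" using J[OF k] by blast
    have "a k \<le> (if ?S i (k mod s) k then b / 2 ^ i else 0)" using i by simp
    also have "\<dots> \<le> (\<Sum>r<s. if ?S i r k then b / 2 ^ i else 0)"
      using \<open>0 < b\<close> \<open>0 < s\<close>
      by (intro member_le_sum[of "k mod s" _ "\<lambda>r. if ?S i r k then b / 2 ^ i else 0"]) auto
    also have "\<dots> \<le> (\<Sum>j<J. \<Sum>r<s. if ?S j r k then b / 2 ^ j else 0)"
      using \<open>0 < b\<close> i(1)
      by (intro member_le_sum[of i _ "\<lambda>j. \<Sum>r<s. if ?S j r k then b / 2 ^ j else 0"]) (auto intro!: sum_nonneg)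
    finally show ?thesis .
  qed
  have "(\<Sum>k\<le>L. a k) \<le> (\<Sum>k\<le>L. \<Sum>j<J. \<Sum>r<s. if ?S j r k then b / 2 ^ j else 0)"
    by (intro sum_mono each) simp
  also have "\<dots> = (\<Sum>j<J. \<Sum>k\<le>L. \<Sum>r<s. if ?S j r k then b / 2 ^ j else 0)" by (rule sum.swap)
  also have "\<dots> = (\<Sum>j<J. \<Sum>r<s. \<Sum>k\<le>L. if ?S j r k then b / 2 ^ j else 0)"
    by (intro sum.cong refl sum.swap)
  also have "\<dots> \<le> (\<Sum>j<J. \<Sum>r<s. grid_threshold \<delta> s * b * (2 powr - \<eta>) ^ j)"
  proof (intro sum_mono)
    fix j r assume r: "r \<in> {..<s}"
    have "(\<Sum>k\<le>L. if ?S j r k then b / 2 ^ j else 0) = (\<Sum>k\<in>{k\<in>{..L}. ?S j r k}. b / 2 ^ j)"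
      by (rule sum.inter_filter[symmetric]) simp
    also have "\<dots> = real (card {k\<in>{..L}. ?S j r k}) * (b / 2 ^ j)" by simp
    also have "\<dots> \<le> (grid_threshold \<delta> s * 2 powr (real j * (1 - \<eta>))) * (b / 2 ^ j)"
      using few[of r j] r \<open>0 < b\<close> unfolding \<eta>_def by (intro mult_right_mono) auto
    also have "2 powr (real j * (1 - \<eta>)) = 2 ^ j * (2 powr - \<eta>) ^ j"
      by (simp add: powr_realpow[symmetric] powr_powr powr_add[symmetric] algebra_simps)
    finally show "(\<Sum>k\<le>L. if ?S j r k then b / 2 ^ j else 0) \<le> grid_threshold \<delta> s * b * (2 powr - \<eta>) ^ j"
      by (simp add: mult_ac)
  qed
  also have "\<dots> = real s * grid_threshold \<delta> s * b * (\<Sum>j<J. (2 powr - \<eta>) ^ j)"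
    by (simp add: sum_distrib_left mult_ac)
  \<comment> \<open>\<open>grid_threshold\<close> is normalised precisely so that the full geometric
    series adds up to \<open>b\<close>.\<close>
  also have "\<dots> = (1 - 2 powr - \<eta>) * b * (\<Sum>j<J. (2 powr - \<eta>) ^ j)"
    using \<open>0 < s\<close> unfolding grid_threshold_def \<eta>_def by simp
  also have "\<dots> = b * (1 - (2 powr - \<eta>) ^ J)"
    using one_diff_power_eq[of "2 powr - \<eta>" J] by (simp add: mult_ac)
  also have "\<dots> \<le> b * 1" using \<open>0 < b\<close> by (intro mult_left_mono) auto
  finally show ?thesis by simp
qed

context nested_cells
begin

text \<open>The level set is covered by the points where a single term exceeds \<open>b\<close> and,
  for each window \<open>j\<close> and residue \<open>r\<close>, by the points lying in at least
  \<open>q j\<close> cells of that family. The bounds for these pieces form a geometric series in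
  \<open>j\<close>.\<close>

lemma grid_operator_weak_type:
  fixes w v f :: "'m::finite \<Rightarrow> 'a \<Rightarrow> ennreal" and e :: "nat \<Rightarrow> ennreal"
  defines "a \<equiv> \<lambda>k x. \<Prod>i\<in>UNIV. e k * (\<integral>\<^sup>+y\<in>cell k x. f i y \<partial>M)"
  assumes "0 < \<delta>" "0 < C" "0 < s" "0 < b"
    and meas: "u \<in> borel_measurable M" "\<And>i. w i \<in> borel_measurable M" "\<And>i. f i \<in> borel_measurable M"
    and uw: "\<And>x. u x ^ CARD('m) \<le> (\<Prod>i\<in>UNIV. w i x)"
    and dom: "\<And>i. dominates C \<delta> (density M (w i)) (v i)"
    and scale: "\<And>j k x y. j + s \<le> k \<Longrightarrow> k \<le> L \<Longrightarrow> y \<in> cell k x \<Longrightarrow>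
      of_nat (4 * CARD('m)) * (e j * emeasure M (cell j y)) \<le> e k * emeasure M (cell k x)"
  shows "{x. ennreal b < (\<Sum>k\<le>L. a k x)} \<in> sets M"
    and "ennreal b * (\<integral>\<^sup>+x\<in>{x. ennreal b < (\<Sum>k\<le>L. a k x)}. u x \<partial>M) ^ CARD('m) \<le>
      ennreal (grid_const \<delta> C s ^ CARD('m)) *
        (\<Prod>i\<in>UNIV. \<integral>\<^sup>+x. f i x * (SUP k\<in>{..L}. e k * (\<integral>\<^sup>+y\<in>cell k x. v i y \<partial>M)) \<partial>M)"
proof -
  define m where "m = CARD('m)"
  have m: "1 \<le> m" unfolding m_def by (simp add: Suc_leI)
  have v: "v i \<in> borel_measurable M" for i using dom unfolding dominates_def by auto
  define X where "X i = (\<integral>\<^sup>+x. f i x * (SUP k\<in>{..L}. e k * (\<integral>\<^sup>+y\<in>cell k x. v i y \<partial>M)) \<partial>M)" for i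
  have acell: "a k y = a k x" if "y \<in> cell k x" for k x y unfolding a_def using cell_eq[OF that] by simp
  let ?E = "{x. ennreal b < (\<Sum>k\<le>L. a k x)}"
  show Es: "?E \<in> sets M"
  proof (rule sets_cellwise)
    fix x y assume "y \<in> cell 0 x" "x \<in> ?E"
    moreover from this have "a k y = a k x" for k unfolding a_def using cell_eq_above by simp
    ultimately show "y \<in> ?E" by simp
  qed
  have K: "0 < grid_const \<delta> C s" using \<open>0 < \<delta>\<close> \<open>0 < C\<close> by (rule grid_const_pos)
  have goal: "ennreal b * (\<integral>\<^sup>+x\<in>?E. u x \<partial>M) ^ m \<le> ennreal (grid_const \<delta> C s ^ m) * (\<Prod>i\<in>UNIV. X i)"
  proof (cases "(\<Prod>i\<in>UNIV. X i) = \<infinity>")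
    case True
    show ?thesis using K unfolding True by (simp add: ennreal_mult_top)
  next
    case False
    then obtain p where p: "(\<Prod>i\<in>UNIV. X i) = ennreal p" "0 \<le> p" by (cases "\<Prod>i\<in>UNIV. X i") auto
    \<comment> \<open>Up to the constant this is the claimed bound for the u-measure; every piece is
      estimated by a multiple of it.\<close>
    define B where "B = root m (p / b)"
    have B: "0 \<le> B" unfolding B_def using p \<open>0 < b\<close> m by simp
    define U where "U A = emeasure (density M u) A" for A
    have U: "U A = (\<integral>\<^sup>+x\<in>A. u x \<partial>M)" if "A \<in> sets M" for A
      unfolding U_def using meas that by (simp add: emeasure_density)
    have est: "U (covered S q) \<le> ennreal (\<psi> * root m (p / t))"
      if S: "saturated S" and "1 \<le> q" "0 < t" "0 \<le> \<psi>"
        and big: "\<And>k x. k \<le> L \<Longrightarrow> S k x \<Longrightarrow> ennreal t \<le> a k x"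
        and wv: "\<And>Q i. Q \<in> generation S 1 \<Longrightarrow> emeasure (density M (w i)) (Q \<inter> covered S q) \<le> ennreal \<psi> * (\<integral>\<^sup>+x\<in>Q. v i x \<partial>M)"
      for S q t \<psi>
    proof (rule le_of_power_le_ennreal)
      have "ennreal t * (\<integral>\<^sup>+x\<in>covered S q. u x \<partial>M) ^ m \<le> (\<Prod>i\<in>UNIV. ennreal \<psi> * X i)"
        unfolding m_def X_def
      proof (rule first_generation_estimate[OF S \<open>1 \<le> q\<close> \<open>0 < t\<close> big[unfolded a_def] meas(1,2) v meas(3) uw])
        fix Q i assume Q: "Q \<in> generation S 1"
        then show "(\<integral>\<^sup>+x\<in>Q \<inter> covered S q. w i x \<partial>M) \<le> ennreal \<psi> * (\<integral>\<^sup>+x\<in>Q. v i x \<partial>M)"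
          using wv[OF Q, of i] meas generation_sets[OF Q] sets_covered[OF S] by (simp add: emeasure_density)
      qed
      also have "\<dots> = ennreal (\<psi> ^ m * p)"
        using p \<open>0 \<le> \<psi>\<close> by (simp add: prod.distrib m_def ennreal_power ennreal_mult)
      finally show "ennreal t * U (covered S q) ^ m \<le> ennreal (\<psi> ^ m * p)"
        using sets_covered[OF S] by (simp add: U)
    qed (use \<open>0 < t\<close> \<open>0 \<le> \<psi>\<close> p m in auto)
    define C' where "C' = 8 * 2 powr \<delta> * C"
    have C': "0 < C'" "C \<le> C'"
    proof -
      show "0 < C'" unfolding C'_def using \<open>0 < C\<close> by simp
      have "1 \<le> 2 powr \<delta>" using \<open>0 < \<delta>\<close> by (simp add: ge_one_powr_ge_zero)
      then show "C \<le> C'" unfolding C'_def using \<open>0 < C\<close> mult_right_mono[of 1 "8 * 2 powr \<delta>" C] by simp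
    qed
    define S0 where "S0 k x \<longleftrightarrow> ennreal b < a k x" for k x
    have S0: "saturated S0" unfolding saturated_def S0_def using acell by simp
    have U0: "U (covered S0 1) \<le> ennreal (C' * B)"
      unfolding B_def
    proof (rule est[OF S0])
      fix Q i assume Q: "Q \<in> generation S0 1"
      have "emeasure (density M (w i)) (Q \<inter> covered S0 1) \<le> emeasure (density M (w i)) Q"
        using generation_sets[OF Q] by (intro emeasure_mono) auto
      also have "\<dots> \<le> ennreal C * (\<integral>\<^sup>+x\<in>Q. v i x \<partial>M)" by (rule dominates_cell[OF dom Q])
      also have "\<dots> \<le> ennreal C' * (\<integral>\<^sup>+x\<in>Q. v i x \<partial>M)" using C' by (intro mult_right_mono ennreal_leI) auto
      finally show "emeasure (density M (w i)) (Q \<inter> covered S0 1) \<le> ennreal C' * (\<integral>\<^sup>+x\<in>Q. v i x \<partial>M)" .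
    qed (use \<open>0 < b\<close> C' in \<open>auto simp: S0_def\<close>)
    define c0 where "c0 = grid_threshold \<delta> s"
    have c0: "0 < c0" unfolding c0_def using \<open>0 < \<delta>\<close> \<open>0 < s\<close> by (rule grid_threshold_pos)
    \<comment> \<open>Chosen so that (2^(j \<theta>))^(-(1 + \<delta>)) = 2^(-j) \<rho>^j with
      \<rho> = 2^(-\<delta>/2): the first factor pays for lowering the height to b/2^(j+1), the
      second makes the windows summable.\<close>
    define \<theta> where "\<theta> = 1 - \<delta> / 2 / (1 + \<delta>)"
    have th: "\<theta> * (1 + \<delta>) = 1 + \<delta> / 2" unfolding \<theta>_def using \<open>0 < \<delta>\<close> by (simp add: field_simps)
    \<comment> \<open>The least integer strictly above the threshold: fewer than \<open>q j\<close>
      cells means at most the threshold, as counting requires, while \<open>q j\<close> itself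
      exceeds it, as the decay requires.\<close>
    define q where "q j = nat \<lfloor>c0 * 2 powr (real j * \<theta>)\<rfloor> + 1" for j :: nat
    have q: "1 \<le> q j" "c0 * 2 powr (real j * \<theta>) \<le> real (q j)"
      "\<And>h. h < q j \<Longrightarrow> real h \<le> c0 * 2 powr (real j * \<theta>)" for j
    proof -
      have 0: "0 \<le> c0 * 2 powr (real j * \<theta>)" using c0 by simp
      show "1 \<le> q j" unfolding q_def by simp
      show "c0 * 2 powr (real j * \<theta>) \<le> real (q j)" unfolding q_def using 0 by linarith
      fix h assume "h < q j"
      then have "h \<le> nat \<lfloor>c0 * 2 powr (real j * \<theta>)\<rfloor>" unfolding q_def by simp
      then show "real h \<le> c0 * 2 powr (real j * \<theta>)" using 0 by linarith
    qed
    define S where "S j r k x \<longleftrightarrow> ennreal (b / 2 ^ Suc j) < a k x \<and> a k x \<le> 2 * ennreal (b / 2 ^ Suc j) \<and> k mod s = r"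
      for j r k x
    have S: "saturated (S j r)" "sparse (S j r)" for j r
      using sparse_window[of f "b / 2 ^ Suc j" s e "S j r" r, OF meas(3) _ scale] \<open>0 < b\<close>
      unfolding S_def a_def by auto
    define G where "G = 2 * C' * c0 powr - (1 + \<delta>)"
    have G: "0 \<le> G" unfolding G_def using C' c0 by simp
    define \<rho> where "\<rho> = (2::real) powr - (\<delta> / 2)"
    have rho: "0 < \<rho>" "\<rho> < 1" unfolding \<rho>_def using two_powr_minus_less_1[of "\<delta> / 2"] \<open>0 < \<delta>\<close> by auto
    have Uj: "U (covered (S j r) (q j)) \<le> ennreal (G * B * \<rho> ^ j)" for j r
    proof -
      define \<psi> where "\<psi> = C' * real (q j) powr - (1 + \<delta>)"
      have "U (covered (S j r) (q j)) \<le> ennreal (\<psi> * root m (p / (b / 2 ^ Suc j)))"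
      proof (rule est[OF S(1) q(1)])
        fix Q i assume "Q \<in> generation (S j r) 1"
        then show "emeasure (density M (w i)) (Q \<inter> covered (S j r) (q j)) \<le> ennreal \<psi> * (\<integral>\<^sup>+x\<in>Q. v i x \<partial>M)"
          unfolding \<psi>_def C'_def by (rule dominates_decay[OF dom S _ q(1) \<open>0 < \<delta>\<close> \<open>0 < C\<close>])
      qed (use \<open>0 < b\<close> C' in \<open>auto simp: S_def \<psi>_def\<close>)
      also have "\<dots> \<le> ennreal (G * B * \<rho> ^ j)"
      proof (rule ennreal_leI)
        have "real (q j) powr - (1 + \<delta>) \<le> (c0 * 2 powr (real j * \<theta>)) powr - (1 + \<delta>)"
          using q(2)[of j] c0 \<open>0 < \<delta>\<close> by (intro powr_mono2') auto
        also have "\<dots> = c0 powr - (1 + \<delta>) * 2 powr (- real j * (\<theta> * (1 + \<delta>)))"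
          using c0 by (simp add: powr_mult powr_powr algebra_simps)
        also have "2 powr (- real j * (\<theta> * (1 + \<delta>))) = \<rho> ^ j / 2 ^ j"
          unfolding th \<rho>_def by (simp add: powr_realpow[symmetric] powr_powr powr_diff[symmetric] algebra_simps)
            (rule arg_cong[where f="\<lambda>z. 2 powr z"], simp)
        finally have "\<psi> \<le> C' * (c0 powr - (1 + \<delta>) * (\<rho> ^ j / 2 ^ j))"
          unfolding \<psi>_def using C' by (intro mult_left_mono) auto
        then have psi: "\<psi> \<le> C' * c0 powr - (1 + \<delta>) * \<rho> ^ j / 2 ^ j" by simp
        have "root m (p / (b / 2 ^ Suc j)) = root m (2 ^ Suc j) * B"
          unfolding B_def by (simp add: real_root_mult[symmetric] mult_ac)
        \<comment> \<open>The advantage of the root for m > 1 is given away; the decay is strong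
          enough for the full loss 2^(j+1).\<close>
        also have "root m (2 ^ Suc j) \<le> root m ((2 ^ Suc j) ^ m)"
          using m by (subst real_root_le_iff) (auto simp del: power_Suc intro!: self_le_power one_le_power)
        also have "root m ((2 ^ Suc j) ^ m) = 2 ^ Suc j" using m by (intro real_root_power_cancel) auto
        finally have rt: "root m (p / (b / 2 ^ Suc j)) \<le> 2 ^ Suc j * B" using B by (simp add: mult_right_mono del: power_Suc)
        have "0 \<le> root m (p / (b / 2 ^ Suc j))" using m p \<open>0 < b\<close> by (intro real_root_ge_zero) auto
        then have "\<psi> * root m (p / (b / 2 ^ Suc j)) \<le> (C' * c0 powr - (1 + \<delta>) * \<rho> ^ j / 2 ^ j) * (2 ^ Suc j * B)"
          using psi rt C' c0 rho by (intro mult_mono) auto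
        also have "\<dots> = G * B * \<rho> ^ j" unfolding G_def by simp
        finally show "\<psi> * root m (p / (b / 2 ^ Suc j)) \<le> G * B * \<rho> ^ j" .
      qed
      finally show ?thesis .
    qed
    let ?F = "\<lambda>j. \<Union>r\<in>{..<s}. covered (S j r) (q j)"
    have Fs: "?F j \<in> sets M" for j using sets_covered[OF S(1)] by auto
    have cover: "?E \<subseteq> covered S0 1 \<union> (\<Union>j. ?F j)"
    proof (rule subsetI, rule ccontr)
      fix x assume x: "x \<in> ?E" "x \<notin> covered S0 1 \<union> (\<Union>j. ?F j)"
      have le: "a k x \<le> ennreal b" if "k \<le> L" for k
      proof (rule ccontr)
        assume "\<not> a k x \<le> ennreal b"
        then have "k \<in> {j. 0 \<le> j \<and> j \<le> L \<and> S0 j x}" using that by (simp add: S0_def)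
        moreover have "finite {j. 0 \<le> j \<and> j \<le> L \<and> S0 j x}" by simp
        ultimately have "1 \<le> height S0 0 x" unfolding height_def by (metis One_nat_def Suc_leI card_gt_0_iff empty_iff)
        then show False using x(2) by (simp add: covered_def)
      qed
      define \<alpha> where "\<alpha> k = enn2real (a k x)" for k
      have al: "a k x = ennreal (\<alpha> k)" "0 \<le> \<alpha> k" "\<alpha> k \<le> b" if "k \<le> L" for k
      proof -
        have "a k x < top" by (rule le_less_trans[OF le[OF that]]) simp
        then show "a k x = ennreal (\<alpha> k)" "0 \<le> \<alpha> k" "\<alpha> k \<le> b"
          using le[OF that] \<open>0 < b\<close> unfolding \<alpha>_def by (simp_all add: enn2real_leI)
      qed
      have "(\<Sum>k\<le>L. \<alpha> k) \<le> b"
      proof (rule sum_le_of_few_in_windows[OF _ _ \<open>0 < b\<close> \<open>0 < \<delta>\<close> \<open>0 < s\<close>])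
        fix j r assume r: "r < s"
        have "{k. k \<le> L \<and> b / 2 ^ Suc j < \<alpha> k \<and> \<alpha> k \<le> b / 2 ^ j \<and> k mod s = r} = {k. 0 \<le> k \<and> k \<le> L \<and> S j r k x}"
        proof -
          have "2 * ennreal (b / 2 ^ Suc j) = ennreal (b / 2 ^ j)"
            using \<open>0 < b\<close> by (simp add: numeral_mult_ennreal)
          then show ?thesis unfolding S_def using al \<open>0 < b\<close> by (auto simp: ennreal_less_iff simp del: power_Suc)
        qed
        moreover have "height (S j r) 0 x < q j" using x(2) r by (auto simp: covered_def not_le)
        ultimately show "real (card {k. k \<le> L \<and> b / 2 ^ Suc j < \<alpha> k \<and> \<alpha> k \<le> b / 2 ^ j \<and> k mod s = r})
            \<le> grid_threshold \<delta> s * 2 powr (real j * (1 - \<delta> / 2 / (1 + \<delta>)))"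
          using q(3)[of "height (S j r) 0 x" j] unfolding height_def c0_def \<theta>_def by simp
      qed (use al in auto)
      moreover have "(\<Sum>k\<le>L. a k x) = ennreal (\<Sum>k\<le>L. \<alpha> k)"
        using al by (subst sum_ennreal[symmetric]) auto
      ultimately show False using x(1) \<open>0 < b\<close> by (simp add: ennreal_less_iff sum_nonneg al)
    qed
    have "U ?E \<le> U (covered S0 1 \<union> (\<Union>j. ?F j))"
      unfolding U_def using cover sets_covered[OF S0] Fs by (intro emeasure_mono) auto
    also have "\<dots> \<le> U (covered S0 1) + U (\<Union>j. ?F j)"
      unfolding U_def using sets_covered[OF S0] Fs by (intro emeasure_subadditive) auto
    also have "U (\<Union>j. ?F j) \<le> (\<Sum>j. U (?F j))"
      unfolding U_def using Fs by (intro emeasure_subadditive_countably) auto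
    also have "(\<Sum>j. U (?F j)) \<le> (\<Sum>j. ennreal (real s * (G * B * \<rho> ^ j)))"
    proof (intro suminf_le allI)
      fix j
      have "U (?F j) \<le> (\<Sum>r\<in>{..<s}. U (covered (S j r) (q j)))"
        unfolding U_def using sets_covered[OF S(1)] by (intro emeasure_subadditive_finite) auto
      also have "\<dots> \<le> (\<Sum>r\<in>{..<s}. ennreal (G * B * \<rho> ^ j))" by (intro sum_mono Uj)
      also have "\<dots> = ennreal (real s * (G * B * \<rho> ^ j))"
        using G B rho by (subst sum_ennreal) auto
      finally show "U (?F j) \<le> ennreal (real s * (G * B * \<rho> ^ j))" .
    qed auto
    also have "\<dots> = ennreal (real s * G * B / (1 - \<rho>))"
    proof (rule suminf_ennreal_eq)
      show "(\<lambda>j. real s * (G * B * \<rho> ^ j)) sums (real s * G * B / (1 - \<rho>))"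
        using sums_mult[OF geometric_sums[of \<rho>], of "real s * G * B"] rho by (simp add: mult_ac)
    qed (use G B rho in auto)
    finally have "U ?E \<le> ennreal (C' * B) + ennreal (real s * G * B / (1 - \<rho>))"
      using U0 by (meson add_mono order_trans order_refl)
    also have "\<dots> = ennreal (C' * B + real s * G * B / (1 - \<rho>))"
      using C' B G rho by (intro ennreal_plus[symmetric]) auto
    also have "C' * B + real s * G * B / (1 - \<rho>) = grid_const \<delta> C s * B"
      unfolding grid_const_def G_def C'_def c0_def \<rho>_def by (simp add: algebra_simps add_divide_distrib)
    finally have "U ?E ^ m \<le> ennreal (grid_const \<delta> C s * B) ^ m" by (rule power_mono_ennreal)
    also have "\<dots> = ennreal (grid_const \<delta> C s ^ m * (p / b))"
      using K B m p \<open>0 < b\<close> unfolding B_def by (simp add: ennreal_power power_mult_distrib)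
    finally have "ennreal b * U ?E ^ m \<le> ennreal b * ennreal (grid_const \<delta> C s ^ m * (p / b))"
      by (intro mult_left_mono) auto
    also have "\<dots> = ennreal (grid_const \<delta> C s ^ m) * ennreal p"
      using K p \<open>0 < b\<close> by (simp add: ennreal_mult'[symmetric])
    finally show ?thesis using U[OF Es] p by simp
  qed
  then show "ennreal b * (\<integral>\<^sup>+x\<in>?E. u x \<partial>M) ^ CARD('m) \<le> ennreal (grid_const \<delta> C s ^ CARD('m)) *
        (\<Prod>i\<in>UNIV. \<integral>\<^sup>+x. f i x * (SUP k\<in>{..L}. e k * (\<integral>\<^sup>+y\<in>cell k x. v i y \<partial>M)) \<partial>M)"
    unfolding m_def X_def .
qed

end

section \<open>Dyadic grids and dominated weights\<close>

definition grid_side :: "real \<Rightarrow> nat \<Rightarrow> real" where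
  "grid_side h k = h * 2 ^ k"

definition grid_cell :: "real \<Rightarrow> real^'n \<Rightarrow> nat \<Rightarrow> real^'n \<Rightarrow> (real^'n) set" where
  "grid_cell h s k x =
     {y. \<forall>i. \<lfloor>(y $ i - s $ i) / grid_side h k\<rfloor> = \<lfloor>(x $ i - s $ i) / grid_side h k\<rfloor>}"

definition grid_corner :: "real \<Rightarrow> real^'n \<Rightarrow> nat \<Rightarrow> real^'n \<Rightarrow> real^'n" where
  "grid_corner h s k x = (\<chi> i. s $ i + grid_side h k * \<lfloor>(x $ i - s $ i) / grid_side h k\<rfloor>)"

text \<open>Closure of the half-open \<open>grid_cell\<close>. Cells must be half-open to partition
  space, while the maximal operators use closed cubes; equal measure lets averages be compared
  without a constant.\<close>

definition grid_cube :: "real \<Rightarrow> real^'n \<Rightarrow> nat \<Rightarrow> real^'n \<Rightarrow> (real^'n) set" where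
  "grid_cube h s k x = cbox (grid_corner h s k x) (\<chi> i. grid_corner h s k x $ i + grid_side h k)"

lemma grid_side_pos: "0 < h \<Longrightarrow> 0 < grid_side h k"
  by (simp add: grid_side_def)

lemma floor_scaled_eq_iff:
  fixes d :: real
  assumes "0 < d"
  shows "\<lfloor>t / d\<rfloor> = z \<longleftrightarrow> d * z \<le> t \<and> t < d * z + d"
  using assms by (auto simp: floor_eq_iff field_simps)

lemma mem_grid_cell_iff:
  assumes "0 < h"
  shows "y \<in> grid_cell h s k x \<longleftrightarrow>
    (\<forall>i. grid_corner h s k x $ i \<le> y $ i \<and> y $ i < grid_corner h s k x $ i + grid_side h k)"
  unfolding grid_cell_def mem_Collect_eq floor_scaled_eq_iff[OF grid_side_pos[OF assms]]
  by (simp add: grid_corner_def algebra_simps)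

lemma grid_cell_subset_cube: "0 < h \<Longrightarrow> grid_cell h s k x \<subseteq> grid_cube h s k x"
  unfolding grid_cube_def by (auto simp: mem_grid_cell_iff mem_box_cart less_imp_le)

lemma grid_cell_self: "x \<in> grid_cell h s k x"
  by (simp add: grid_cell_def)

lemma grid_cell_eq: "y \<in> grid_cell h s k x \<Longrightarrow> grid_cell h s k y = grid_cell h s k x"
  by (auto simp: grid_cell_def)

lemma grid_cube_eq: "y \<in> grid_cell h s k x \<Longrightarrow> grid_cube h s k y = grid_cube h s k x"
  by (simp add: grid_cell_def grid_cube_def grid_corner_def)

lemma grid_cube_in_cubes: "0 < h \<Longrightarrow> grid_cube h s k x \<in> cubes"
  unfolding cubes_def grid_cube_def using grid_side_pos by blast

lemma mem_grid_cube: "0 < h \<Longrightarrow> x \<in> grid_cube h s k x"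
  using grid_cell_subset_cube grid_cell_self by blast

lemma prod_Basis_const_vec:
  "(\<Prod>b\<in>(Basis :: (real^'n) set). (\<chi> i. d) \<bullet> b) = d ^ CARD('n)"
proof -
  have "(\<Prod>b\<in>(Basis :: (real^'n) set). (\<chi> i. d) \<bullet> b) = (\<Prod>b\<in>(Basis :: (real^'n) set). d)"
    by (rule prod.cong) (auto simp: Basis_vec_def inner_axis)
  then show ?thesis by simp
qed

lemma emeasure_grid_cube:
  assumes "0 < h"
  shows "emeasure lebesgue (grid_cube h s k (x :: real^'n)) = ennreal (grid_side h k ^ CARD('n))"
proof -
  let ?a = "grid_corner h s k x" and ?d = "grid_side h k"
  have d: "(\<chi> i. ?a $ i + ?d) - ?a = (\<chi> i. ?d)" by (simp add: vec_eq_iff)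
  have "?a \<bullet> b \<le> (\<chi> i. ?a $ i + ?d) \<bullet> b" if "b \<in> Basis" for b
    using that grid_side_pos[OF assms, of k] by (auto simp: Basis_vec_def inner_axis)
  then show ?thesis unfolding grid_cube_def by (simp add: d prod_Basis_const_vec)
qed

lemma sets_grid_cell: "grid_cell h s k x \<in> sets lebesgue"
proof -
  have [measurable]: "(\<lambda>y::real^'n. y $ i) \<in> borel_measurable borel" for i
    by (intro borel_measurable_continuous_onI continuous_intros)
  have "grid_cell h s k x \<in> sets borel"
    unfolding grid_cell_def by measurable
  then show ?thesis by simp
qed

lemma emeasure_grid_cell:
  assumes "0 < h"
  shows "emeasure lebesgue (grid_cell h s k (x :: real^'n)) = ennreal (grid_side h k ^ CARD('n))"
proof (rule antisym)
  show "emeasure lebesgue (grid_cell h s k x) \<le> ennreal (grid_side h k ^ CARD('n))"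
    unfolding emeasure_grid_cube[OF assms, of s k x, symmetric] using grid_cell_subset_cube[OF assms]
    by (intro emeasure_mono) (auto simp: grid_cube_def)
  let ?a = "grid_corner h s k x" and ?d = "grid_side h k"
  have d: "(\<chi> i. ?a $ i + ?d) - ?a = (\<chi> i. ?d)" by (simp add: vec_eq_iff)
  have "?a \<bullet> b \<le> (\<chi> i. ?a $ i + ?d) \<bullet> b" if "b \<in> Basis" for b
    using that grid_side_pos[OF assms, of k] by (auto simp: Basis_vec_def inner_axis)
  then have "ennreal (?d ^ CARD('n)) = emeasure lebesgue (box ?a (\<chi> i. ?a $ i + ?d))"
    by (simp add: d prod_Basis_const_vec)
  also have "\<dots> \<le> emeasure lebesgue (grid_cell h s k x)"
    by (intro emeasure_mono sets_grid_cell) (auto simp: mem_grid_cell_iff[OF assms] mem_box_cart less_imp_le)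
  finally show "ennreal (grid_side h k ^ CARD('n)) \<le> emeasure lebesgue (grid_cell h s k x)" .
qed

text \<open>Halving a quotient turns its floor into the integer quotient by 2. This relies on one
  shift serving all levels.\<close>

lemma grid_cell_Suc: "grid_cell h s k x \<subseteq> grid_cell h s (Suc k) x"
proof
  fix y assume "y \<in> grid_cell h s k x"
  moreover have "\<lfloor>t / grid_side h (Suc k)\<rfloor> = \<lfloor>t / grid_side h k\<rfloor> div 2" for t
  proof -
    have "t / grid_side h (Suc k) = t / grid_side h k / real_of_int 2"
      by (simp add: grid_side_def mult_ac)
    then show ?thesis by (simp only: floor_divide_real_eq_div)
  qed
  ultimately show "y \<in> grid_cell h s (Suc k) x" by (simp add: grid_cell_def)
qed

lemma countable_grid_cells: "countable (range (grid_cell h s k :: real^'n \<Rightarrow> _))"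
proof -
  have "range (grid_cell h s k) \<subseteq> range (\<lambda>z :: 'n \<Rightarrow> int. {y. \<forall>i. \<lfloor>(y $ i - s $ i) / grid_side h k\<rfloor> = z i})"
    by (auto simp: grid_cell_def)
  then show ?thesis by (rule countable_subset) simp
qed

lemma nested_cells_grid:
  assumes "0 < h" shows "nested_cells lebesgue (grid_cell h (s :: real^'n))"
proof
  show "emeasure lebesgue (grid_cell h s k x) \<noteq> 0" for k x
    using grid_side_pos[OF assms, of k] by (simp add: emeasure_grid_cell[OF assms])
qed (auto simp: emeasure_grid_cell[OF assms] grid_cell_self sets_grid_cell countable_grid_cells
  intro: subsetD[OF grid_cell_Suc] dest: grid_cell_eq)

text \<open>The constant is uniform in mesh, shift and cut-off, while \<open>v\<close> may vary with
  them: it will be a discretised maximal function, measurable even if nothing is known about the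
  measurability of \<open>V\<close>.\<close>

definition grid_dominated :: "real \<Rightarrow> real \<Rightarrow> (real^'n \<Rightarrow> ennreal) \<Rightarrow> (real^'n \<Rightarrow> ennreal) \<Rightarrow> bool" where
  "grid_dominated C \<delta> w V \<longleftrightarrow> (\<forall>h>0. \<forall>s L. \<exists>v. (\<forall>x. v x \<le> V x) \<and>
     nested_cells.dominates lebesgue (grid_cell h s) L C \<delta> (density lebesgue w) v)"

lemma HL_maximal_mono: "(\<And>x. f x \<le> g x) \<Longrightarrow> HL_maximal f x \<le> HL_maximal g x"
  unfolding HL_maximal_def
  by (intro SUP_mono') (auto intro!: divide_right_mono_ennreal nn_integral_mono mult_right_mono)

lemma grid_dominated_HL:
  fixes w :: "real^'n \<Rightarrow> ennreal"
  assumes w: "w \<in> borel_measurable lebesgue"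
  shows "grid_dominated 4 1 w (HL_maximal (HL_maximal w))"
  unfolding grid_dominated_def
proof (intro allI impI)
  fix h :: real and s :: "real^'n" and L assume h: "0 < h"
  interpret nested_cells lebesgue "grid_cell h s" L by (rule nested_cells_grid[OF h])
  let ?c = "grid_cell h s" and ?q = "grid_cube h s"
  \<comment> \<open>Maximal function over the closed grid cubes of finitely many levels. It lies
    below \<open>HL_maximal\<close> and is constant on the cells of level 0.\<close>
  define A where "A f x = (SUP k\<in>{..L}. (\<integral>\<^sup>+y\<in>?q k x. f y \<partial>lebesgue) / emeasure lebesgue (?q k x))"
    for f :: "real^'n \<Rightarrow> ennreal" and x
  have A_le: "A f x \<le> HL_maximal f x" for f x
    unfolding A_def HL_maximal_def using grid_cube_in_cubes[OF h] mem_grid_cube[OF h]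
    by (intro SUP_mono) blast
  have A_meas: "A f \<in> borel_measurable lebesgue" for f
  proof (rule borel_measurable_cellwise)
    fix x y assume y: "y \<in> ?c 0 x"
    have "?q k y = ?q k x" for k by (rule grid_cube_eq) (use y cell_mono[of 0 k x] in auto)
    then show "A f y = A f x" unfolding A_def by simp
  qed
  have A_ge: "(\<integral>\<^sup>+z\<in>?c k x. f z \<partial>lebesgue) \<le> emeasure lebesgue (?c k x) * A f y"
    if "k \<le> L" "y \<in> ?c k x" for f k x y
  proof -
    let ?I = "\<integral>\<^sup>+z\<in>?q k x. f z \<partial>lebesgue" and ?m = "emeasure lebesgue (?c k x)"
    have m: "?m = emeasure lebesgue (?q k x)" by (simp add: emeasure_grid_cell[OF h] emeasure_grid_cube[OF h])
    have "(\<integral>\<^sup>+z\<in>?c k x. f z \<partial>lebesgue) \<le> ?I"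
      using grid_cell_subset_cube[OF h] by (intro nn_integral_mono) (auto split: split_indicator)
    also have "?I = ?I * ?m / ?m" using emeasure_cell[of k x] by (simp add: ennreal_mult_divide_eq)
    also have "\<dots> = ?m * (?I / ?m)" by (simp add: ennreal_times_divide mult.commute)
    also have "\<dots> \<le> ?m * A f y"
      unfolding A_def m using that grid_cube_eq[OF that(2)] by (intro mult_left_mono SUP_upper2[of k]) auto
    finally show ?thesis .
  qed
  let ?\<nu> = "density lebesgue w"
  have nu: "emeasure ?\<nu> B = (\<integral>\<^sup>+z\<in>B. w z \<partial>lebesgue)" if "B \<in> sets lebesgue" for B
    using w that by (rule emeasure_density)
  have cell1: "emeasure ?\<nu> (?c k x) \<le> (\<integral>\<^sup>+z\<in>?c k x. A w z \<partial>lebesgue)" if "k \<le> L" for k x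
  proof -
    have "emeasure ?\<nu> (?c k x) \<le> 1 * (\<integral>\<^sup>+z\<in>?c k x. A w z \<partial>lebesgue)"
      using A_ge[OF that, of _ x w] sets_cell emeasure_cell
      by (intro le_set_integral A_meas) (auto simp: nu)
    then show ?thesis by simp
  qed
  have cell2: "emeasure ?\<nu> (?c k x) \<le> emeasure lebesgue (?c k x) * A (A w) y" if "k \<le> L" "y \<in> ?c k x" for k x y
    using cell1[OF that(1)] A_ge[OF that] by (rule order_trans)
  have four: "a \<le> 4 * a" for a :: ennreal using mult_right_mono[of 1 4 a] by simp
  have "dominates 4 1 ?\<nu> (A (A w))"
    unfolding dominates_def
  proof (intro conjI allI impI ballI)
    fix k x y assume "k \<le> L" "y \<in> ?c k x"
    then show "emeasure ?\<nu> (?c k x) \<le> ennreal 4 * emeasure lebesgue (?c k x) * A (A w) y"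
      using order_trans[OF cell2 four] by (simp add: mult_ac)
  next
    fix S g Q l y
    assume S: "saturated S" "sparse S" and g: "1 \<le> g" and Q: "Q \<in> generation S g" and y: "y \<in> Q"
    obtain k where k: "Q = ?c k y" "k \<le> L" by (rule generationE[OF S(1) Q y])
    show "emeasure ?\<nu> (Q \<inter> covered S (g + l)) \<le> ennreal (4 * (1 + real l) powr - 1) * emeasure lebesgue Q * A (A w) y"
    proof (cases "l = 0")
      case True
      have "emeasure ?\<nu> (Q \<inter> covered S (g + l)) \<le> emeasure ?\<nu> Q"
        using generation_sets[OF Q] by (intro emeasure_mono) auto
      also have "\<dots> \<le> emeasure lebesgue Q * A (A w) y"
        unfolding k(1) by (rule cell2[OF k(2) cell_self])
      also have "\<dots> \<le> 4 * (emeasure lebesgue Q * A (A w) y)" by (rule four)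
      finally show ?thesis using True by (simp add: mult_ac)
    next
      case False
      then have l: "0 < l" by simp
      let ?N = "emeasure ?\<nu> (Q \<inter> covered S (g + l))"
      \<comment> \<open>First use of the summation over layers, with depth 0 and \<phi> = 1: only
        the bound by averages is available, and \<open>l\<close> layers produce the decay
        1/l.\<close>
      have "of_nat l * emeasure ?\<nu> (Q \<inter> covered S (g + 0 + l)) \<le> 2 * 1 * (\<integral>\<^sup>+z\<in>Q. A w z \<partial>lebesgue)"
      proof (rule generation_gain[OF S A_meas _ _ Q g])
        fix g' R z assume R: "R \<in> generation S g'" and z: "z \<in> R"
        obtain j where j: "R = ?c j z" "j \<le> L" by (rule generationE[OF S(1) R z])
        have "emeasure ?\<nu> (R \<inter> covered S (g' + 0)) \<le> emeasure ?\<nu> R"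
          using generation_sets[OF R] by (intro emeasure_mono) auto
        also have "\<dots> \<le> emeasure lebesgue R * A w z"
          using A_ge[OF j(2) cell_self, of w z] sets_cell by (simp add: nu j(1))
        finally show "emeasure ?\<nu> (R \<inter> covered S (g' + 0)) \<le> 1 * emeasure lebesgue R * A w z" by simp
      qed simp
      also have "\<dots> \<le> 2 * (emeasure lebesgue Q * A (A w) y)"
        using A_ge[OF k(2) cell_self, of "A w" y] unfolding k(1)[symmetric] by (simp add: mult_left_mono)
      finally have "ennreal (1 / l) * (of_nat l * ?N) \<le> ennreal (1 / l) * (2 * (emeasure lebesgue Q * A (A w) y))"
        by (intro mult_left_mono) auto
      moreover have "ennreal (1 / l) * of_nat l = 1"
        using l by (simp add: ennreal_of_nat_eq_real_of_nat ennreal_mult[symmetric])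
      ultimately have "?N \<le> (ennreal (1 / l) * 2) * (emeasure lebesgue Q * A (A w) y)"
        by (simp add: mult.assoc[symmetric])
      also have "ennreal (1 / l) * 2 = ennreal (2 / l)"
        by (simp add: numeral_mult_ennreal mult.commute[of _ 2])
      \<comment> \<open>Since 2/l <= 4/(1 + l) for l >= 1; this is the origin of the constant
        4.\<close>
      also have "\<dots> * (emeasure lebesgue Q * A (A w) y) \<le> ennreal (4 * (1 + real l) powr - 1) * (emeasure lebesgue Q * A (A w) y)"
        using l by (intro mult_right_mono ennreal_leI) (auto simp: powr_minus field_simps)
      finally show ?thesis by (simp add: mult_ac)
    qed
  qed (simp_all add: A_meas)
  moreover have "A (A w) x \<le> HL_maximal (HL_maximal w) x" for x
    using A_le[of "A w" x] HL_maximal_mono[of "A w" "HL_maximal w" x] A_le[of w] by (meson order_trans)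
  ultimately show "\<exists>v. (\<forall>x. v x \<le> HL_maximal (HL_maximal w) x) \<and> dominates 4 1 ?\<nu> v"
    by blast
qed

text \<open>
  On a set of relative measure \<open>2^(-l)\<close>, a function is split at the height \<open>2^(l/2)\<close> times its
  norm: the part below contributes \<open>2^(-l/2)\<close>, the part above gains
  \<open>(1 + (l/2) ln 2)^(-\<delta>)\<close>. The two terms of the constant compare these with \<open>(1 + l)^(-\<delta>)\<close>.
\<close>

definition LlogL_const :: "real \<Rightarrow> real" where
  "LlogL_const \<delta> = (let c = ln 2 / 2 in (\<delta> / c) powr \<delta> * exp c + c powr - \<delta>)"

lemma LlogL_const_pos: "0 < LlogL_const \<delta>"
  unfolding LlogL_const_def Let_def by (intro add_nonneg_pos mult_nonneg_nonneg) auto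

lemma LlogL_const_bound:
  fixes l :: nat
  assumes "0 < \<delta>"
  shows "2 powr - (real l / 2) + (1 + real l / 2 * ln 2) powr - \<delta> \<le> LlogL_const \<delta> * (1 + real l) powr - \<delta>"
proof -
  define c where "c = ln (2::real) / 2"
  have c: "0 < c" "c \<le> 1" unfolding c_def using ln_le_minus_one[of "2::real"] by auto
  \<comment> \<open>From 1 + z <= exp z at z = c (1 + l)/\<delta>. Raised to the power \<delta> it
    compares (1 + l)^\<delta> with exp (c l) = 2^(l/2).\<close>
  have "1 + real l \<le> \<delta> / c * exp (c / \<delta> * (1 + real l))"
    using exp_ge_add_one_self[of "c / \<delta> * (1 + real l)"] c assms by (simp add: field_simps)
  then have "(1 + real l) powr \<delta> \<le> (\<delta> / c * exp (c / \<delta> * (1 + real l))) powr \<delta>"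
    using assms by (intro powr_mono2) auto
  also have "\<dots> = (\<delta> / c) powr \<delta> * exp c * exp (c * l)"
  proof -
    have "c / \<delta> * (1 + real l) * \<delta> = c + c * l" using assms by (simp add: algebra_simps)
    moreover have "(\<delta> / c * exp z) powr \<delta> = (\<delta> / c) powr \<delta> * exp (z * \<delta>)" for z
      using c assms by (subst powr_mult) (simp_all add: exp_powr_real)
    ultimately show ?thesis by (simp only: exp_add mult.assoc)
  qed
  finally have "(1 + real l) powr \<delta> * exp (- (c * l)) \<le> (\<delta> / c) powr \<delta> * exp c"
    by (simp add: exp_minus field_simps)
  moreover have "2 powr - (real l / 2) = exp (- (c * l))" unfolding c_def by (simp add: powr_def)
  ultimately have "(1 + real l) powr \<delta> * 2 powr - (real l / 2) \<le> (\<delta> / c) powr \<delta> * exp c" by simp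
  then have 1: "2 powr - (real l / 2) \<le> (\<delta> / c) powr \<delta> * exp c * (1 + real l) powr - \<delta>"
    by (simp add: powr_minus[of "1 + real l" \<delta>] pos_le_divide_eq mult_ac flip: divide_inverse)
  have "(1 + real l / 2 * ln 2) powr - \<delta> \<le> (c * (1 + real l)) powr - \<delta>"
  proof (rule powr_mono2')
    show "0 < c * (1 + real l)" using c by simp
    show "c * (1 + real l) \<le> 1 + real l / 2 * ln 2" using c(2) by (simp add: c_def algebra_simps)
  qed (use assms in simp)
  also have "\<dots> = c powr - \<delta> * (1 + real l) powr - \<delta>" using c by (simp add: powr_mult)
  finally show ?thesis using 1 unfolding LlogL_const_def Let_def c_def[symmetric] by (simp add: algebra_simps)
qed

lemma LlogL_young_split:
  assumes "0 < \<delta>" "0 \<le> z"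
  shows "z \<le> 2 powr (real l / 2) + (1 + real l / 2 * ln 2) powr - \<delta> * LlogL_young \<delta> z"
proof (cases "z \<le> 2 powr (real l / 2)")
  case True
  moreover have "0 \<le> (1 + real l / 2 * ln 2) powr - \<delta> * LlogL_young \<delta> z"
    using assms unfolding LlogL_young_def by simp
  ultimately show ?thesis by linarith
next
  case False
  define b where "b = 1 + real l / 2 * ln 2"
  have b: "0 < b" unfolding b_def by (simp add: add_pos_nonneg)
  have z: "0 < z" using False by (smt (verit) powr_gt_zero)
  have "real l / 2 * ln 2 \<le> ln z"
    using False z ln_le_cancel_iff[of "2 powr (real l / 2)" z] by (simp add: ln_powr)
  then have "b powr \<delta> \<le> (1 + max 0 (ln z)) powr \<delta>"
    using b assms unfolding b_def by (intro powr_mono2) auto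
  then have "z * b powr \<delta> \<le> LlogL_young \<delta> z" unfolding LlogL_young_def using z by simp
  then have "z \<le> b powr - \<delta> * LlogL_young \<delta> z" using b by (simp add: powr_minus field_simps)
  moreover have "0 \<le> 2 powr (real l / 2)" by simp
  ultimately show ?thesis unfolding b_def by linarith
qed

lemma integral_small_set_le_luxemburg_norm:
  fixes w :: "real^'n \<Rightarrow> real"
  assumes w: "weight w" and "0 < \<delta>" and E: "E \<in> sets lebesgue" "E \<subseteq> Q" and Q: "Q \<in> sets lebesgue"
    "emeasure lebesgue Q \<noteq> 0" "emeasure lebesgue Q \<noteq> \<infinity>"
    and small: "2 ^ l * emeasure lebesgue E \<le> emeasure lebesgue Q"
  shows "(\<integral>\<^sup>+x\<in>E. ennreal (w x) \<partial>lebesgue) \<le>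
    ennreal (LlogL_const \<delta> * (1 + real l) powr - \<delta>) * emeasure lebesgue Q * luxemburg_norm (LlogL_young \<delta>) Q w"
proof -
  have wm: "w \<in> borel_measurable lebesgue" and w0: "0 \<le> w x" for x using w unfolding weight_def by auto
  let ?mQ = "emeasure lebesgue Q" and ?K = "LlogL_const \<delta> * (1 + real l) powr - \<delta>"
  define A where "A = (1 + real l / 2 * ln 2) powr - \<delta>"
  have K: "0 < ?K" using LlogL_const_pos by simp
  define N where "N = (\<integral>\<^sup>+x\<in>E. ennreal (w x) \<partial>lebesgue)"
  \<comment> \<open>For one admissible \<open>t\<close>: smallness of \<open>E\<close> turns 2^(l/2)
    |E| into at most 2^(-l/2) |Q|, and admissibility bounds the integral of the Young function over
    \<open>Q\<close> by |Q|.\<close>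
  have main: "N \<le> ennreal ?K * ?mQ * ennreal t"
    if t: "0 < t" and adm: "(\<integral>\<^sup>+y\<in>Q. ennreal (LlogL_young \<delta> (\<bar>w y\<bar> / t)) \<partial>lebesgue) / ?mQ \<le> 1" for t
  proof -
    let ?I = "\<integral>\<^sup>+y\<in>Q. ennreal (LlogL_young \<delta> (\<bar>w y\<bar> / t)) \<partial>lebesgue"
    have [measurable]: "(\<lambda>y. LlogL_young \<delta> (\<bar>w y\<bar> / t)) \<in> borel_measurable lebesgue"
      unfolding LlogL_young_def using wm by measurable
    have "?I = ?mQ * (?I / ?mQ)"
      using Q by (subst ennreal_times_divide, subst mult.commute) (simp add: ennreal_mult_divide_eq)
    also have "\<dots> \<le> ?mQ * 1" using adm by (intro mult_left_mono) auto
    finally have I: "?I \<le> ?mQ" by simp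
    have pw: "ennreal (w x) * indicator E x \<le> ennreal t *
        (ennreal (2 powr (real l / 2)) * indicator E x + ennreal A * (ennreal (LlogL_young \<delta> (\<bar>w x\<bar> / t)) * indicator Q x))" for x
    proof (cases "x \<in> E")
      case True
      have Y0: "0 \<le> LlogL_young \<delta> (\<bar>w x\<bar> / t)" unfolding LlogL_young_def using t by simp
      have "w x / t \<le> 2 powr (real l / 2) + A * LlogL_young \<delta> (\<bar>w x\<bar> / t)"
        using LlogL_young_split[OF \<open>0 < \<delta>\<close>, of "w x / t" l] w0[of x] t unfolding A_def by simp
      then have "w x \<le> t * (2 powr (real l / 2) + A * LlogL_young \<delta> (\<bar>w x\<bar> / t))"
        using t by (simp add: field_simps)
      then have "ennreal (w x) \<le> ennreal (t * (2 powr (real l / 2) + A * LlogL_young \<delta> (\<bar>w x\<bar> / t)))"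
        by (rule ennreal_leI)
      also have "\<dots> = ennreal t * (ennreal (2 powr (real l / 2)) + ennreal A * ennreal (LlogL_young \<delta> (\<bar>w x\<bar> / t)))"
        using t Y0 by (simp add: ennreal_mult' A_def)
      finally show ?thesis using True E by (auto simp: indicator_def)
    qed simp
    have "N \<le> (\<integral>\<^sup>+x. ennreal t * (ennreal (2 powr (real l / 2)) * indicator E x
        + ennreal A * (ennreal (LlogL_young \<delta> (\<bar>w x\<bar> / t)) * indicator Q x)) \<partial>lebesgue)"
      unfolding N_def by (intro nn_integral_mono pw)
    also have "\<dots> = ennreal t * (ennreal (2 powr (real l / 2)) * emeasure lebesgue E + ennreal A * ?I)"
      using E Q by (simp add: nn_integral_cmult nn_integral_add nn_integral_cmult_indicator)
    also have "\<dots> \<le> ennreal t * (ennreal (2 powr - (real l / 2)) * ?mQ + ennreal A * ?mQ)"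
    proof (intro mult_left_mono add_mono I)
      have "(2::real) powr (real l / 2) = 2 powr - (real l / 2) * 2 ^ l"
        by (simp add: powr_realpow[symmetric] powr_add[symmetric])
      then have "ennreal (2 powr (real l / 2)) * emeasure lebesgue E = ennreal (2 powr - (real l / 2)) * (2 ^ l * emeasure lebesgue E)"
        by (simp add: ennreal_mult' ennreal_power[symmetric] mult.assoc)
      then show "ennreal (2 powr (real l / 2)) * emeasure lebesgue E \<le> ennreal (2 powr - (real l / 2)) * ?mQ"
        using small by (simp add: mult_left_mono)
    qed auto
    also have "\<dots> = ennreal (2 powr - (real l / 2) + A) * ?mQ * ennreal t"
      by (simp add: A_def distrib_left mult_ac)
    also have "\<dots> \<le> ennreal ?K * ?mQ * ennreal t"
      using LlogL_const_bound[OF \<open>0 < \<delta>\<close>, of l] unfolding A_def by (intro mult_right_mono ennreal_leI) auto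
    finally show ?thesis .
  qed
  let ?D = "ennreal ?K * ?mQ"
  \<comment> \<open>Dividing by this finite nonzero factor gives a lower bound for every admissible
    \<open>t\<close>, hence for the infimum, including the case where none is admissible.\<close>
  have D: "?D \<noteq> 0" "?D \<noteq> \<infinity>" using K Q by (auto simp: ennreal_mult_eq_top_iff)
  have "N / ?D \<le> luxemburg_norm (LlogL_young \<delta>) Q w"
    unfolding luxemburg_norm_def
  proof (rule Inf_greatest)
    fix z assume "z \<in> {ennreal t |t. 0 < t \<and> (\<integral>\<^sup>+y\<in>Q. ennreal (LlogL_young \<delta> (\<bar>w y\<bar> / t)) \<partial>lebesgue) / ?mQ \<le> 1}"
    then obtain t where "z = ennreal t" "0 < t"
      "(\<integral>\<^sup>+y\<in>Q. ennreal (LlogL_young \<delta> (\<bar>w y\<bar> / t)) \<partial>lebesgue) / ?mQ \<le> 1" by auto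
    then have "N \<le> ?D * z" using main by simp
    then have "N / ?D \<le> z * ?D / ?D" by (intro divide_right_mono_ennreal) (simp add: mult.commute)
    then show "N / ?D \<le> z" using D by (simp add: ennreal_mult_divide_eq)
  qed
  then have "?D * (N / ?D) \<le> ?D * luxemburg_norm (LlogL_young \<delta>) Q w" by (intro mult_left_mono) auto
  moreover have "?D * (N / ?D) = N"
    using D by (subst ennreal_times_divide, subst mult.commute) (simp add: ennreal_mult_divide_eq)
  ultimately show ?thesis unfolding N_def by simp
qed

lemma grid_dominated_LlogL:
  fixes w :: "real^'n \<Rightarrow> real"
  assumes w: "weight w" and "0 < \<delta>"
  shows "grid_dominated (LlogL_const \<delta>) \<delta> (\<lambda>x. ennreal (w x)) (LlogL_maximal \<delta> w)"
  unfolding grid_dominated_def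
proof (intro allI impI)
  fix h :: real and s :: "real^'n" and L assume h: "0 < h"
  interpret nested_cells lebesgue "grid_cell h s" L by (rule nested_cells_grid[OF h])
  let ?c = "grid_cell h s" and ?q = "grid_cube h s"
  have wm: "w \<in> borel_measurable lebesgue" using w unfolding weight_def by auto
  define v where "v x = (SUP k\<in>{..L}. luxemburg_norm (LlogL_young \<delta>) (?q k x) w)" for x
  have v_le: "v x \<le> LlogL_maximal \<delta> w x" for x
    unfolding v_def LlogL_maximal_def using grid_cube_in_cubes[OF h] mem_grid_cube[OF h]
    by (intro SUP_mono) blast
  have v_meas: "v \<in> borel_measurable lebesgue"
  proof (rule borel_measurable_cellwise)
    fix x y assume y: "y \<in> ?c 0 x"
    have "?q k y = ?q k x" for k by (rule grid_cube_eq) (use y cell_mono[of 0 k x] in auto)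
    then show "v y = v x" unfolding v_def by simp
  qed
  let ?\<nu> = "density lebesgue (\<lambda>x. ennreal (w x))"
  \<comment> \<open>Only the relative measure of \<open>E\<close> matters. The whole cell with l = 0
    gives the first clause of \<open>dominates\<close>; covered sets, through
    \<open>sparse_decay\<close>, give the second.\<close>
  have bound: "emeasure ?\<nu> E \<le> ennreal (LlogL_const \<delta> * (1 + real l) powr - \<delta>) * emeasure lebesgue (?c k x) * v y"
    if k: "k \<le> L" "y \<in> ?c k x" and E: "E \<in> sets lebesgue" "E \<subseteq> ?c k x"
      "2 ^ l * emeasure lebesgue E \<le> emeasure lebesgue (?c k x)" for k x y E l
  proof -
    have m: "emeasure lebesgue (?q k x) = emeasure lebesgue (?c k x)"
      by (simp add: emeasure_grid_cell[OF h] emeasure_grid_cube[OF h])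
    have "emeasure ?\<nu> E = (\<integral>\<^sup>+x\<in>E. ennreal (w x) \<partial>lebesgue)"
      using wm E by (simp add: emeasure_density)
    also have "\<dots> \<le> ennreal (LlogL_const \<delta> * (1 + real l) powr - \<delta>) * emeasure lebesgue (?q k x)
        * luxemburg_norm (LlogL_young \<delta>) (?q k x) w"
    proof (rule integral_small_set_le_luxemburg_norm[OF w \<open>0 < \<delta>\<close> E(1)])
      show "E \<subseteq> ?q k x" using E(2) grid_cell_subset_cube[OF h] by (rule order_trans)
      show "?q k x \<in> sets lebesgue" by (simp add: grid_cube_def)
    qed (use emeasure_cell[of k x] E(3) in \<open>simp_all only: m not_False_eq_True\<close>)
    also have "\<dots> \<le> ennreal (LlogL_const \<delta> * (1 + real l) powr - \<delta>) * emeasure lebesgue (?q k x) * v y"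
      unfolding v_def using k grid_cube_eq[OF k(2)] by (intro mult_left_mono SUP_upper2[of k]) auto
    finally show ?thesis by (simp add: m)
  qed
  have "dominates (LlogL_const \<delta>) \<delta> ?\<nu> v"
    unfolding dominates_def
  proof (intro conjI allI impI ballI)
    fix k x y assume "k \<le> L" "y \<in> ?c k x"
    then show "emeasure ?\<nu> (?c k x) \<le> ennreal (LlogL_const \<delta>) * emeasure lebesgue (?c k x) * v y"
      using bound[of k y x "?c k x" 0] sets_cell by simp
  next
    fix S g Q l y
    assume S: "saturated S" "sparse S" and g: "1 \<le> g" and Q: "Q \<in> generation S g" and y: "y \<in> Q"
    obtain k where k: "Q = ?c k y" "k \<le> L" by (rule generationE[OF S(1) Q y])
    show "emeasure ?\<nu> (Q \<inter> covered S (g + l)) \<le> ennreal (LlogL_const \<delta> * (1 + real l) powr - \<delta>) * emeasure lebesgue Q * v y"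
      unfolding k(1)
      by (rule bound[OF k(2) cell_self])
        (use sets_cell sets_covered[OF S(1)] sparse_decay[OF S Q g, of l] k(1) in auto)
  qed (simp_all add: v_meas)
  then show "\<exists>v. (\<forall>x. v x \<le> LlogL_maximal \<delta> w x) \<and> dominates (LlogL_const \<delta>) \<delta> ?\<nu> v"
    using v_le by blast
qed

section \<open>The multilinear fractional integral\<close>

lemma integer_between_floors:
  fixes x y :: real
  assumes "\<lfloor>y\<rfloor> \<noteq> \<lfloor>x\<rfloor>"
  obtains z :: int where "\<bar>x - z\<bar> \<le> \<bar>y - x\<bar>"
proof (cases "x < y")
  case True
  then have "\<lfloor>x\<rfloor> < \<lfloor>y\<rfloor>" using assms floor_mono[of x y] by simp
  then have "x < \<lfloor>y\<rfloor>" by (simp add: floor_less_iff)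
  then show ?thesis using True by (intro that[of "\<lfloor>y\<rfloor>"]) linarith
next
  case False
  then have "y < \<lfloor>x\<rfloor>" using assms floor_mono[of y x] by (simp flip: floor_less_iff)
  then show ?thesis using False by (intro that[of "\<lfloor>x\<rfloor>"]) linarith
qed

text \<open>Two integer lattices shifted by \<open>2^j/3\<close> against each other have distance at least \<open>1/3\<close>.\<close>

lemma floor_constant_up_to_third_shift:
  fixes x r :: real
  assumes "6 * r < 1"
  shows "(\<forall>y. \<bar>y - x\<bar> \<le> r \<longrightarrow> \<lfloor>y\<rfloor> = \<lfloor>x\<rfloor>) \<or> (\<forall>y. \<bar>y - x\<bar> \<le> r \<longrightarrow> \<lfloor>y - 2 ^ j / 3\<rfloor> = \<lfloor>x - 2 ^ j / 3\<rfloor>)"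
proof (rule ccontr)
  assume "\<not> ?thesis"
  then obtain y y' where y: "\<bar>y - x\<bar> \<le> r" "\<lfloor>y\<rfloor> \<noteq> \<lfloor>x\<rfloor>"
    and y': "\<bar>y' - x\<bar> \<le> r" "\<lfloor>y' - 2 ^ j / 3\<rfloor> \<noteq> \<lfloor>x - 2 ^ j / 3\<rfloor>" by blast
  obtain z :: int where z: "\<bar>x - z\<bar> \<le> \<bar>y - x\<bar>" using integer_between_floors[OF y(2)] by blast
  obtain z' :: int where z': "\<bar>x - 2 ^ j / 3 - z'\<bar> \<le> \<bar>y' - 2 ^ j / 3 - (x - 2 ^ j / 3)\<bar>"
    using integer_between_floors[OF y'(2)] by blast
  define q :: real where "q = 2 ^ j / 3"
  have "\<bar>x - q - z'\<bar> \<le> r" using z' y'(1) unfolding q_def by simp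
  moreover have "\<bar>x - z\<bar> \<le> r" using z y(1) by (rule order_trans)
  ultimately have "\<bar>(x - q - z') - (x - z)\<bar> \<le> r + r" by (rule order_trans[OF abs_triangle_ineq4 add_mono])
  \<comment> \<open>Three times 2r is below 1 by assumption. After clearing the denominator an
    integer of absolute value below 1 remains, so 3 would divide a power of 2.\<close>
  then have "\<bar>3 * ((x - q - z') - (x - z))\<bar> < 1" using assms unfolding abs_mult by simp
  then have "\<bar>3 * (real_of_int z - z') - 2 ^ j\<bar> < 1" by (simp add: q_def algebra_simps)
  then have "\<bar>real_of_int (3 * (z - z') - 2 ^ j)\<bar> < 1" by simp
  then have "3 * (z - z') - 2 ^ j = 0" by linarith
  then have "(3::int) dvd 2 ^ j" by (metis dvd_triv_left eq_iff_diff_eq_0)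
  then have "(3::int) dvd 2" using prime_dvd_power[of "3::int" 2 j] by simp
  then show False by simp
qed

text \<open>One third of the coarsest side. In units of the side at level \<open>k\<close> this is
  2^(L-k)/3, at distance 1/3 from the integers, so a single shift is effective at every level and
  the grid stays nested. The subsets \<open>A\<close> give 2^n grids.\<close>

definition grid_shift :: "real \<Rightarrow> nat \<Rightarrow> 'n set \<Rightarrow> real^'n" where
  "grid_shift h L A = (\<chi> i. if i \<in> A then h * 2 ^ L / 3 else 0)"

lemma ball_in_shifted_cell:
  fixes x :: "real^'n"
  assumes h: "0 < h" and "k \<le> L" and R: "6 * R < grid_side h k"
  obtains A where "\<And>y. norm (x - y) \<le> R \<Longrightarrow> y \<in> grid_cell h (grid_shift h L A) k x"
proof -
  let ?d = "grid_side h k"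
  have d: "0 < ?d" by (rule grid_side_pos[OF h])
  have sh: "h * 2 ^ L / (3 * ?d) = 2 ^ (L - k) / 3"
    using h \<open>k \<le> L\<close> by (simp add: grid_side_def power_diff)
  \<comment> \<open>The coordinates in which the unshifted grid separates points near
    \<open>x\<close>; exactly these are shifted, so the grid depends on \<open>x\<close> and
    \<open>k\<close>.\<close>
  define A where "A = {i. \<not> (\<forall>y. \<bar>y - x $ i / ?d\<bar> \<le> R / ?d \<longrightarrow> \<lfloor>y\<rfloor> = \<lfloor>x $ i / ?d\<rfloor>)}"
  have "y \<in> grid_cell h (grid_shift h L A) k x" if y: "norm (x - y) \<le> R" for y
    unfolding grid_cell_def mem_Collect_eq
  proof
    fix i
    have "\<bar>y $ i - x $ i\<bar> \<le> norm (y - x)" using component_le_norm_cart[of "y - x" i] by simp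
    then have "\<bar>y $ i - x $ i\<bar> \<le> R" using y by (simp add: norm_minus_commute)
    then have "\<bar>(y $ i - x $ i) / ?d\<bar> \<le> R / ?d" using d by (simp add: divide_right_mono)
    then have close: "\<bar>y $ i / ?d - x $ i / ?d\<bar> \<le> R / ?d" by (simp add: diff_divide_distrib)
    show "\<lfloor>(y $ i - grid_shift h L A $ i) / ?d\<rfloor> = \<lfloor>(x $ i - grid_shift h L A $ i) / ?d\<rfloor>"
    proof (cases "i \<in> A")
      case True
      have "6 * (R / ?d) < 1" using R d by (simp add: field_simps)
      from floor_constant_up_to_third_shift[OF this, of "x $ i / ?d" "L - k"] True
      have "\<lfloor>y $ i / ?d - 2 ^ (L - k) / 3\<rfloor> = \<lfloor>x $ i / ?d - 2 ^ (L - k) / 3\<rfloor>"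
        using close unfolding A_def by blast
      then show ?thesis using True by (simp add: grid_shift_def diff_divide_distrib sh)
    next
      case False
      then have "\<lfloor>y $ i / ?d\<rfloor> = \<lfloor>x $ i / ?d\<rfloor>" using close unfolding A_def by blast
      then show ?thesis using False by (simp add: grid_shift_def)
    qed
  qed
  then show ?thesis by (rule that)
qed

section \<open>Domination of the multilinear kernel by the shifted grids\<close>

definition grid_weight :: "real \<Rightarrow> real \<Rightarrow> nat \<Rightarrow> ennreal" where
  "grid_weight d h k = ennreal (grid_side h k powr - d)"

definition grid_term ::
    "real \<Rightarrow> real \<Rightarrow> real^'n \<Rightarrow> ('m::finite \<Rightarrow> real^'n \<Rightarrow> ennreal) \<Rightarrow> nat \<Rightarrow> real^'n \<Rightarrow> ennreal" where
  "grid_term d h s f k x = (\<Prod>i\<in>UNIV. grid_weight d h k * (\<integral>\<^sup>+y\<in>grid_cell h s k x. f i y \<partial>lebesgue))"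

lemma scale_of_radius:
  assumes "0 < h" "h \<le> 12 * R" "6 * R < h * 2 ^ L"
  obtains k where "k \<le> L" "grid_side h k \<le> 12 * R" "6 * R < grid_side h k"
proof -
  define k where "k = (LEAST k. 6 * R < grid_side h k)"
  have L: "6 * R < grid_side h L" using assms by (simp add: grid_side_def)
  have k: "6 * R < grid_side h k" unfolding k_def by (rule LeastI[of "\<lambda>k. 6 * R < grid_side h k", OF L])
  have "k \<le> L" unfolding k_def by (rule Least_le[of "\<lambda>k. 6 * R < grid_side h k", OF L])
  moreover have "grid_side h k \<le> 12 * R"
  proof (cases k)
    case 0
    then show ?thesis using assms by (simp add: grid_side_def)
  next
    case (Suc i)
    then have "\<not> 6 * R < grid_side h i" using not_less_Least[of i "\<lambda>k. 6 * R < grid_side h k"] unfolding k_def by simp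
    then show ?thesis using Suc by (simp add: grid_side_def)
  qed
  ultimately show ?thesis using k that by blast
qed

text \<open>If R is the sum of the distances |x - y_i| and 6R < side <= 12R, one shifted cell around
  \<open>x\<close> contains all \<open>y_i\<close>, and the kernel is at most 12^(md) times a
  product of \<open>m\<close> factors side^(-d). Summing over all grids and levels removes the
  dependence of the choice on \<open>y\<close>.\<close>

lemma integral_kernel_annulus_le:
  fixes f :: "'m::finite \<Rightarrow> real^'n \<Rightarrow> complex" and x :: "real^'n"
  assumes f: "\<And>i. f i \<in> borel_measurable lebesgue" and h: "0 < h"
    and d: "0 < d" "real CARD('m) * d = real CARD('m) * real CARD('n) - \<alpha>"
  defines "R \<equiv> \<lambda>y::real^'n^'m. \<Sum>i\<in>UNIV. norm (x - y $ i)"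
  shows "(\<integral>\<^sup>+y\<in>{y. h \<le> 12 * R y \<and> 6 * R y < h * 2 ^ L}. ennreal (norm (frac_kernel_integrand \<alpha> f x y)) \<partial>lebesgue)
    \<le> ennreal (12 powr (real CARD('m) * d)) *
      (\<Sum>A\<in>UNIV. \<Sum>k\<le>L. grid_term d h (grid_shift h L A) (\<lambda>i y. ennreal (norm (f i y))) k x)"
proof -
  define m where "m = CARD('m)"
  let ?T = "{y. h \<le> 12 * R y \<and> 6 * R y < h * 2 ^ L}"
  let ?g = "\<lambda>A k i z. grid_weight d h k * (ennreal (norm (f i z)) * indicator (grid_cell h (grid_shift h L A) k x) z)"
  have fm: "(\<lambda>z. ennreal (norm (f i z)) * indicator (grid_cell h (grid_shift h L A) k x) z) \<in> borel_measurable lebesgue"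
    for A k i using f sets_grid_cell by measurable
  then have gm: "?g A k i \<in> borel_measurable lebesgue" for A k i by measurable
  define maj where "maj A k G \<longleftrightarrow> G \<in> borel_measurable lebesgue \<and> (\<forall>y::real^'n^'m. (\<Prod>i\<in>UNIV. ?g A k i (y $ i)) \<le> G y) \<and>
      (\<integral>\<^sup>+y. G y \<partial>lebesgue) = (\<Prod>i\<in>UNIV. \<integral>\<^sup>+z. ?g A k i z \<partial>lebesgue)" for A k G
  have "\<exists>G. maj A k G" for A k
    unfolding maj_def by (rule Fubini_prod_components_majorant[of "?g A k", OF gm]) blast
  then obtain G where "\<And>A k. maj A k (G A k)" by metis
  then have G: "\<And>A k. G A k \<in> borel_measurable lebesgue"
    "\<And>A k (y::real^'n^'m). (\<Prod>i\<in>UNIV. ?g A k i (y $ i)) \<le> G A k y"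
    "\<And>A k. (\<integral>\<^sup>+y. G A k y \<partial>lebesgue) = (\<Prod>i\<in>UNIV. \<integral>\<^sup>+z. ?g A k i z \<partial>lebesgue)"
    unfolding maj_def by blast+
  have int: "(\<integral>\<^sup>+y. G A k y \<partial>lebesgue) = grid_term d h (grid_shift h L A) (\<lambda>i y. ennreal (norm (f i y))) k x" for A k
    unfolding G grid_term_def by (intro prod.cong refl nn_integral_cmult fm)
  have pw: "ennreal (norm (frac_kernel_integrand \<alpha> f x y)) * indicator ?T y
      \<le> ennreal (12 powr (m * d)) * (\<Sum>A\<in>UNIV. \<Sum>k\<le>L. G A k y)" for y
  proof (cases "y \<in> ?T")
    case True
    then obtain k where k: "k \<le> L" "grid_side h k \<le> 12 * R y" "6 * R y < grid_side h k"
      using scale_of_radius[OF h, of "R y" L] by auto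
    obtain A where A: "\<And>z. norm (x - z) \<le> R y \<Longrightarrow> z \<in> grid_cell h (grid_shift h L A) k x"
      using ball_in_shifted_cell[OF h k(1,3), of x] by blast
    have cell: "y $ i \<in> grid_cell h (grid_shift h L A) k x" for i
      by (rule A) (unfold R_def, rule member_le_sum, auto)
    note side = grid_side_pos[OF h, of k]
    have R0: "0 < R y" using k side by simp
    have "R y powr - (m * d) \<le> (grid_side h k / 12) powr - (m * d)"
      using k(2) side d(1) unfolding m_def by (intro powr_mono2') auto
    also have "\<dots> = 12 powr (m * d) * (grid_side h k powr - d) ^ m"
      using side by (simp add: powr_divide powr_minus powr_realpow[symmetric] powr_powr field_simps)
    finally have ker: "R y powr - (m * d) \<le> 12 powr (m * d) * (grid_side h k powr - d) ^ m" .
    have "norm (frac_kernel_integrand \<alpha> f x y) = (\<Prod>i\<in>UNIV. norm (f i (y $ i))) * R y powr - (m * d)"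
    proof -
      have "(\<Sum>i\<in>UNIV. norm (x - y $ i)) = R y" by (simp add: R_def)
      then show ?thesis
        unfolding frac_kernel_integrand_def m_def d(2)[symmetric]
        by (simp only: norm_divide prod_norm norm_of_real powr_minus divide_inverse abs_of_nonneg powr_ge_zero norm_mult norm_inverse)
    qed
    also have "\<dots> \<le> (\<Prod>i\<in>UNIV. norm (f i (y $ i))) * (12 powr (m * d) * (grid_side h k powr - d) ^ m)"
      by (intro mult_left_mono ker prod_nonneg) simp
    also have "\<dots> = 12 powr (m * d) * (\<Prod>i\<in>(UNIV::'m set). grid_side h k powr - d * norm (f i (y $ i)))"
      by (simp add: prod.distrib m_def)
    finally have "ennreal (norm (frac_kernel_integrand \<alpha> f x y)) \<le>
      ennreal (12 powr (m * d) * (\<Prod>i\<in>(UNIV::'m set). grid_side h k powr - d * norm (f i (y $ i))))" by (rule ennreal_leI)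
    also have "\<dots> = ennreal (12 powr (m * d)) * (\<Prod>i\<in>UNIV. ?g A k i (y $ i))"
      using cell by (simp add: ennreal_mult' prod_ennreal[symmetric] grid_weight_def)
    also have "\<dots> \<le> ennreal (12 powr (m * d)) * (\<Sum>A\<in>UNIV. \<Sum>k\<le>L. G A k y)"
    proof (rule mult_left_mono)
      have "(\<Prod>i\<in>UNIV. ?g A k i (y $ i)) \<le> G A k y" by (rule G)
      also have "\<dots> \<le> (\<Sum>k\<le>L. G A k y)" using k(1) by (intro member_le_sum[of k _ "\<lambda>k. G A k y"]) auto
      also have "\<dots> \<le> (\<Sum>A\<in>UNIV. \<Sum>k\<le>L. G A k y)" by (intro member_le_sum[of A _ "\<lambda>A. \<Sum>k\<le>L. G A k y"]) auto
      finally show "(\<Prod>i\<in>UNIV. ?g A k i (y $ i)) \<le> (\<Sum>A\<in>UNIV. \<Sum>k\<le>L. G A k y)" .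
    qed simp
    finally show ?thesis using True by simp
  qed simp
  have "(\<integral>\<^sup>+y\<in>?T. ennreal (norm (frac_kernel_integrand \<alpha> f x y)) \<partial>lebesgue)
    \<le> (\<integral>\<^sup>+y. ennreal (12 powr (m * d)) * (\<Sum>A\<in>UNIV. \<Sum>k\<le>L. G A k y) \<partial>lebesgue)"
    by (intro nn_integral_mono pw)
  also have "\<dots> = ennreal (12 powr (m * d)) * (\<Sum>A\<in>UNIV. \<Sum>k\<le>L. \<integral>\<^sup>+y. G A k y \<partial>lebesgue)"
    using G(1) by (simp add: nn_integral_cmult nn_integral_sum)
  finally show ?thesis unfolding int m_def .
qed

text \<open>The factor side^(-d) equals |Q|^(-(1 - \<beta>/n)), the normalisation in
  \<open>frac_maximal\<close>; replacing the cell by the closed cube and \<open>v\<close> by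
  \<open>V\<close> only enlarges the integral.\<close>

lemma dyadic_le_frac_maximal:
  fixes v V :: "real^'n \<Rightarrow> ennreal"
  assumes h: "0 < h" and d: "d = real CARD('n) - \<beta>" and v: "\<And>y. v y \<le> V y"
  shows "(SUP k\<in>{..L}. grid_weight d h k * (\<integral>\<^sup>+y\<in>grid_cell h s k x. v y \<partial>lebesgue)) \<le> frac_maximal \<beta> V x"
proof (rule SUP_least)
  fix k
  let ?q = "grid_cube h s k x"
  note side = grid_side_pos[OF h, of k]
  have "measure lebesgue ?q = grid_side h k ^ CARD('n)"
    using emeasure_grid_cube[OF h, of s k x] side by (simp add: measure_def)
  then have "measure lebesgue ?q powr (1 - \<beta> / real CARD('n)) = grid_side h k powr d"
    using side by (simp add: powr_realpow[symmetric] powr_powr d right_diff_distrib)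
  then have eq: "x / ennreal (measure lebesgue ?q powr (1 - \<beta> / real CARD('n))) = grid_weight d h k * x" for x
    using side by (simp add: grid_weight_def powr_minus divide_ennreal_def inverse_ennreal mult.commute)
  have "grid_weight d h k * (\<integral>\<^sup>+y\<in>grid_cell h s k x. v y \<partial>lebesgue) \<le> grid_weight d h k * (\<integral>\<^sup>+y\<in>?q. V y \<partial>lebesgue)"
    using grid_cell_subset_cube[OF h] v
    by (intro mult_left_mono nn_integral_mono) (auto split: split_indicator)
  also have "\<dots> = (\<integral>\<^sup>+y\<in>?q. V y \<partial>lebesgue) / ennreal (measure lebesgue ?q powr (1 - \<beta> / real CARD('n)))"
    by (simp only: eq)
  also have "\<dots> \<le> frac_maximal \<beta> V x"
    unfolding frac_maximal_def using grid_cube_in_cubes[OF h] mem_grid_cube[OF h] by (intro SUP_upper) auto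
  finally show "grid_weight d h k * (\<integral>\<^sup>+y\<in>grid_cell h s k x. v y \<partial>lebesgue) \<le> frac_maximal \<beta> V x" .
qed

text \<open>The product of grid weight and cell measure is side^\<beta>, which gains 2^(s \<beta>)
  >= N over \<open>s\<close> levels. With N = 4m this is the hypothesis behind sparsity.\<close>

lemma grid_weight_scale:
  fixes x y :: "real^'n"
  assumes h: "0 < h" and "0 < \<beta>" and d: "d = real CARD('n) - \<beta>" and s: "log 2 (real N) / \<beta> \<le> real s"
    and N: "0 < N" and "j + s \<le> k"
  shows "of_nat N * (grid_weight d h j * emeasure lebesgue (grid_cell h s' j y))
    \<le> grid_weight d h k * emeasure lebesgue (grid_cell h s' k x)"
proof -
  have side: "0 < grid_side h k" for k by (rule grid_side_pos[OF h])
  have eq: "grid_weight d h k * emeasure lebesgue (grid_cell h s' k z) = ennreal (grid_side h k powr \<beta>)" for k z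
    unfolding grid_weight_def emeasure_grid_cell[OF h]
    using side[of k] by (simp add: ennreal_mult[symmetric] powr_realpow[symmetric] powr_add[symmetric] d)
  have "log 2 (real N) \<le> real s * \<beta>" using s \<open>0 < \<beta>\<close> by (simp add: pos_divide_le_eq)
  then have "real N \<le> 2 powr (real s * \<beta>)" using N by (simp add: log_le_iff)
  then have "real N * grid_side h j powr \<beta> \<le> 2 powr (real s * \<beta>) * grid_side h j powr \<beta>" by (simp add: mult_right_mono)
  also have "\<dots> = (2 ^ s * grid_side h j) powr \<beta>"
    using side[of j] by (simp add: powr_mult powr_realpow[symmetric] powr_powr)
  also have "\<dots> \<le> grid_side h k powr \<beta>"
  proof (rule powr_mono2)
    have "2 ^ s * grid_side h j = h * 2 ^ (j + s)" by (simp add: grid_side_def power_add)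
    also have "\<dots> \<le> h * 2 ^ k" using h \<open>j + s \<le> k\<close> by (intro mult_left_mono power_increasing) auto
    finally show "2 ^ s * grid_side h j \<le> grid_side h k" by (simp add: grid_side_def)
  qed (use side[of j] \<open>0 < \<beta>\<close> in auto)
  finally have "ennreal (real N * grid_side h j powr \<beta>) \<le> ennreal (grid_side h k powr \<beta>)" by (rule ennreal_leI)
  then show ?thesis unfolding eq by (simp add: ennreal_mult' ennreal_of_nat_eq_real_of_nat)
qed

text \<open>If the sum over T = 2^n grids exceeds \<open>b\<close>, one of them exceeds b/T. The
  lower height costs a factor T, and the union of T level sets costs T^m after taking the m-th
  power.\<close>

lemma shifted_grids_weak_type:
  fixes w V f :: "'m::finite \<Rightarrow> real^'n \<Rightarrow> ennreal"
  defines "m \<equiv> CARD('m)"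
  assumes "0 < \<delta>" "0 < C" and \<beta>: "0 < \<beta>" "d = real CARD('n) - \<beta>"
    and s: "0 < s" "log 2 (real (4 * m)) / \<beta> \<le> real s" and h: "0 < h" and b: "0 < b"
    and meas: "u \<in> borel_measurable lebesgue" "\<And>i. w i \<in> borel_measurable lebesgue" "\<And>i. f i \<in> borel_measurable lebesgue"
    and uw: "\<And>x. u x ^ m \<le> (\<Prod>i\<in>UNIV. w i x)"
    and dom: "\<And>i. grid_dominated C \<delta> (w i) (V i)"
    and E: "E = {x. ennreal b < (\<Sum>A\<in>(UNIV::'n set set). \<Sum>k\<le>L. grid_term d h (grid_shift h L A) f k x)}"
  shows "E \<in> sets lebesgue"
    and "ennreal b * (\<integral>\<^sup>+x\<in>E. u x \<partial>lebesgue) ^ m \<le>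
      ennreal (2 ^ CARD('n) * (2 ^ CARD('n) * grid_const \<delta> C s) ^ m) *
        (\<Prod>i\<in>UNIV. \<integral>\<^sup>+x. f i x * frac_maximal \<beta> (V i) x \<partial>lebesgue)"
proof -
  define T where "T = (2::nat) ^ CARD('n)"
  have T: "0 < T" "card (UNIV :: 'n set set) = T" unfolding T_def by (simp_all add: card_UNIV_set)
  define D where "D A x = (\<Sum>k\<le>L. grid_term d h (grid_shift h L A) f k x)" for A x
  define EA where "EA A = {x. ennreal (b / T) < D A x}" for A
  have K: "0 < grid_const \<delta> C s" using \<open>0 < \<delta>\<close> \<open>0 < C\<close> by (rule grid_const_pos)
  define P where "P = (\<Prod>i\<in>UNIV. \<integral>\<^sup>+x. f i x * frac_maximal \<beta> (V i) x \<partial>lebesgue)"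
  have bT: "0 < b / T" using b T by simp
  have A: "EA A \<in> sets lebesgue"
    "ennreal (b / T) * (\<integral>\<^sup>+x\<in>EA A. u x \<partial>lebesgue) ^ m \<le> ennreal (grid_const \<delta> C s ^ m) * P" for A
  proof -
    let ?s = "grid_shift h L A"
    interpret nested_cells lebesgue "grid_cell h ?s" L by (rule nested_cells_grid[OF h])
    have "\<exists>v. (\<forall>x. v x \<le> V i x) \<and> dominates C \<delta> (density lebesgue (w i)) v" for i
      using dom[of i] h unfolding grid_dominated_def by blast
    then obtain v where v: "\<And>i x. v i x \<le> V i x" "\<And>i. dominates C \<delta> (density lebesgue (w i)) (v i)" by metis
    have scale: "of_nat (4 * CARD('m)) * (grid_weight d h j * emeasure lebesgue (grid_cell h ?s j y))
        \<le> grid_weight d h k * emeasure lebesgue (grid_cell h ?s k x)" if "j + s \<le> k" for j k and x y :: "real^'n"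
      using s(2) that unfolding m_def by (intro grid_weight_scale[OF h \<beta>]) auto
    note * = grid_operator_weak_type[OF \<open>0 < \<delta>\<close> \<open>0 < C\<close> \<open>0 < s\<close> bT meas uw[unfolded m_def] v(2) scale]
    show "EA A \<in> sets lebesgue" using *(1) unfolding EA_def D_def grid_term_def .
    have "ennreal (b / T) * (\<integral>\<^sup>+x\<in>EA A. u x \<partial>lebesgue) ^ m \<le> ennreal (grid_const \<delta> C s ^ m) *
        (\<Prod>i\<in>UNIV. \<integral>\<^sup>+x. f i x * (SUP k\<in>{..L}. grid_weight d h k * (\<integral>\<^sup>+y\<in>grid_cell h ?s k x. v i y \<partial>lebesgue)) \<partial>lebesgue)"
      using *(2) unfolding EA_def D_def grid_term_def m_def .
    also have "\<dots> \<le> ennreal (grid_const \<delta> C s ^ m) * P"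
      unfolding P_def using v(1)
      by (intro mult_left_mono prod_mono_ennreal nn_integral_mono dyadic_le_frac_maximal[OF h \<beta>(2)]) auto
    finally show "ennreal (b / T) * (\<integral>\<^sup>+x\<in>EA A. u x \<partial>lebesgue) ^ m \<le> ennreal (grid_const \<delta> C s ^ m) * P" .
  qed
  have "D A \<in> borel_measurable lebesgue" for A
  proof -
    interpret nested_cells lebesgue "grid_cell h (grid_shift h L A)" L by (rule nested_cells_grid[OF h])
    show ?thesis by (rule borel_measurable_cellwise) (simp add: D_def grid_term_def cell_eq_above[OF _ le0])
  qed
  then have "(\<lambda>x. \<Sum>A\<in>(UNIV::'n set set). D A x) \<in> borel_measurable lebesgue" by measurable
  then have "{x \<in> space lebesgue. ennreal b < (\<Sum>A\<in>(UNIV::'n set set). D A x)} \<in> sets lebesgue" by measurable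
  then show Es: "E \<in> sets lebesgue" unfolding E D_def[symmetric] by simp
  have cover: "E \<subseteq> (\<Union>A. EA A)"
  proof (rule subsetI, rule ccontr)
    fix x assume x: "x \<in> E" "x \<notin> (\<Union>A. EA A)"
    then have "(\<Sum>A\<in>(UNIV::'n set set). D A x) \<le> (\<Sum>A\<in>(UNIV::'n set set). ennreal (b / T))"
      by (intro sum_mono) (auto simp: EA_def not_less)
    also have "\<dots> = ennreal b" using T b by (simp add: ennreal_of_nat_eq_real_of_nat ennreal_mult[symmetric])
    finally show False using x(1) unfolding E D_def[symmetric] by simp
  qed
  define U where "U B = (\<integral>\<^sup>+x\<in>B. u x \<partial>lebesgue)" for B
  have Ue: "U B = emeasure (density lebesgue u) B" if "B \<in> sets lebesgue" for B
    unfolding U_def using meas that by (simp add: emeasure_density)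
  \<comment> \<open>Comparing all grids with the one of largest measure bounds the union by T equal
    terms.\<close>
  obtain A0 where A0: "\<And>A. U (EA A) \<le> U (EA A0)"
  proof -
    have "finite (range (\<lambda>A. U (EA A)))" "range (\<lambda>A. U (EA A)) \<noteq> {}" by auto
    then have "Max (range (\<lambda>A. U (EA A))) \<in> range (\<lambda>A. U (EA A))" by (rule Max_in)
    then obtain A0 where "Max (range (\<lambda>A. U (EA A))) = U (EA A0)" by (rule imageE)
    then show ?thesis using that Max_ge[OF \<open>finite (range (\<lambda>A. U (EA A)))\<close>] by (metis rangeI)
  qed
  have "U E \<le> emeasure (density lebesgue u) (\<Union>A. EA A)"
    using cover Es A(1) by (simp add: Ue emeasure_mono)
  also have "\<dots> \<le> (\<Sum>A\<in>UNIV. emeasure (density lebesgue u) (EA A))"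
    using A(1) by (intro emeasure_subadditive_finite) auto
  also have "\<dots> \<le> (\<Sum>A\<in>(UNIV::'n set set). U (EA A0))" using A0 A(1) by (intro sum_mono) (simp add: Ue)
  also have "\<dots> = of_nat T * U (EA A0)" using T by simp
  finally have "ennreal b * U E ^ m \<le> ennreal b * (of_nat T * U (EA A0)) ^ m"
    by (intro mult_left_mono power_mono_ennreal) auto
  also have "\<dots> = of_nat T * of_nat T ^ m * (ennreal (b / T) * U (EA A0) ^ m)"
  proof -
    have "ennreal b = of_nat T * ennreal (b / T)"
      using T b by (simp add: ennreal_of_nat_eq_real_of_nat ennreal_mult[symmetric])
    then show ?thesis by (simp add: power_mult_distrib mult_ac)
  qed
  also have "\<dots> \<le> of_nat T * of_nat T ^ m * (ennreal (grid_const \<delta> C s ^ m) * P)"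
    using A(2) unfolding U_def by (intro mult_left_mono) auto
  also have "\<dots> = ennreal (2 ^ CARD('n) * (2 ^ CARD('n) * grid_const \<delta> C s) ^ m) * P"
    using K by (simp add: T_def ennreal_mult power_mult_distrib ennreal_power[symmetric] mult_ac)
  finally show "ennreal b * (\<integral>\<^sup>+x\<in>E. u x \<partial>lebesgue) ^ m \<le>
      ennreal (2 ^ CARD('n) * (2 ^ CARD('n) * grid_const \<delta> C s) ^ m) *
        (\<Prod>i\<in>UNIV. \<integral>\<^sup>+x. f i x * frac_maximal \<beta> (V i) x \<partial>lebesgue)"
    unfolding U_def P_def .
qed

section \<open>Removal of the truncation and the weak type estimate\<close>

lemma ennreal_powr_of_nat: "0 < m \<Longrightarrow> ennreal_powr a (real m) = a ^ m"
  by (cases a) (auto simp: ennreal_powr_def powr_realpow' ennreal_power)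

lemma norm_multilinear_frac_integral_annulus:
  fixes f :: "'m::finite \<Rightarrow> real^'n \<Rightarrow> complex" and x :: "real^'n"
  defines "R \<equiv> \<lambda>y::real^'n^'m. \<Sum>i\<in>UNIV. norm (x - y $ i)"
  assumes "0 \<le> t" "t < norm (multilinear_frac_integral \<alpha> f x)"
  obtains K0 where "\<And>K. K0 \<le> K \<Longrightarrow> ennreal t <
    (\<integral>\<^sup>+y\<in>{y. (1/2) ^ K \<le> 12 * R y \<and> 6 * R y < (1/2) ^ K * 2 ^ (2 * K)}.
      ennreal (norm (frac_kernel_integrand \<alpha> f x y)) \<partial>lebesgue)"
proof -
  let ?F = "frac_kernel_integrand \<alpha> f x"
  define T where "T K = {y. (1/2) ^ K \<le> 12 * R y \<and> 6 * R y < (1/2) ^ K * 2 ^ (2 * K)}" for K :: nat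
  have T: "T K = {y. (1/2) ^ K \<le> 12 * R y \<and> 6 * R y < 2 ^ K}" for K
  proof -
    have "(1/2::real) ^ K * 2 ^ (2 * K) = 2 ^ K" by (simp add: mult_2 power_add power_one_over)
    then show ?thesis unfolding T_def by simp
  qed
  \<comment> \<open>A non-integrable kernel would give the Bochner integral its default value 0,
    contradicting a norm above t >= 0.\<close>
  have int: "integrable lebesgue ?F"
  proof (rule ccontr)
    assume "\<not> integrable lebesgue ?F"
    then have "multilinear_frac_integral \<alpha> f x = 0"
      unfolding multilinear_frac_integral_def by (rule not_integrable_integral_eq)
    then show False using assms by simp
  qed
  have Tm: "T K \<in> sets lebesgue" for K
  proof -
    have [measurable]: "(\<lambda>y::real^'n^'m. y $ i) \<in> borel_measurable borel" for i
      by (intro borel_measurable_continuous_onI continuous_intros)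
    have [measurable]: "R \<in> borel_measurable borel" unfolding R_def by measurable
    have "T K \<in> sets borel" unfolding T by measurable
    then show ?thesis by simp
  qed
  have mono: "T K \<subseteq> T K'" if "K \<le> K'" for K K'
  proof -
    have "(1/2::real) ^ K' \<le> (1/2) ^ K" "(2::real) ^ K \<le> 2 ^ K'"
      using that by (auto intro: power_decreasing power_increasing)
    then show ?thesis unfolding T by (intro subsetI, unfold mem_Collect_eq) linarith
  qed
  let ?g = "\<lambda>K y. ennreal (norm (?F y)) * indicator (T K) y"
  have "ennreal t < ennreal (norm (multilinear_frac_integral \<alpha> f x))"
    using assms by (simp add: ennreal_less_iff)
  also have "\<dots> \<le> (\<integral>\<^sup>+y. ennreal (norm (?F y)) \<partial>lebesgue)"
    unfolding multilinear_frac_integral_def by (rule integral_norm_bound_ennreal[OF int])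
  also have "\<dots> \<le> (\<integral>\<^sup>+y. (SUP K. ?g K y) \<partial>lebesgue)"
  proof (rule nn_integral_mono)
    fix y
    show "ennreal (norm (?F y)) \<le> (SUP K. ?g K y)"
    proof (cases "R y = 0")
      case True
      \<comment> \<open>The kernel has its singularity here, but \<open>0 powr z\<close> is 0 and
        division by 0 gives 0, so the point contributes nothing.\<close>
      then have "?F y = 0" unfolding frac_kernel_integrand_def R_def by simp
      then show ?thesis by simp
    next
      case False
      have "0 \<le> R y" unfolding R_def by (intro sum_nonneg) simp
      with False have R: "0 < R y" by simp
      obtain K1 where K1: "(1/2) ^ K1 < 12 * R y" using real_arch_pow_inv[of "12 * R y" "1/2"] R by auto
      obtain K2 where K2: "6 * R y < 2 ^ K2" using real_arch_pow[of 2 "6 * R y"] by auto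
      define K where "K = max K1 K2"
      have "(1/2::real) ^ K \<le> (1/2) ^ K1" "(2::real) ^ K2 \<le> 2 ^ K"
        unfolding K_def by (auto intro: power_decreasing power_increasing)
      then have "y \<in> T K" unfolding T mem_Collect_eq using K1 K2 by linarith
      then show ?thesis by (intro SUP_upper2[of K]) auto
    qed
  qed
  also have "\<dots> = (SUP K. \<integral>\<^sup>+y. ?g K y \<partial>lebesgue)"
  proof (rule nn_integral_monotone_convergence_SUP)
    show "incseq ?g"
      using mono by (intro monoI le_funI mult_left_mono) (auto split: split_indicator)
    fix K
    have "?F \<in> borel_measurable lebesgue" using int by (rule borel_measurable_integrable)
    then show "?g K \<in> borel_measurable lebesgue" using Tm[of K] by measurable
  qed
  finally obtain K0 where K0: "ennreal t < (\<integral>\<^sup>+y. ?g K0 y \<partial>lebesgue)" by (auto simp: less_SUP_iff)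
  have "ennreal t < (\<integral>\<^sup>+y. ?g K y \<partial>lebesgue)" if "K0 \<le> K" for K
  proof -
    have "(\<integral>\<^sup>+y. ?g K0 y \<partial>lebesgue) \<le> (\<integral>\<^sup>+y. ?g K y \<partial>lebesgue)"
      using mono[OF that] by (intro nn_integral_mono mult_left_mono) (auto split: split_indicator)
    with K0 show ?thesis by (rule less_le_trans)
  qed
  then show ?thesis using that unfolding T_def by blast
qed

lemma weak_type_of_grid_dominated:
  fixes \<alpha> \<delta> C :: real
  assumes \<alpha>: "0 < \<alpha>" "\<alpha> < real CARD('n::finite) * real CARD('m::finite)" and "0 < \<delta>" "0 < C"
  shows "\<exists>K>0. \<forall>(w :: 'm \<Rightarrow> real^'n \<Rightarrow> real) u f V.
    (\<forall>i. weight (w i)) \<longrightarrow> u = (\<lambda>x. \<Prod>i\<in>UNIV. w i x powr (1 / real CARD('m))) \<longrightarrow>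
    (\<forall>i. f i \<in> borel_measurable lebesgue) \<longrightarrow>
    (\<forall>i. grid_dominated C \<delta> (\<lambda>x. ennreal (w i x)) (V i)) \<longrightarrow>
    weak_Lnorm (1 / real CARD('m)) u (multilinear_frac_integral \<alpha> f)
      \<le> ennreal K * (\<Prod>i\<in>UNIV. \<integral>\<^sup>+ x. ennreal (norm (f i x)) * frac_maximal (\<alpha> / real CARD('m)) (V i) x \<partial>lebesgue)"
proof -
  define m where "m = CARD('m)"
  define \<beta> where "\<beta> = \<alpha> / real m"
  define d where "d = real CARD('n) - \<beta>"
  have m: "0 < m" unfolding m_def by simp
  have \<beta>: "0 < \<beta>" and d: "0 < d" "real m * d = real m * real CARD('n) - \<alpha>"
    using \<alpha> m unfolding \<beta>_def d_def m_def by (auto simp: field_simps)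
  \<comment> \<open>Large enough for 2^(s \<beta>) >= 4m.\<close>
  define s where "s = nat \<lceil>log 2 (real (4 * m)) / \<beta>\<rceil> + 1"
  have s: "0 < s" "log 2 (real (4 * m)) / \<beta> \<le> real s" unfolding s_def by linarith+
  define c where "c = 12 powr (real m * d)"
  have c: "0 < c" unfolding c_def by simp
  define K1 where "K1 = 2 ^ CARD('n) * (2 ^ CARD('n) * grid_const \<delta> C s) ^ m"
  have K1: "0 < K1" unfolding K1_def using grid_const_pos[OF \<open>0 < \<delta>\<close> \<open>0 < C\<close>] by simp
  show ?thesis
  proof (intro exI conjI allI impI)
    show "0 < c * K1" using c K1 by simp
    fix w :: "'m \<Rightarrow> real^'n \<Rightarrow> real" and u and f :: "'m \<Rightarrow> real^'n \<Rightarrow> complex" and V :: "'m \<Rightarrow> real^'n \<Rightarrow> ennreal"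
    assume w: "\<forall>i. weight (w i)" and u: "u = (\<lambda>x. \<Prod>i\<in>UNIV. w i x powr (1 / real CARD('m)))"
      and f: "\<forall>i. f i \<in> borel_measurable lebesgue"
      and dom: "\<forall>i. grid_dominated C \<delta> (\<lambda>x. ennreal (w i x)) (V i)"
    define P where "P = (\<Prod>i\<in>UNIV. \<integral>\<^sup>+ x. ennreal (norm (f i x)) * frac_maximal \<beta> (V i) x \<partial>lebesgue)"
    have wm: "w i \<in> borel_measurable lebesgue" and w0: "0 \<le> w i x" for i x using w unfolding weight_def by auto
    have um: "(\<lambda>x. ennreal (u x)) \<in> borel_measurable lebesgue" unfolding u using wm by measurable
    have uw: "ennreal (u x) ^ m \<le> (\<Prod>i\<in>UNIV. ennreal (w i x))" for x
    proof -
      have "(w i x powr (1 / real m)) ^ m = w i x" for i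
        using w0[of i x] m by (cases "w i x = 0") (auto simp: powr_realpow[symmetric] powr_powr)
      then have "u x ^ m = (\<Prod>i\<in>UNIV. w i x)" unfolding u m_def[symmetric] by (simp add: prod_power_distrib)
      moreover have "0 \<le> u x" unfolding u by (intro prod_nonneg) simp
      ultimately show ?thesis using w0 by (simp add: ennreal_power prod_ennreal)
    qed
    have level: "ennreal t * weighted_measure u {x. norm (multilinear_frac_integral \<alpha> f x) > t} ^ m \<le> ennreal (c * K1) * P"
      if t: "0 < t" for t
    proof (cases "P = \<infinity>")
      case True
      then show ?thesis using c K1 by (simp add: ennreal_mult_top)
    next
      case False
      then obtain p where p: "P = ennreal p" "0 \<le> p" by (cases P) auto
      define b where "b = t / c"
      have b: "0 < b" "ennreal c * ennreal b = ennreal t" unfolding b_def using t c by (simp_all add: ennreal_mult[symmetric])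
      \<comment> \<open>Mesh 2^(-K) with levels up to 2K, so that the sides run from 2^(-K) to 2^K
        and the annuli exhaust all positive radii.\<close>
      define G where "G K = {x. ennreal b < (\<Sum>A\<in>(UNIV::'n set set). \<Sum>k\<le>2 * K.
        grid_term d ((1/2) ^ K) (grid_shift ((1/2) ^ K) (2 * K) A) (\<lambda>i y. ennreal (norm (f i y))) k x)}" for K :: nat
      have fm: "(\<lambda>y. ennreal (norm (f i y))) \<in> borel_measurable lebesgue" for i
        using spec[OF f, of i] by measurable
      note grids = shifted_grids_weak_type[OF \<open>0 < \<delta>\<close> \<open>0 < C\<close> \<beta> d_def s[unfolded m_def] _ b(1) um
        measurable_compose[OF wm measurable_ennreal] fm uw[unfolded m_def] spec[OF dom] G_def]
      have Gs: "G K \<in> sets lebesgue" for K by (rule grids(1)) simp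
      have Gle: "ennreal b * (\<integral>\<^sup>+x\<in>G K. ennreal (u x) \<partial>lebesgue) ^ m \<le> ennreal K1 * P" for K
        unfolding m_def K1_def P_def by (rule grids(2)) simp
      \<comment> \<open>Mesh and shift both change with \<open>K\<close>, so the sets
        \<open>G K\<close> need not increase. Points of the level set lie in all \<open>G K\<close>
        from some index on; these lower limits do increase and inherit the bound.\<close>
      define H where "H K = (\<Inter>K'\<in>{K..}. G K')" for K
      have Hs: "H K \<in> sets lebesgue" for K unfolding H_def using Gs by auto
      define \<mu> where "\<mu> = density lebesgue (\<lambda>x. ennreal (u x))"
      have mu: "emeasure \<mu> B = (\<integral>\<^sup>+x\<in>B. ennreal (u x) \<partial>lebesgue)" if "B \<in> sets lebesgue" for B
        unfolding \<mu>_def using um that by (rule emeasure_density)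
      define q where "q = root m (K1 * p / b)"
      have q: "0 \<le> q" unfolding q_def using K1 p b m by simp
      have "emeasure \<mu> (H K) \<le> ennreal q" for K
      proof -
        have "emeasure \<mu> (H K) \<le> emeasure \<mu> (G K)" using Gs by (intro emeasure_mono) (auto simp: H_def \<mu>_def)
        also have "\<dots> \<le> ennreal (1 * root m (K1 * p / b))"
          using Gle[of K] p K1 b m by (intro le_of_power_le_ennreal) (auto simp: mu[OF Gs] ennreal_mult)
        finally show ?thesis unfolding q_def by simp
      qed
      moreover have "incseq H" unfolding H_def by (intro monoI) auto
      then have "emeasure \<mu> (\<Union>K. H K) = (SUP K. emeasure \<mu> (H K))"
        using Hs by (intro SUP_emeasure_incseq[symmetric]) (auto simp: \<mu>_def)
      ultimately have lim: "emeasure \<mu> (\<Union>K. H K) \<le> ennreal q" by (simp add: SUP_le_iff)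
      have "{x. norm (multilinear_frac_integral \<alpha> f x) > t} \<subseteq> (\<Union>K. H K)"
      proof
        fix x assume "x \<in> {x. norm (multilinear_frac_integral \<alpha> f x) > t}"
        then have "t < norm (multilinear_frac_integral \<alpha> f x)" by simp
        then obtain K0 where K0: "\<And>K. K0 \<le> K \<Longrightarrow> ennreal t <
          (\<integral>\<^sup>+y\<in>{y. (1/2) ^ K \<le> 12 * (\<Sum>i\<in>UNIV. norm (x - y $ i)) \<and>
              6 * (\<Sum>i\<in>UNIV. norm (x - y $ i)) < (1/2) ^ K * 2 ^ (2 * K)}.
            ennreal (norm (frac_kernel_integrand \<alpha> f x y)) \<partial>lebesgue)"
          using norm_multilinear_frac_integral_annulus[of t \<alpha> f x] t by auto
        have "x \<in> G K" if "K0 \<le> K" for K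
        proof (rule ccontr)
          assume "x \<notin> G K"
          then have le: "ennreal c * (\<Sum>A\<in>(UNIV::'n set set). \<Sum>k\<le>2 * K. grid_term d ((1/2) ^ K)
              (grid_shift ((1/2) ^ K) (2 * K) A) (\<lambda>i y. ennreal (norm (f i y))) k x) \<le> ennreal c * ennreal b"
            unfolding G_def by (intro mult_left_mono) (auto simp: not_less)
          have "ennreal t < ennreal c * (\<Sum>A\<in>(UNIV::'n set set). \<Sum>k\<le>2 * K. grid_term d ((1/2) ^ K)
              (grid_shift ((1/2) ^ K) (2 * K) A) (\<lambda>i y. ennreal (norm (f i y))) k x)"
            unfolding c_def m_def
            by (rule less_le_trans[OF K0[OF that] integral_kernel_annulus_le]) (use f d in \<open>simp_all add: m_def\<close>)
          also note le
          finally show False by (simp add: b(2))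
        qed
        then show "x \<in> (\<Union>K. H K)" unfolding H_def by blast
      qed
      \<comment> \<open>Monotonicity of the integral suffices here, without measurability of the
        level set on the left.\<close>
      then have "weighted_measure u {x. norm (multilinear_frac_integral \<alpha> f x) > t} \<le> (\<integral>\<^sup>+x\<in>(\<Union>K. H K). ennreal (u x) \<partial>lebesgue)"
        unfolding weighted_measure_def by (intro nn_integral_mono) (auto split: split_indicator)
      also have "\<dots> = emeasure \<mu> (\<Union>K. H K)" using Hs by (intro mu[symmetric]) auto
      also note lim
      finally have "ennreal t * weighted_measure u {x. norm (multilinear_frac_integral \<alpha> f x) > t} ^ m \<le> ennreal t * ennreal q ^ m"
        by (intro mult_left_mono power_mono_ennreal) auto
      also have "\<dots> = ennreal (t * (K1 * p / b))"
        using q t K1 p b(1) m unfolding q_def by (simp add: ennreal_power ennreal_mult'[symmetric])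
      also have "t * (K1 * p / b) = c * K1 * p" unfolding b_def using t c by simp
      finally show ?thesis using p c K1 by (simp add: ennreal_mult)
    qed
    show "weak_Lnorm (1 / real CARD('m)) u (multilinear_frac_integral \<alpha> f)
      \<le> ennreal (c * K1) * (\<Prod>i\<in>UNIV. \<integral>\<^sup>+ x. ennreal (norm (f i x)) * frac_maximal (\<alpha> / real CARD('m)) (V i) x \<partial>lebesgue)"
      unfolding weak_Lnorm_def
    proof (rule SUP_least)
      fix t :: real assume "t \<in> {0<..}"
      then show "ennreal t * ennreal_powr (weighted_measure u {x. norm (multilinear_frac_integral \<alpha> f x) > t}) (1 / (1 / real CARD('m)))
        \<le> ennreal (c * K1) * (\<Prod>i\<in>UNIV. \<integral>\<^sup>+ x. ennreal (norm (f i x)) * frac_maximal (\<alpha> / real CARD('m)) (V i) x \<partial>lebesgue)"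
        using level[of t] m unfolding P_def \<beta>_def m_def by (simp add: ennreal_powr_of_nat)
    qed
  qed
qed

theorem theorem2p21:
  fixes \<alpha> \<delta> :: real
  assumes "0 < \<alpha>" and "\<alpha> < real CARD('n::finite) * real CARD('m::finite)" and "0 < \<delta>"
  shows "\<exists>C::real. C > 0 \<and>
    (\<forall>(w :: 'm \<Rightarrow> real^'n \<Rightarrow> real) (u :: real^'n \<Rightarrow> real) (f :: 'm \<Rightarrow> real^'n \<Rightarrow> complex).
      (\<forall>i. weight (w i)) \<longrightarrow>
      u = (\<lambda>x. \<Prod>i\<in>UNIV. w i x powr (1 / real CARD('m))) \<longrightarrow>
      f \<in> frac_integral_domain \<alpha> \<longrightarrow>
        weak_Lnorm (1 / real CARD('m)) u (multilinear_frac_integral \<alpha> f)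
          \<le> ennreal C * (\<Prod>i\<in>UNIV. \<integral>\<^sup>+ x. ennreal (norm (f i x)) *
                frac_maximal (\<alpha> / real CARD('m)) (LlogL_maximal \<delta> (w i)) x \<partial>lebesgue)
      \<and> weak_Lnorm (1 / real CARD('m)) u (multilinear_frac_integral \<alpha> f)
          \<le> ennreal C * (\<Prod>i\<in>UNIV. \<integral>\<^sup>+ x. ennreal (norm (f i x)) *
                frac_maximal (\<alpha> / real CARD('m))
                  (HL_maximal (HL_maximal (\<lambda>z. ennreal (w i z)))) x \<partial>lebesgue))"
proof -
  obtain K1 where K1: "0 < K1" "\<And>(w :: 'm \<Rightarrow> real^'n \<Rightarrow> real) u f V. \<forall>i. weight (w i) \<Longrightarrow>
      u = (\<lambda>x. \<Prod>i\<in>UNIV. w i x powr (1 / real CARD('m))) \<Longrightarrow> \<forall>i. f i \<in> borel_measurable lebesgue \<Longrightarrow>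
      \<forall>i. grid_dominated (LlogL_const \<delta>) \<delta> (\<lambda>x. ennreal (w i x)) (V i) \<Longrightarrow>
      weak_Lnorm (1 / real CARD('m)) u (multilinear_frac_integral \<alpha> f) \<le> ennreal K1 *
        (\<Prod>i\<in>UNIV. \<integral>\<^sup>+ x. ennreal (norm (f i x)) * frac_maximal (\<alpha> / real CARD('m)) (V i) x \<partial>lebesgue)"
    using weak_type_of_grid_dominated[OF assms(1,2,3) LlogL_const_pos[of \<delta>]] by blast
  \<comment> \<open>For M(M w) the decay exponent is 1 whatever \<delta> is given.\<close>
  obtain K2 where K2: "0 < K2" "\<And>(w :: 'm \<Rightarrow> real^'n \<Rightarrow> real) u f V. \<forall>i. weight (w i) \<Longrightarrow>
      u = (\<lambda>x. \<Prod>i\<in>UNIV. w i x powr (1 / real CARD('m))) \<Longrightarrow> \<forall>i. f i \<in> borel_measurable lebesgue \<Longrightarrow>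
      \<forall>i. grid_dominated 4 1 (\<lambda>x. ennreal (w i x)) (V i) \<Longrightarrow>
      weak_Lnorm (1 / real CARD('m)) u (multilinear_frac_integral \<alpha> f) \<le> ennreal K2 *
        (\<Prod>i\<in>UNIV. \<integral>\<^sup>+ x. ennreal (norm (f i x)) * frac_maximal (\<alpha> / real CARD('m)) (V i) x \<partial>lebesgue)"
    using weak_type_of_grid_dominated[OF assms(1,2), of 1 4] by auto
  show ?thesis
  proof (intro exI[of _ "max K1 K2"] conjI allI impI)
    show "0 < max K1 K2" using K1(1) by simp
    fix w :: "'m \<Rightarrow> real^'n \<Rightarrow> real" and u and f :: "'m \<Rightarrow> real^'n \<Rightarrow> complex"
    assume w: "\<forall>i. weight (w i)" and u: "u = (\<lambda>x. \<Prod>i\<in>UNIV. w i x powr (1 / real CARD('m)))"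
      and "f \<in> frac_integral_domain \<alpha>"
    then have f: "\<forall>i. f i \<in> borel_measurable lebesgue" unfolding frac_integral_domain_def by blast
    have wm: "(\<lambda>x. ennreal (w i x)) \<in> borel_measurable lebesgue" for i using w unfolding weight_def by simp
    show "weak_Lnorm (1 / real CARD('m)) u (multilinear_frac_integral \<alpha> f)
          \<le> ennreal (max K1 K2) * (\<Prod>i\<in>UNIV. \<integral>\<^sup>+ x. ennreal (norm (f i x)) *
                frac_maximal (\<alpha> / real CARD('m)) (LlogL_maximal \<delta> (w i)) x \<partial>lebesgue)"
      using w grid_dominated_LlogL[OF _ assms(3)]
      by (intro order_trans[OF K1(2)[OF w u f, of "\<lambda>i. LlogL_maximal \<delta> (w i)"]] mult_right_mono ennreal_leI) auto
    show "weak_Lnorm (1 / real CARD('m)) u (multilinear_frac_integral \<alpha> f)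
          \<le> ennreal (max K1 K2) * (\<Prod>i\<in>UNIV. \<integral>\<^sup>+ x. ennreal (norm (f i x)) *
                frac_maximal (\<alpha> / real CARD('m)) (HL_maximal (HL_maximal (\<lambda>z. ennreal (w i z)))) x \<partial>lebesgue)"
      using grid_dominated_HL[OF wm]
      by (intro order_trans[OF K2(2)[OF w u f, of "\<lambda>i. HL_maximal (HL_maximal (\<lambda>z. ennreal (w i z)))"]]
          mult_right_mono ennreal_leI) auto
  qed
qed

end
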